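(* Let $a$ be a real number in the interval $(-1,1)$. In the bulk scaling limit around $a\sqrt{2N}$ the Dyson Brownian minor kernel $K^{\mathcal{DBM}}$ converges to a time-dependent bead kernel with parameter $a$. More precisely, $$K^{\mathrm{Bead}}_a((n,x,t),(n',x',t'))=\lim_{N\to\infty}e^{-N(t'-t)}\,(4N)^{\frac12(n-n')}(2N)^{-\frac12}\,K^{\mathcal{DBM}}\Big(\big(N+n,\ \sqrt{2N}a+\tfrac{x}{\sqrt{2N}},\ \tfrac{t}{2N}\big),\big(N+n',\ \sqrt{2N}a+\tfrac{x'}{\sqrt{2N}},\ \tfrac{t'}{2N}\big)\Big)$$ for $$K^{\mathrm{Bead}}_a((n,x,t),(n',x',t')):=-\phi^{\mathrm{Bead}}_a((n,x,t),(n',x',t'))+\frac1{2\pi i}\int_{u_-}^{u_+}u^{n'-n}e^{\frac12(t'-t)(u^2-2au)+u(x-x')}\,du,$$ where $$\phi^{\mathrm{Bead}}_a((n,x,t),(n',x',t'))=\begin{cases}\displaystyle 2^{\frac12(n-n')}\int_{\mathbb{R}}H^{n-n'}(x-y)\,p_{\frac12(t'-t)}(y,x'-a(t'-t))\,dy,&(n,t)<(n',t'),\\0,&\text{otherwise.}\end{cases}$$ The limit holds uniformly on compact sets, and the contour of integration in the integral defining $K^{\mathrm{Bead}}_a$ is the straight line between $u_-$ and $u_+$, where $u_\pm=a\pm i\sqrt{1-a^2}$ are two points on the unit circle.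
   Context: Order: $(n,t)<(n',t')$ means that either $n>n'$, or $n=n'$ and $t<t'$; and $(n,t)\ge(n',t')$ is its negation. $H^n(x)=\frac{x^{n-1}}{(n-1)!}\mathbf 1\{x\ge0\}$ for $n\ge1$, and $H^0=\delta$ is the Dirac delta. $p_t(x,y)=\frac1{\sqrt{\pi t}}e^{-(y-x)^2/t}$ for $t>0$ (transition density of Brownian motion with variance $t/2$); $p_0(x,y)$ is read as $\delta(x-y)$. Normalised Hermite polynomials: $h^*_n(x)=[\sqrt\pi\,n!\,2^n]^{-1/2}(-1)^n e^{x^2}\frac{d^n}{dx^n}e^{-x^2}$ for $n\ge0$, and $h^*_n\equiv0$ for $n<0$ (terms of a sum containing an $h^*$ with negative index are zero). Dyson Brownian minor kernel: $$K^{\mathcal{DBM}}((n,x,t),(n',x',t'))=\begin{cases}\displaystyle\sum_{l=-\infty}^{-1}\sqrt{\frac{(n'+l)!}{(n+l)!}}\;e^{-l(t'-t)}h^*_{n+l}(x)h^*_{n'+l}(x')e^{-(x')^2},&(n,t)\ge(n',t'),\\[2mm]\displaystyle-\sum_{l=0}^{\infty}\sqrt{\frac{(n'+l)!}{(n+l)!}}\;e^{-l(t'-t)}h^*_{n+l}(x)h^*_{n'+l}(x')e^{-(x')^2},&(n,t)<(n',t').\end{cases}$$ Here $n,n'\in\mathbb{N}$ and $x,x',t,t'\in\mathbb{R}$. Compact sets refer to the topology on $(\mathbb{N}\times\mathbb{R}^2)^2$ that is the product of the discrete topology on $\mathbb{N}$ and the Euclidean topology on $\mathbb{R}$. Both kernels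 are used only along space-like paths, i.e. at pairs of points for which the level does not increase as time increases.
   Formalization: Corrected: the prefactor is e^{-(t'-t)/2} N^{(n-n')/2}; phi has no power of 2 and uses p_{2(t'-t)}(y, x'+a(t'-t)); for n>n' and a<=0 the contour is the unit-circle arc through 1; points with n=n'+1, t=t', x=x' are excluded. *)

theory Defs
  imports "HOL-Complex_Analysis.Complex_Analysis"
begin

text \<open>A point \<open>(n, x, t)\<close> consists of a level, a position and a time.\<close>

type_synonym point = "nat \<times> real \<times> real"

definition precedes :: "point \<Rightarrow> point \<Rightarrow> bool" where
  "precedes = (\<lambda>(n, x, t) (n', x', t'). n > n' \<or> (n = n' \<and> t < t'))"

text \<open>Two points can lie on a common space-like path iff the level does not increase as time
  increases.\<close>

definition space_like :: "point \<Rightarrow> point \<Rightarrow> bool" where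
  "space_like = (\<lambda>(n, x, t) (n', x', t'). (t < t' \<longrightarrow> n \<ge> n') \<and> (t' < t \<longrightarrow> n' \<ge> n))"

text \<open>The jump of \<open>H 1\<close>: here the series defining the Dyson Brownian minor kernel converges to the
  mean of its two one-sided limits, whereas \<open>H 1 0 = 1\<close>.\<close>

definition at_jump :: "point \<Rightarrow> point \<Rightarrow> bool" where
  "at_jump = (\<lambda>(n, x, t) (n', x', t'). n = n' + 1 \<and> t = t' \<and> x = x')"

definition hermite_star :: "int \<Rightarrow> real \<Rightarrow> real" where
  "hermite_star k x =
     (if k < 0 then 0
      else (sqrt pi * fact (nat k) * 2 ^ nat k) powr (-1/2) * (-1) ^ nat k * exp (x\<^sup>2) *
           (deriv ^^ nat k) (\<lambda>y. exp (- (y\<^sup>2))) x)"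

text \<open>If \<open>n + l < 0\<close> or \<open>n' + l < 0\<close>, the term is \<open>0\<close> because of \<open>hermite_star\<close>, whatever value
  \<open>nat\<close> gives to the factorials.\<close>

definition DBM_term :: "point \<Rightarrow> point \<Rightarrow> int \<Rightarrow> real" where
  "DBM_term = (\<lambda>(n, x, t) (n', x', t') l.
     sqrt (fact (nat (int n' + l)) / fact (nat (int n + l))) * exp (- of_int l * (t' - t)) *
     hermite_star (int n + l) x * hermite_star (int n' + l) x' * exp (- (x'\<^sup>2)))"

text \<open>The sum over \<open>l \<ge> 0\<close> is the limit of its partial sums; it need not converge absolutely.\<close>

definition K_DBM :: "point \<Rightarrow> point \<Rightarrow> real" where
  "K_DBM p p' =
     (if precedes p p' then - (\<Sum>j. DBM_term p p' (int j))
      else (\<Sum>j. DBM_term p p' (- 1 - int j)))"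

text \<open>\<open>H n\<close> for \<open>n \<ge> 1\<close>; the distribution \<open>H\<^sup>0 = \<delta>\<close> enters through \<open>H_conv\<close> below.\<close>

definition H :: "nat \<Rightarrow> real \<Rightarrow> real" where
  "H n x = (if x \<ge> 0 then x ^ (n - 1) / fact (n - 1) else 0)"

definition bm_density :: "real \<Rightarrow> real \<Rightarrow> real \<Rightarrow> real" where
  "bm_density t x y = exp (- ((y - x)\<^sup>2 / t)) / sqrt (pi * t)"

text \<open>The integral of \<open>H\<^sup>k(x - y) p\<^sub>s(y, z)\<close> over \<open>y\<close>, where \<open>H\<^sup>0 = \<delta>\<close> and \<open>p\<^sub>0(y, z) = \<delta>(y - z)\<close>.
  The case \<open>k = 0\<close>, \<open>s = 0\<close> is not used.\<close>

definition H_conv :: "nat \<Rightarrow> real \<Rightarrow> real \<Rightarrow> real \<Rightarrow> real" where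
  "H_conv k s x z =
     (if k = 0 then bm_density s x z
      else if s = 0 then H k (x - z)
      else (\<integral>y. H k (x - y) * bm_density s y z \<partial>lborel))"

text \<open>The variance and the drift are those of the integral in \<open>K_Bead\<close> below: for \<open>n = n'\<close> and
  \<open>s = t' - t > 0\<close>, integrating over the whole line \<open>Re u = a\<close> gives
  \<open>bm_density (2 * s) x (x' + a * s)\<close>. Mehler's formula for the Dyson Brownian minor kernel gives
  the same limit.\<close>

definition phi_Bead :: "real \<Rightarrow> point \<Rightarrow> point \<Rightarrow> real" where
  "phi_Bead a p p' =
     (if precedes p p' then
        (case (p, p') of ((n, x, t), (n', x', t')) \<Rightarrow>
           H_conv (n - n') (2 * (t' - t)) x (x' + a * (t' - t)))
      else 0)"

definition u_minus :: "real \<Rightarrow> complex" where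
  "u_minus a = Complex a (- sqrt (1 - a\<^sup>2))"

definition u_plus :: "real \<Rightarrow> complex" where
  "u_plus a = Complex a (sqrt (1 - a\<^sup>2))"

text \<open>For \<open>n > n'\<close> the integrand has a pole at \<open>0\<close>, and the contour has to pass to the right of it.
  The segment does so iff \<open>a > 0\<close>; for \<open>a \<le> 0\<close> it is replaced by the arc of the unit circle
  through \<open>1\<close>. For \<open>n \<le> n'\<close> the integrand is entire.\<close>

definition bead_contour :: "real \<Rightarrow> nat \<Rightarrow> nat \<Rightarrow> real \<Rightarrow> complex" where
  "bead_contour a n n' =
     (if a > 0 \<or> n \<le> n' then linepath (u_minus a) (u_plus a)
      else part_circlepath 0 1 (- arccos a) (arccos a))"

definition K_Bead :: "real \<Rightarrow> point \<Rightarrow> point \<Rightarrow> complex" where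
  "K_Bead a p p' =
     - of_real (phi_Bead a p p') +
     (case (p, p') of ((n, x, t), (n', x', t')) \<Rightarrow>
        1 / (2 * of_real pi * \<i>) *
        contour_integral (bead_contour a n n')
          (\<lambda>u. u powi (int n' - int n) *
               exp (of_real ((t' - t) / 2) * (u\<^sup>2 - 2 * of_real a * u) + u * of_real (x - x'))))"

end

theory Submission
  imports Defs "HOL-Probability.Probability"
begin

text \<open>
  The coefficients of \<open>F z = exp (2 * X * \<rho> * z - \<rho>\<^sup>2 * z\<^sup>2)\<close> give
  one Hermite factor of the kernel, Gaussian moments along a vertical line give the other. In the bulk
  scaling the unit circle \<open>z = cis \<theta>\<close> and the line \<open>Re u = a\<close> are the
  right contours as they stand: up to bounded factors the integrand is at most \<open>exp (- N * (cos
  \<theta> - a)\<^sup>2)\<close> on the circle and \<open>exp (- N * (\<bar>u\<bar> - 1)\<^sup>2 /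
  2)\<close> on the line, and they cross at \<open>u_minus a\<close> and \<open>u_plus a\<close>.

  Truncating the Taylor series of \<open>F\<close> at degree \<open>m\<close> leaves \<open>F u\<close>
  for \<open>\<bar>u\<bar> < 1\<close> and \<open>0\<close> for \<open>\<bar>u\<bar> > 1\<close>, up to
  a Cauchy integral over the circle. Hence the finite sum is the integral over the part
  \<open>\<bar>u\<bar> < 1\<close> of the line plus a double integral with the singularity \<open>1 / (u
  - z)\<close>, which is \<open>O(1 / sqrt N)\<close>; the infinite sum is the integral over the part
  \<open>\<bar>u\<bar> > 1\<close> minus the same error. For \<open>t < t'\<close> the part
  \<open>\<bar>u\<bar> > 1\<close> and the bead contour together are equivalent to a line \<open>Re u =
  c > 0\<close>, where expanding \<open>1 / u ^ k\<close> as a Laplace transform produces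
  \<open>phi_Bead\<close>.

  For \<open>t = t'\<close> and \<open>n > n'\<close> the series need not converge absolutely. Its
  convergence follows from the same error estimate with the truncation degree tending to infinity, and
  the bound from that for \<open>t < t'\<close> by Abel's limit theorem.
\<close>

section \<open>Hermite polynomials and their generating function\<close>

text \<open>The Gaussian moments do not depend on the abscissa of the line, so it may be put at Re u
  = a; rescaling by \<rho> = sqrt (N / 2) moves the saddle points to the fixed places
  \<open>u_minus a\<close> and \<open>u_plus a\<close>. There the two Hermite factors have the sizes
  exp (N a^2 + N / 2) and exp (- N a^2 - N / 2), which cancel. Because |a| < 1, line and circle
  cross transversally, which makes the singularity of 1 / (u - z) integrable in the two variables.

  The obstacle is uniformity. For n = n' the kernels blow up at x = x' as t' - t decreases to 0, and
  for n = n' + 1 the limit at equal times jumps at x = x'. Hence all constants are kept independent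
  of t' - t > 0. The bound at equal times is then the limit, at fixed N, of a bound K / sqrt N; for
  this, pointwise convergence of both kernels is enough, and no uniformity near the jump is
  required. At the jump itself the argument stops: the half-line integrals of 1 / u have no
  oscillating factor, and \<open>H_conv\<close> tends to 1/2 and not to
  \<open>H 1 0\<close>.\<close>

fun herm :: "nat \<Rightarrow> 'a::comm_ring_1 \<Rightarrow> 'a" where
  "herm 0 x = 1"
| "herm (Suc 0) x = 2 * x"
| "herm (Suc (Suc n)) x = 2 * x * herm (Suc n) x - 2 * of_nat (Suc n) * herm n x"

text \<open>At n = 0 the truncated index n - 1 carries the coefficient 0, so one recursion serves
  all n.\<close>

lemma herm_Suc: "herm (Suc n) x = 2 * x * herm n x - 2 * of_nat n * herm (n - 1) x"
  by (cases n) auto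

text \<open>\<open>herm\<close> is polymorphic because the derivatives of the generating function
  contain it at a complex argument; at the origin that argument is real again.\<close>

lemma herm_of_real: "herm n (of_real x :: 'a::{real_algebra_1,comm_ring_1}) = of_real (herm n x)"
  by (induction n x rule: herm.induct) auto

lemma herm_has_field_derivative:
  fixes x :: "'a::real_normed_field"
  shows "(herm n has_field_derivative (2 * of_nat n * herm (n - 1) x)) (at x)"
proof (induction n x rule: herm.induct)
  case (1 x)
  have "herm 0 = (\<lambda>x::'a. 1)" by auto
  then show ?case by simp
next
  case (2 x)
  have "herm (Suc 0) = (\<lambda>x::'a. 2 * x)" by auto
  then show ?case by (auto intro!: derivative_eq_intros)
next
  case (3 n x)
  have "herm (Suc (Suc n)) = (\<lambda>x::'a. 2 * x * herm (Suc n) x - 2 * of_nat (Suc n) * herm n x)"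
    by auto
  then show ?case
    using 3 by (auto intro!: derivative_eq_intros simp: herm_Suc[of n x] algebra_simps)
qed

text \<open>Rodrigues' formula: each differentiation of the Gaussian times \<open>herm n\<close>
  reproduces \<open>herm_Suc\<close> up to the sign.\<close>

lemma higher_deriv_gauss:
  fixes x :: real
  shows "(deriv ^^ n) (\<lambda>y. exp (- (y\<^sup>2))) x = (- 1) ^ n * herm n x * exp (- (x\<^sup>2))"
proof (induction n arbitrary: x)
  case (Suc n)
  have "((\<lambda>y. (- 1) ^ n * herm n y * exp (- (y\<^sup>2))) has_field_derivative
      (- 1) ^ Suc n * herm (Suc n) x * exp (- (x\<^sup>2))) (at x)"
    by (rule derivative_eq_intros herm_has_field_derivative refl)+
       (simp add: herm_Suc[of n x] algebra_simps power2_eq_square)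
  moreover have "(deriv ^^ n) (\<lambda>y. exp (- (y\<^sup>2))) = (\<lambda>y::real. (- 1) ^ n * herm n y * exp
      (- (y\<^sup>2)))"
    using Suc by auto
  ultimately show ?case
    by (simp add: DERIV_imp_deriv)
qed simp

lemma hermite_star_nat:
  "hermite_star (int n) x = herm n x / sqrt (sqrt pi * fact n * 2 ^ n)"
proof -
  have "(sqrt pi * fact n * 2 ^ n) powr (-1/2) = 1 / sqrt (sqrt pi * fact n * 2 ^ n)"
    by (simp add: powr_minus powr_half_sqrt field_simps)
  moreover have "(-1::real) ^ n * exp (x\<^sup>2) * ((-1) ^ n * herm n x * exp (- (x\<^sup>2))) =
      ((-1) ^ n * (-1) ^ n) * (exp (x\<^sup>2) * exp (- (x\<^sup>2))) * herm n x"
    by (simp only: ac_simps)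
  moreover have "(-1::real) ^ n * (-1) ^ n = 1" "exp (x\<^sup>2) * exp (- (x\<^sup>2)) = 1"
    by (simp_all flip: power_mult_distrib exp_add)
  ultimately show ?thesis
    unfolding hermite_star_def by (simp add: higher_deriv_gauss del: power_mult_distrib)
qed

text \<open>The classical generating function exp (2 X w - w^2) at w = \<rho> z; the scale \<rho> is
  chosen later so that the relevant radius becomes 1.\<close>

definition hgen :: "real \<Rightarrow> real \<Rightarrow> complex \<Rightarrow> complex" where
  "hgen X \<rho> z = exp (2 * of_real (X * \<rho>) * z - of_real (\<rho>\<^sup>2) * z\<^sup>2)"

definition hcoeff :: "real \<Rightarrow> real \<Rightarrow> nat \<Rightarrow> real" where
  "hcoeff X \<rho> j = \<rho> ^ j * herm j X / fact j"

lemma hgen_holomorphic [holomorphic_intros]: "hgen X \<rho> holomorphic_on S"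
  unfolding hgen_def by (intro holomorphic_intros)

text \<open>Recentring the generating function at z replaces X by X - \<rho> z. Only z = 0 is used
  afterwards, but the induction needs the formula at every z.\<close>

lemma higher_deriv_hgen:
  "(deriv ^^ n) (hgen X \<rho>) z = of_real \<rho> ^ n * herm n (of_real X - of_real \<rho> * z) * hgen X \<rho> z"
proof (induction n arbitrary: z)
  case (Suc n)
  have "((\<lambda>z. of_real \<rho> ^ n * herm n (of_real X - of_real \<rho> * z) * hgen X \<rho> z)
      has_field_derivative
      of_real \<rho> ^ Suc n * herm (Suc n) (of_real X - of_real \<rho> * z) * hgen X \<rho> z) (at z)"
    unfolding hgen_def
    by (rule derivative_eq_intros DERIV_chain2[OF herm_has_field_derivative] refl)+
       (simp add: herm_Suc[of n] algebra_simps power2_eq_square)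
  moreover have "(deriv ^^ n) (hgen X \<rho>) = (\<lambda>z. of_real \<rho> ^ n * herm n (of_real X - of_real
      \<rho> * z) * hgen X \<rho> z)"
    using Suc by auto
  ultimately show ?case
    by (simp add: DERIV_imp_deriv)
qed simp

lemma higher_deriv_hgen_0: "(deriv ^^ n) (hgen X \<rho>) 0 / fact n = of_real (hcoeff X \<rho> n)"
  by (simp add: higher_deriv_hgen hcoeff_def herm_of_real hgen_def)

lemma hcoeff_sums: "(\<lambda>n. of_real (hcoeff X \<rho> n) * z ^ n) sums hgen X \<rho> z"
  using holomorphic_power_series[OF hgen_holomorphic, of z 0 "norm z + 1" X \<rho>]
  by (simp add: higher_deriv_hgen_0)

lemma norm_hgen_le: "norm (hgen X \<rho> z) \<le> exp (2 * \<bar>X * \<rho>\<bar> * norm z + \<rho>\<^sup>2 *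
    (norm z)\<^sup>2)"
proof -
  have "norm (hgen X \<rho> z) = exp (Re (2 * of_real (X * \<rho>) * z - of_real (\<rho>\<^sup>2) * z\<^sup>2))"
    unfolding hgen_def by (rule norm_exp_eq_Re)
  also have "\<dots> \<le> exp (norm (2 * of_real (X * \<rho>) * z - of_real (\<rho>\<^sup>2) * z\<^sup>2))"
    by (simp only: exp_le_cancel_iff complex_Re_le_cmod)
  also have "\<dots> \<le> exp (2 * \<bar>X * \<rho>\<bar> * norm z + \<rho>\<^sup>2 * (norm z)\<^sup>2)"
    by (intro exp_le_cancel_iff[THEN iffD2] order.trans[OF norm_triangle_ineq4])
       (simp add: norm_mult norm_power abs_mult)
  finally show ?thesis .
qed

text \<open>Cauchy estimate on the circle of radius \<open>r\<close>; the choice \<open>q * r\<close> with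
  \<open>q > 1\<close> below makes the partial sums a geometric series.\<close>

lemma hcoeff_bound:
  assumes "0 < r"
  shows "\<bar>hcoeff X \<rho> n\<bar> \<le> exp (2 * \<bar>X * \<rho>\<bar> * r + \<rho>\<^sup>2 * r\<^sup>2)
      / r ^ n"
proof -
  have "norm ((deriv ^^ n) (hgen X \<rho>) 0) \<le> fact n * exp (2 * \<bar>X * \<rho>\<bar> * r +
      \<rho>\<^sup>2 * r\<^sup>2) / r ^ n"
    using assms norm_hgen_le[of X \<rho>]
    by (intro Cauchy_inequality hgen_holomorphic holomorphic_on_imp_continuous_on) auto
  moreover have "norm ((deriv ^^ n) (hgen X \<rho>) 0) = fact n * \<bar>hcoeff X \<rho> n\<bar>"
    using arg_cong[OF higher_deriv_hgen_0[of n X \<rho>], of norm]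
    by (simp add: norm_divide field_simps)
  ultimately have "fact n * \<bar>hcoeff X \<rho> n\<bar> \<le> fact n * (exp (2 * \<bar>X * \<rho>\<bar> * r +
      \<rho>\<^sup>2 * r\<^sup>2) / r ^ n)"
    by simp
  then show ?thesis
    by (simp only: mult_le_cancel_left_pos fact_gt_zero)
qed

lemma hcoeff_sum_bound:
  assumes "1 < q"
  shows "(\<Sum>j<M. \<bar>hcoeff X \<rho> j\<bar> * r ^ j) \<le> exp (2 * \<bar>X * \<rho>\<bar> * (q *
      \<bar>r\<bar>) + \<rho>\<^sup>2 * (q * \<bar>r\<bar>)\<^sup>2) * (q / (q - 1))"
    (is "_ \<le> ?B * _")
proof (cases "r = 0")
  case True
  have "(\<Sum>j<M. \<bar>hcoeff X \<rho> j\<bar> * r ^ j) \<le> 1"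
    by (cases M) (auto simp: True hcoeff_def sum.lessThan_Suc_shift)
  also have "1 \<le> ?B * (q / (q - 1))"
    using assms True by (simp add: field_simps)
  finally show ?thesis .
next
  case False
  have "(\<Sum>j<M. \<bar>hcoeff X \<rho> j\<bar> * r ^ j) \<le> (\<Sum>j<M. ?B * (1 / q) ^ j)"
  proof (rule sum_mono)
    fix j
    have "\<bar>hcoeff X \<rho> j\<bar> * r ^ j \<le> \<bar>hcoeff X \<rho> j\<bar> * \<bar>r\<bar> ^ j"
      by (intro mult_left_mono) (auto simp flip: power_abs)
    also have "\<dots> \<le> ?B / (q * \<bar>r\<bar>) ^ j * \<bar>r\<bar> ^ j"
      using assms False by (intro mult_right_mono hcoeff_bound) auto
    also have "\<dots> = ?B * (1 / q) ^ j"
      using assms False by (simp add: power_mult_distrib power_divide)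
    finally show "\<bar>hcoeff X \<rho> j\<bar> * r ^ j \<le> ?B * (1 / q) ^ j" .
  qed
  also have "\<dots> = ?B * (\<Sum>j<M. (1 / q) ^ j)"
    by (simp add: sum_distrib_left)
  also have "(\<Sum>j<M. (1 / q) ^ j) \<le> (\<Sum>j. (1 / q) ^ j)"
    using assms by (intro sum_le_suminf summable_geometric) auto
  also have "(\<Sum>j. (1 / q) ^ j) = q / (q - 1)"
    using assms by (subst suminf_geometric) (auto simp: field_simps)
  finally show ?thesis
    by simp
qed

section \<open>Gaussian integrals along vertical lines\<close>

text \<open>On a vertical line the modulus is a Gaussian in the imaginary part with rate \<sigma> /
  2. The family is closed under products, so the two Hermite factors merge into one member of
  it.\<close>

definition gexp :: "real \<Rightarrow> real \<Rightarrow> complex \<Rightarrow> complex" where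
  "gexp \<beta> \<sigma> u = exp (of_real \<beta> * u + of_real \<sigma> / 2 * u\<^sup>2)"

lemma gexp_holomorphic [holomorphic_intros]: "gexp \<beta> \<sigma> holomorphic_on S"
  unfolding gexp_def by (intro holomorphic_intros) auto

lemma gexp_continuous [continuous_intros]:
  "continuous_on S f \<Longrightarrow> continuous_on S (\<lambda>x. gexp \<beta> \<sigma> (f x))"
  unfolding gexp_def by (intro continuous_intros) auto

lemma gexp_mult: "gexp \<beta> \<sigma> u * gexp \<beta>' \<sigma>' u = gexp (\<beta> + \<beta>') (\<sigma> +
    \<sigma>') u"
  by (simp add: gexp_def algebra_simps add_divide_distrib flip: exp_add)

text \<open>The quadratic coefficient is negative: \<open>hgen\<close> grows on vertical lines like
  exp (\<rho>^2 v^2). Its product with a Gaussian weight of coefficient 2 \<kappa>^2 decays iff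
  \<rho> < \<kappa>, which later means t < t'.\<close>

lemma hgen_eq_gexp: "hgen X \<rho> = gexp (2 * X * \<rho>) (- 2 * \<rho>\<^sup>2)"
  by (rule ext) (simp add: hgen_def gexp_def algebra_simps)

lemma norm_gexp: "norm (gexp \<beta> \<sigma> (Complex a v)) = exp (\<beta> * a + \<sigma> / 2 * (a\<^sup>2 -
    v\<^sup>2))"
  by (simp add: gexp_def norm_exp_eq_Re power2_eq_square)

lemma Complex_continuous [continuous_intros]:
  "continuous_on S f \<Longrightarrow> continuous_on S (\<lambda>x. Complex a (f x))"
  unfolding Complex_eq by (intro continuous_intros)

lemma Complex_measurable [measurable (raw)]:
  "f \<in> borel_measurable M \<Longrightarrow> (\<lambda>x. Complex a (f x)) \<in> borel_measurable M"
  unfolding Complex_eq by measurable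

lemma gexp_measurable [measurable (raw)]:
  "f \<in> borel_measurable M \<Longrightarrow> (\<lambda>x. gexp \<beta> \<sigma> (f x)) \<in> borel_measurable M"
  by (rule measurable_compose[where N=borel])
     (auto intro!: borel_measurable_continuous_onI continuous_intros)

lemma integrable_gauss:
  fixes c :: real
  assumes "0 < c"
  shows "integrable lborel (\<lambda>v. exp (- (c * v\<^sup>2)))"
    and "(LBINT v. exp (- (c * v\<^sup>2))) = sqrt (pi / c)"
proof -
  define d where "d = 1 / sqrt (2 * c)"
  have d: "0 < d" "d\<^sup>2 = 1 / (2 * c)"
    using assms by (auto simp: d_def power_divide)
  then have c: "c = 1 / (2 * d\<^sup>2)"
    using assms by (simp add: field_simps)
  have eq: "exp (- (c * v\<^sup>2)) = sqrt (pi / c) * normal_density 0 d v" for v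
    unfolding c using d(1) by (simp add: normal_density_def field_simps)
  show "integrable lborel (\<lambda>v. exp (- (c * v\<^sup>2)))"
    unfolding eq using d by (intro integrable_mult_right integrable_normal_density)
  show "(LBINT v. exp (- (c * v\<^sup>2))) = sqrt (pi / c)"
    unfolding eq using d by simp
qed

lemma exp_abs_gauss_le:
  fixes b c v :: real
  assumes "0 < c"
  shows "exp (b * \<bar>v\<bar> - c * v\<^sup>2) \<le> exp (b\<^sup>2 / (2 * c)) * exp (- (c / 2 * v\<^sup>2))"
proof -
  \<comment> \<open>Half of the quadratic term is used to complete the square, the other half stays
    for integrability.\<close>
  have "0 \<le> (b - c * \<bar>v\<bar>)\<^sup>2 / (2 * c)"
    using assms by simp
  also have "\<dots> = b\<^sup>2 / (2 * c) - b * \<bar>v\<bar> + c / 2 * v\<^sup>2"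
    using assms by (simp add: power2_eq_square field_simps flip: abs_mult)
  finally show ?thesis
    by (simp flip: exp_add)
qed

lemma integrable_exp_abs_gauss:
  fixes b c :: real
  assumes "0 < c"
  shows "integrable lborel (\<lambda>v. exp (b * \<bar>v\<bar> - c * v\<^sup>2))"
proof (rule Bochner_Integration.integrable_bound)
  show "integrable lborel (\<lambda>v. exp (b\<^sup>2 / (2 * c)) * exp (- (c / 2 * v\<^sup>2)))"
    using assms by (intro integrable_mult_right integrable_gauss) auto
qed (use exp_abs_gauss_le[OF assms] in auto)

text \<open>Bounding the polynomial factor by an exponential of |v| lets
  \<open>integrable_exp_abs_gauss\<close> handle all moments.\<close>

lemma norm_power_Complex_le: "norm (Complex a v ^ m) \<le> exp (real m * \<bar>a\<bar>) * exp (real m *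
    \<bar>v\<bar>)"
proof -
  have "norm (Complex a v) \<le> \<bar>a\<bar> + \<bar>v\<bar>"
    using cmod_le[of "Complex a v"] by simp
  also have "\<dots> \<le> exp (\<bar>a\<bar> + \<bar>v\<bar>)"
    using exp_ge_add_one_self[of "\<bar>a\<bar> + \<bar>v\<bar>"] by linarith
  finally have "norm (Complex a v) ^ m \<le> exp (\<bar>a\<bar> + \<bar>v\<bar>) ^ m"
    by (intro power_mono) auto
  then show ?thesis
    by (simp add: norm_power ring_distribs flip: exp_of_nat_mult exp_add)
qed

lemma norm_power_gexp_le:
  "norm (Complex a v ^ m * gexp \<beta> \<sigma> (Complex a v)) \<le>
     exp (real m * \<bar>a\<bar> + \<beta> * a + \<sigma> / 2 * a\<^sup>2) * exp (real m * \<bar>v\<bar> -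
         \<sigma> / 2 * v\<^sup>2)"
proof -
  have "norm (Complex a v ^ m * gexp \<beta> \<sigma> (Complex a v)) \<le>
      exp (real m * \<bar>a\<bar>) * exp (real m * \<bar>v\<bar>) * exp (\<beta> * a + \<sigma> / 2 *
          (a\<^sup>2 - v\<^sup>2))"
    unfolding norm_mult norm_gexp by (intro mult_right_mono norm_power_Complex_le) auto
  then show ?thesis
    by (simp add: algebra_simps flip: exp_add)
qed

lemma integrable_power_gexp:
  assumes "0 < \<sigma>"
  shows "integrable lborel (\<lambda>v. Complex a v ^ m * gexp \<beta> \<sigma> (Complex a v))"
proof (rule Bochner_Integration.integrable_bound)
  show "integrable lborel (\<lambda>v. exp (real m * \<bar>a\<bar> + \<beta> * a + \<sigma> / 2 * a\<^sup>2) *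
      exp (real m * \<bar>v\<bar> - \<sigma> / 2 * v\<^sup>2))"
    using assms by (intro integrable_mult_right integrable_exp_abs_gauss) auto
qed (use norm_power_gexp_le in auto)

text \<open>Scaling v by 1 / sqrt \<sigma> turns the integral into the characteristic function of
  the standard normal law at \<open>t\<close>. The abscissa a drops out, as it must for an entire
  integrand that decays vertically.\<close>

lemma integral_gexp:
  assumes "0 < \<sigma>"
  shows "(LBINT v. gexp \<beta> \<sigma> (Complex a v)) = of_real (sqrt (2 * pi / \<sigma>) * exp (-
      (\<beta>\<^sup>2 / (2 * \<sigma>))))"
proof -
  define t where "t = (\<beta> + \<sigma> * a) / sqrt \<sigma>"
  have t2: "t\<^sup>2 = (\<beta> + \<sigma> * a)\<^sup>2 / \<sigma>"
    using assms by (simp add: t_def power_divide)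
  have eq: "gexp \<beta> \<sigma> (Complex a (0 + 1 / sqrt \<sigma> * v)) =
      of_real (sqrt (2 * pi) * exp (\<beta> * a + \<sigma> / 2 * a\<^sup>2)) * (std_normal_density v *\<^sub>R
          iexp (t * v))" for v
  proof -
    have "of_real \<beta> * Complex a (1 / sqrt \<sigma> * v) + of_real \<sigma> / 2 * (Complex a (1 / sqrt
        \<sigma> * v))\<^sup>2 =
      of_real (\<beta> * a + \<sigma> / 2 * a\<^sup>2) + of_real (- v\<^sup>2 / 2) + \<i> * of_real (t * v)"
      using assms by (simp add: complex_eq_iff power2_eq_square t_def field_simps)
         (simp add: real_div_sqrt flip: mult.assoc)?
    then have "gexp \<beta> \<sigma> (Complex a (0 + 1 / sqrt \<sigma> * v)) =
       of_real (exp (\<beta> * a + \<sigma> / 2 * a\<^sup>2)) * of_real (exp (- v\<^sup>2 / 2)) * iexp (t * v)"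
      by (simp only: gexp_def exp_add exp_of_real add_0)
    moreover have "complex_of_real (exp (- v\<^sup>2 / 2)) = of_real (sqrt (2 * pi)) * of_real (std_normal_density v)"
      unfolding of_real_mult[symmetric] by (rule arg_cong[where f=of_real]) (simp add: std_normal_density_def)
    ultimately show ?thesis
      by (simp add: scaleR_conv_of_real mult_ac)
  qed
  have "(LBINT v. gexp \<beta> \<sigma> (Complex a v)) =
      (1 / sqrt \<sigma>) *\<^sub>R (LBINT v. gexp \<beta> \<sigma> (Complex a (0 + 1 / sqrt \<sigma> * v)))"
    using assms by (subst lborel_integral_real_affine[where c="1 / sqrt \<sigma>" and t=0]) auto
  also have "(LBINT v. gexp \<beta> \<sigma> (Complex a (0 + 1 / sqrt \<sigma> * v))) =
      of_real (sqrt (2 * pi) * exp (\<beta> * a + \<sigma> / 2 * a\<^sup>2)) * (LBINT v. std_normal_density v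
          *\<^sub>R iexp (t * v))"
    unfolding eq by (rule integral_mult_right_zero)
  also have "(LBINT v. std_normal_density v *\<^sub>R iexp (t * v)) = char std_normal_distribution t"
    unfolding char_def by (subst integral_density) auto
  also have "\<dots> = of_real (exp (- t\<^sup>2 / 2))"
    by (simp add: char_std_normal_distribution)
  finally have "(LBINT v. gexp \<beta> \<sigma> (Complex a v)) =
      of_real (1 / sqrt \<sigma> * sqrt (2 * pi) * (exp (\<beta> * a + \<sigma> / 2 * a\<^sup>2) * exp (-
          t\<^sup>2 / 2)))"
    by (simp add: scaleR_conv_of_real)
  also have "exp (\<beta> * a + \<sigma> / 2 * a\<^sup>2) * exp (- t\<^sup>2 / 2) = exp (- (\<beta>\<^sup>2 /
      (2 * \<sigma>)))"
    unfolding exp_add[symmetric] t2 using assms by (simp add: power2_eq_square field_simps)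
  finally show ?thesis
    by (simp add: real_sqrt_divide)
qed

lemma integral_derivative_eq_zero:
  fixes F f :: "real \<Rightarrow> complex"
  assumes "\<And>x. (F has_vector_derivative f x) (at x)" and "continuous_on UNIV f"
    and "integrable lborel f" and "(F \<longlongrightarrow> 0) at_top" "(F \<longlongrightarrow> 0) at_bot"
  shows "(LBINT x. f x) = 0"
proof -
  have "(LBINT x=-\<infinity>..\<infinity>. f x) = 0 - 0"
    using assms
    by (intro interval_integral_FTC_integrable[where F=F])
       (auto simp: set_integrable_def ereal_tendsto_simps continuous_on_eq_continuous_at)
  then show ?thesis
    by (simp add: interval_lebesgue_integral_def set_lebesgue_integral_def)
qed

lemma gauss_tendsto_0:
  fixes b c :: real
  assumes "0 < c"
  shows "((\<lambda>v. exp (b * \<bar>v\<bar> - c * v\<^sup>2)) \<longlongrightarrow> 0) at_top" "((\<lambda>v.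
      exp (b * \<bar>v\<bar> - c * v\<^sup>2)) \<longlongrightarrow> 0) at_bot"
proof -
  have *: "((\<lambda>v. exp (b * v - c * v\<^sup>2)) \<longlongrightarrow> 0) at_top"
    using assms by real_asymp
  show **: "((\<lambda>v. exp (b * \<bar>v\<bar> - c * v\<^sup>2)) \<longlongrightarrow> 0) at_top"
    by (rule Lim_transform_eventually[OF *]) (use eventually_ge_at_top[of 0] in eventually_elim, auto)
  show "((\<lambda>v. exp (b * \<bar>v\<bar> - c * v\<^sup>2)) \<longlongrightarrow> 0) at_bot"
    unfolding filterlim_at_bot_mirror using ** by simp
qed

text \<open>This supplies the second Hermite factor together with its weight
  \<open>exp (- X\<^sup>2)\<close>. The value is independent of a, which leaves the abscissa free to
  be adapted to the saddle points.\<close>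

lemma integral_power_gexp:
  assumes "0 < \<kappa>"
  shows "(LBINT v. Complex a v ^ m * gexp (- 2 * X * \<kappa>) (2 * \<kappa>\<^sup>2) (Complex a v)) =
    of_real (sqrt pi * exp (- (X\<^sup>2)) * herm m X / (2 ^ m * \<kappa> ^ (m + 1)))" (is "?I m = ?R m")
proof -
  let ?g = "gexp (- 2 * X * \<kappa>) (2 * \<kappa>\<^sup>2)"
  have int: "integrable lborel (\<lambda>v. Complex a v ^ m * ?g (Complex a v))" for m
    using assms by (intro integrable_power_gexp) auto
  have I0: "?I 0 = ?R 0"
  proof -
    have "?I 0 = of_real (sqrt (2 * pi / (2 * \<kappa>\<^sup>2)) * exp (- ((- 2 * X * \<kappa>)\<^sup>2 / (2 *
        (2 * \<kappa>\<^sup>2)))))"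
      using assms by (simp only: power_0 mult_1 integral_gexp zero_less_mult_iff zero_less_power)
        (subst integral_gexp, auto)
    also have "\<dots> = ?R 0"
      using assms by (simp add: real_sqrt_divide field_simps)
    finally show ?thesis .
  qed
  \<comment> \<open>The derivative of u^m g(u) integrates to 0 along the line. Since g' / g = 2
    \<kappa>^2 u - 2 X \<kappa>, this is the Hermite recursion up to scaling.\<close>
  have rec: "of_nat m * ?I (m - 1) + 2 * of_real \<kappa> ^ 2 * ?I (Suc m) - 2 * of_real (X * \<kappa>) * ?I m
      = 0" for m
  proof -
    let ?f = "\<lambda>v. of_nat m * (Complex a v ^ (m - 1) * ?g (Complex a v))
      + 2 * of_real \<kappa> ^ 2 * (Complex a v ^ Suc m * ?g (Complex a v))
      - 2 * of_real (X * \<kappa>) * (Complex a v ^ m * ?g (Complex a v))"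
    let ?F = "\<lambda>v. Complex a v ^ m * ?g (Complex a v)"
    have deriv: "(?F has_vector_derivative \<i> * ?f v) (at v)" for v
    proof -
      have "((\<lambda>u. u ^ m * ?g u) has_field_derivative
          (of_nat m * (u ^ (m - 1) * ?g u) + 2 * of_real \<kappa> ^ 2 * (u ^ Suc m * ?g u)
          - 2 * of_real (X * \<kappa>) * (u ^ m * ?g u))) (at u)" for u
        unfolding gexp_def
        by (rule derivative_eq_intros refl | simp)+ (simp add: algebra_simps)
      moreover have "(Complex a has_vector_derivative \<i>) (at v)"
        unfolding Complex_eq by (auto intro!: derivative_eq_intros)
      ultimately show ?thesis
        using field_vector_diff_chain_at[of "Complex a" \<i> v "\<lambda>u. u ^ m * ?g u"]
        by (auto simp: o_def)
    qed
    have bound: "norm (?F v) \<le> exp (real m * \<bar>a\<bar> + (- 2 * X * \<kappa>) * a + (2 *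
        \<kappa>\<^sup>2) / 2 * a\<^sup>2) *
         exp (real m * \<bar>v\<bar> - \<kappa>\<^sup>2 * v\<^sup>2)" for v
      using norm_power_gexp_le[of a v m "- 2 * X * \<kappa>" "2 * \<kappa>\<^sup>2"] by simp
    have "(LBINT v. \<i> * ?f v) = 0"
    proof (rule integral_derivative_eq_zero[OF deriv])
      show "continuous_on UNIV (\<lambda>v. \<i> * ?f v)"
        by (intro continuous_intros)
      show "integrable lborel (\<lambda>v. \<i> * ?f v)"
        by (intro integrable_mult_right Bochner_Integration.integrable_diff Bochner_Integration.integrable_add int)
      show "(?F \<longlongrightarrow> 0) at_top"
        by (rule Lim_null_comparison[OF always_eventually[OF allI[OF bound]]])
           (use assms in \<open>intro tendsto_mult_right_zero gauss_tendsto_0, simp\<close>)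
      show "(?F \<longlongrightarrow> 0) at_bot"
        by (rule Lim_null_comparison[OF always_eventually[OF allI[OF bound]]])
           (use assms in \<open>intro tendsto_mult_right_zero gauss_tendsto_0, simp\<close>)
    qed
    then have "(LBINT v. ?f v) = 0"
      by simp
    then show ?thesis
      by (simp only: Bochner_Integration.integral_diff Bochner_Integration.integral_add
            integral_mult_right_zero int integrable_mult_right Bochner_Integration.integrable_add)
  qed
  have step: "?I (Suc m) = ?R (Suc m)" if "?I m = ?R m" "0 < m \<Longrightarrow> ?I (m - 1) = ?R (m - 1)" for m
  proof -
    have "2 * of_real \<kappa> ^ 2 * ?I (Suc m) = 2 * of_real (X * \<kappa>) * ?R m - of_nat m * ?R (m - 1)"
      using rec[of m] that by (cases "m = 0") (auto simp: algebra_simps)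
    also have "\<dots> = of_real (2 * (X * \<kappa>) * (sqrt pi * exp (- (X\<^sup>2)) * herm m X / (2 ^ m *
        \<kappa> ^ (m + 1)))
        - real m * (sqrt pi * exp (- (X\<^sup>2)) * herm (m - 1) X / (2 ^ (m - 1) * \<kappa> ^ (m - 1 + 1))))"
      by simp
    also have "2 * (X * \<kappa>) * (sqrt pi * exp (- (X\<^sup>2)) * herm m X / (2 ^ m * \<kappa> ^ (m + 1)))
        - real m * (sqrt pi * exp (- (X\<^sup>2)) * herm (m - 1) X / (2 ^ (m - 1) * \<kappa> ^ (m - 1 + 1)))
        = 2 * \<kappa> ^ 2 * (sqrt pi * exp (- (X\<^sup>2)) * herm (Suc m) X / (2 ^ Suc m * \<kappa> ^ (Suc m + 1)))"
      using assms by (cases m) (simp_all add: field_simps power2_eq_square)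
    finally have "2 * complex_of_real \<kappa> ^ 2 * ?I (Suc m) = 2 * of_real \<kappa> ^ 2 * ?R (Suc m)"
      by simp
    then show ?thesis
      by (rule mult_left_cancel[THEN iffD1, rotated]) (use assms in auto)
  qed
  \<comment> \<open>The recursion reaches back two indices, so consecutive pairs are carried
    along.\<close>
  have "?I m = ?R m \<and> ?I (Suc m) = ?R (Suc m)" for m
    by (induction m) (use I0 step[of 0] step[of "Suc _"] in auto)
  then show ?thesis by blast
qed

section \<open>Truncated Taylor series\<close>

text \<open>Hermite's contour form of the Taylor remainder, divided by w^m. It is meaningful only
  off the circle, hence for almost every point of a vertical line.\<close>

definition ctail :: "(complex \<Rightarrow> complex) \<Rightarrow> nat \<Rightarrow> complex \<Rightarrow>
    complex" where
  "ctail f m w = 1 / (2 * of_real pi * \<i>) * contour_integral (circlepath 0 1) (\<lambda>z. f z / (z ^ m * (w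
      - z)))"

text \<open>The Cauchy integral over the unit circle jumps by \<open>f w\<close> as \<open>w\<close> crosses the
  circle. On the line \<open>Re w = a\<close> this cuts out exactly the segment between \<open>u_minus
  a\<close> and \<open>u_plus a\<close>.\<close>

lemma taylor_eq_ctail:
  assumes f: "f holomorphic_on UNIV" and w: "norm w \<noteq> 1"
  shows "(\<Sum>j<m. (deriv ^^ j) f 0 / fact j * w ^ j) = (if norm w < 1 then f w else 0) + w ^ m * ctail f m w"
proof -
  let ?c = "circlepath 0 1 :: real \<Rightarrow> complex"
  have f': "f holomorphic_on S" for S
    using f holomorphic_on_subset by blast
  have 1: "((\<lambda>z. f z / (w - z)) has_contour_integral - (2 * of_real pi * \<i> * (if norm w < 1 then f w
      else 0))) ?c"
  proof (cases "norm w < 1")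
    case True
    have "((\<lambda>u. - (f u / (u - w))) has_contour_integral - (2 * of_real pi * \<i> * f w)) ?c"
      by (intro has_contour_integral_neg Cauchy_integral_circlepath holomorphic_on_imp_continuous_on f')
         (use True in auto)
    moreover have "(\<lambda>u. - (f u / (u - w))) = (\<lambda>z. f z / (w - z))"
      by (auto simp: minus_divide_right)
    ultimately show ?thesis
      using True by simp
  next
    case False
    then have "((\<lambda>z. f z / (w - z)) has_contour_integral 0) ?c"
      using w by (intro Cauchy_theorem_convex_simple[where S="ball 0 (norm w)"] holomorphic_intros f') auto
    then show ?thesis
      using False by simp
  qed
  have 2: "((\<lambda>z. w ^ j * (f z / z ^ Suc j)) has_contour_integral
      w ^ j * (2 * of_real pi * \<i> / fact j * (deriv ^^ j) f 0)) ?c" for j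
    using Cauchy_has_contour_integral_higher_derivative_circlepath[of 0 1 f 0 j] f'
    by (intro has_contour_integral_lmul) (simp add: holomorphic_on_imp_continuous_on)
  \<comment> \<open>The Taylor coefficients are the integrals of a partial geometric series in w /
    z; added to the Cauchy kernel they leave the single factor (w / z)^m.\<close>
  have "((\<lambda>z. f z / (w - z) + (\<Sum>j<m. w ^ j * (f z / z ^ Suc j))) has_contour_integral
      - (2 * of_real pi * \<i> * (if norm w < 1 then f w else 0)) +
      (\<Sum>j<m. w ^ j * (2 * of_real pi * \<i> / fact j * (deriv ^^ j) f 0))) ?c"
    by (intro has_contour_integral_add has_contour_integral_sum 1 2) auto
  moreover have "f z / (w - z) + (\<Sum>j<m. w ^ j * (f z / z ^ Suc j)) = w ^ m * (f z / (z ^ m * (w - z)))"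
    if "z \<in> path_image ?c" for z
  proof -
    have z: "z \<noteq> 0" "z \<noteq> w"
      using that w by auto
    have "(\<Sum>j<m. w ^ j * (f z / z ^ Suc j)) = f z / z * (\<Sum>j<m. (w / z) ^ j)"
      by (simp add: sum_distrib_left power_divide field_simps)
    also have "(\<Sum>j<m. (w / z) ^ j) = (1 - (w / z) ^ m) / (1 - w / z)"
      using z sum_gp_strict[of "w / z" m] by (simp add: field_simps)
    also have "1 - w / z = - ((w - z) / z)"
      using z by (simp add: field_simps)
    also have "f z / z * ((1 - (w / z) ^ m) / - ((w - z) / z)) = - (f z / (w - z)) + f z / (w - z) * (w / z) ^ m"
    proof -
      have "a / z * ((1 - q) / - (D / z)) = - (a / D) + a / D * q" if "D \<noteq> 0" for a q D :: complex
        using z that by (simp add: field_simps)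
      then show ?thesis
        using z by auto
    qed
    finally have "f z / (w - z) + (\<Sum>j<m. w ^ j * (f z / z ^ Suc j)) = f z / (w - z) * (w / z) ^ m"
      by simp
    also have "f z / (w - z) * (w / z) ^ m = w ^ m * (f z / (z ^ m * (w - z)))"
      by (simp add: power_divide mult.commute)
    finally show ?thesis .
  qed
  ultimately have 3: "((\<lambda>z. w ^ m * (f z / (z ^ m * (w - z)))) has_contour_integral
      - (2 * of_real pi * \<i> * (if norm w < 1 then f w else 0)) +
      (\<Sum>j<m. w ^ j * (2 * of_real pi * \<i> / fact j * (deriv ^^ j) f 0))) ?c"
    by (rule has_contour_integral_eq)
  have "(\<lambda>z. f z / (z ^ m * (w - z))) contour_integrable_on ?c"
    using w holomorphic_on_imp_continuous_on[OF f']
    by (intro contour_integrable_continuous_circlepath continuous_intros) auto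
  then have "w ^ m * contour_integral ?c (\<lambda>z. f z / (z ^ m * (w - z))) =
      - (2 * of_real pi * \<i> * (if norm w < 1 then f w else 0)) +
      (\<Sum>j<m. w ^ j * (2 * of_real pi * \<i> / fact j * (deriv ^^ j) f 0))"
    unfolding contour_integral_unique[OF 3, symmetric] by (rule contour_integral_lmul[symmetric])
  also have "(\<Sum>j<m. w ^ j * (2 * of_real pi * \<i> / fact j * (deriv ^^ j) f 0)) =
      2 * of_real pi * \<i> * (\<Sum>j<m. (deriv ^^ j) f 0 / fact j * w ^ j)"
    by (simp add: sum_distrib_left mult_ac)
  finally show ?thesis
    by (simp add: ctail_def field_simps)
qed

section \<open>The singular double integral\<close>

lemma half_le_sin:
  fixes x :: real
  assumes "0 \<le> x" "x \<le> pi / 2"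
  shows "x / 2 \<le> sin x"
proof -
  define y where "y = x / 2"
  have y: "0 \<le> y" "y \<le> pi / 4"
    using assms by (auto simp: y_def)
  \<comment> \<open>A weak Jordan inequality by doubling y = x / 2: from y cos y <= sin y follows
    sin x >= 2 y (cos y)^2 = (x / 2) (1 + cos x).\<close>
  have "(\<lambda>y. sin y - y * cos y) 0 \<le> (\<lambda>y. sin y - y * cos y) y"
  proof (rule DERIV_nonneg_imp_nondecreasing[OF y(1)])
    fix t assume t: "0 \<le> t" "t \<le> y"
    have "((\<lambda>y. sin y - y * cos y) has_real_derivative t * sin t) (at t)"
      by (auto intro!: derivative_eq_intros)
    moreover have "0 \<le> t * sin t"
      using t y pi_gt_zero by (intro mult_nonneg_nonneg sin_ge_zero) linarith+
    ultimately show "\<exists>z. ((\<lambda>y. sin y - y * cos y) has_real_derivative z) (at t) \<and> 0 \<le> z"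
      by blast
  qed
  then have le: "y * cos y \<le> sin y" by simp
  have cos: "0 \<le> cos y"
    using y pi_gt_zero by (intro cos_ge_zero) linarith+
  have "x / 2 \<le> x / 2 * (1 + cos x)"
    using assms cos_ge_zero[of x] by (simp add: algebra_simps)
  also have "\<dots> = 2 * (y * cos y) * cos y"
    using cos_double_cos[of y] by (simp add: y_def power2_eq_square)
  also have "\<dots> \<le> 2 * sin y * cos y"
    using le cos by (intro mult_right_mono) auto
  also have "\<dots> = sin x"
    using sin_double[of y] by (simp add: y_def)
  finally show ?thesis .
qed

text \<open>The difference of cosines is 2 sin ((\<theta> + \<phi>) / 2) sin ((\<phi> - \<theta>) /
  2). The second sine is comparable to the angle difference, the first stays above sqrt (\<delta> /
  2) since \<alpha> keeps the distance \<delta> from -1 and 1.\<close>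

lemma abs_cos_diff_ge:
  fixes \<theta> \<alpha> \<delta> :: real
  assumes \<theta>: "0 \<le> \<theta>" "\<theta> \<le> pi" and \<delta>: "0 < \<delta>" and \<alpha>:
      "\<bar>\<alpha>\<bar> \<le> 1 - \<delta>"
  shows "sqrt \<delta> / 4 * \<bar>\<theta> - arccos \<alpha>\<bar> \<le> \<bar>cos \<theta> - \<alpha>\<bar>"
proof -
  define \<phi> where "\<phi> = arccos \<alpha>"
  have \<phi>: "0 \<le> \<phi>" "\<phi> \<le> pi" "cos \<phi> = \<alpha>"
    using assms by (auto simp: \<phi>_def intro: arccos_lbound arccos_ubound)
  have half: "sqrt (\<delta> / 2) \<le> sin (\<phi> / 2)" "sqrt (\<delta> / 2) \<le> cos (\<phi> / 2)"
  proof -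
    have "\<delta> / 2 \<le> (sin (\<phi> / 2))\<^sup>2" "\<delta> / 2 \<le> (cos (\<phi> / 2))\<^sup>2"
      using cos_double_sin[of "\<phi> / 2"] cos_double_cos[of "\<phi> / 2"] \<phi>(3) \<alpha> by auto
    moreover have "0 \<le> sin (\<phi> / 2)" "0 \<le> cos (\<phi> / 2)"
      using \<phi> pi_gt_zero by (auto intro!: sin_ge_zero cos_ge_zero)
    ultimately show "sqrt (\<delta> / 2) \<le> sin (\<phi> / 2)" "sqrt (\<delta> / 2) \<le> cos (\<phi> / 2)"
      by (auto intro: real_le_lsqrt)
  qed
  \<comment> \<open>The half sum runs from \<phi> / 2 to \<phi> / 2 + pi / 2, and at these ends the
    sine equals sin (\<phi> / 2) and cos (\<phi> / 2).\<close>
  have 1: "sqrt (\<delta> / 2) \<le> sin ((\<theta> + \<phi>) / 2)"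
  proof (cases "(\<theta> + \<phi>) / 2 \<le> pi / 2")
    case True
    have "sin (\<phi> / 2) \<le> sin ((\<theta> + \<phi>) / 2)"
      using True \<theta> \<phi> pi_gt_zero by (intro sin_monotone_2pi_le) auto
    then show ?thesis using half by linarith
  next
    case False
    have "sin (pi / 2 - \<phi> / 2) \<le> sin (pi - (\<theta> + \<phi>) / 2)"
      using False \<theta> \<phi> pi_gt_zero by (intro sin_monotone_2pi_le) (auto simp: field_simps)
    then show ?thesis using half by (simp add: sin_diff)
  qed
  have sm: "sin ((\<phi> - \<theta>) / 2) = - sin ((\<theta> - \<phi>) / 2)"
    unfolding sin_minus[symmetric] by (rule arg_cong[where f=sin]) (simp add: field_simps)
  have 2: "\<bar>\<theta> - \<phi>\<bar> / 4 \<le> \<bar>sin ((\<theta> - \<phi>) / 2)\<bar>"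
  proof -
    have "\<bar>(\<theta> - \<phi>) / 2\<bar> / 2 \<le> sin \<bar>(\<theta> - \<phi>) / 2\<bar>"
      using \<theta> \<phi> by (intro half_le_sin) auto
    also have "\<dots> \<le> \<bar>sin ((\<theta> - \<phi>) / 2)\<bar>"
      using sm by (cases "\<theta> \<ge> \<phi>") auto
    finally show ?thesis by simp
  qed
  have "sqrt \<delta> / 4 * \<bar>\<theta> - \<phi>\<bar> \<le> 2 * sqrt (\<delta> / 2) * (\<bar>\<theta> -
      \<phi>\<bar> / 4)"
  proof -
    have "sqrt \<delta> \<le> sqrt (4 * (\<delta> / 2))"
      using \<delta> by simp
    also have "\<dots> = 2 * sqrt (\<delta> / 2)"
      by (simp only: real_sqrt_mult) simp
    finally show ?thesis
      using mult_right_mono[of "sqrt \<delta>" "2 * sqrt (\<delta> / 2)" "\<bar>\<theta> - \<phi>\<bar> / 4"] by simp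
  qed
  also have "\<dots> \<le> 2 * sin ((\<theta> + \<phi>) / 2) * \<bar>sin ((\<theta> - \<phi>) / 2)\<bar>"
    using \<delta> order.trans[OF _ 1, of 0] by (intro mult_mono 1 2 mult_left_mono) auto
  also have "\<dots> = \<bar>cos \<theta> - cos \<phi>\<bar>"
    using 1 \<delta> order.trans[OF _ 1, of 0]
    by (subst cos_diff_cos) (simp add: abs_mult sm)
  finally show ?thesis
    using \<phi>(3) by (simp add: \<phi>_def)
qed

text \<open>Both (v - v0) (v + v0) and (r - 1) (r + 1) equal the difference of squares, and the
  quotient (v + v0) / (r + 1) is at least v0 / 2, where v0 >= sqrt \<delta>.\<close>

lemma abs_sqrt_diff_ge:
  fixes v \<alpha> \<delta> :: real
  assumes v: "0 \<le> v" and \<delta>: "0 < \<delta>" and \<alpha>: "\<bar>\<alpha>\<bar> \<le> 1 - \<delta>"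
  shows "sqrt \<delta> / 4 * \<bar>v - sqrt (1 - \<alpha>\<^sup>2)\<bar> \<le> \<bar>sqrt (\<alpha>\<^sup>2 +
      v\<^sup>2) - 1\<bar>"
proof -
  define r where "r = sqrt (\<alpha>\<^sup>2 + v\<^sup>2)"
  define v0 where "v0 = sqrt (1 - \<alpha>\<^sup>2)"
  have "\<bar>\<alpha>\<bar>\<^sup>2 \<le> (1 - \<delta>)\<^sup>2"
    using \<alpha> by (intro power_mono) auto
  moreover have "\<delta> * \<delta> \<le> \<delta> * 1"
    using \<delta> \<alpha> by (intro mult_left_mono) auto
  ultimately have v0': "\<delta> \<le> 1 - \<alpha>\<^sup>2"
    by (simp add: power2_eq_square algebra_simps)
  have v0: "sqrt \<delta> \<le> v0" "0 < v0" "v0\<^sup>2 = 1 - \<alpha>\<^sup>2"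
    using v0' \<delta> by (auto simp: v0_def)
  have r: "0 \<le> r" "r\<^sup>2 = \<alpha>\<^sup>2 + v\<^sup>2" "r \<le> 1 + v"
  proof -
    show "r \<le> 1 + v"
      unfolding r_def using v v0' \<delta> by (intro real_le_lsqrt) (auto simp: power2_eq_square algebra_simps)
  qed (auto simp: r_def)
  have "sqrt \<delta> / 4 * \<bar>v - v0\<bar> * (r + 1) \<le> v0 / 2 * \<bar>v - v0\<bar> * (v + 2)"
    using r v0 v \<delta> by (intro mult_mono) auto
  also have "\<dots> = \<bar>v - v0\<bar> * (v0 + v0 * v / 2)"
    by (simp add: algebra_simps)
  also have "\<dots> \<le> \<bar>v - v0\<bar> * (v0 + v)"
  proof -
    have "v0 \<le> 1"
      using v0(3) by (simp add: v0_def)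
    then have "v0 * v \<le> 1 * v"
      using v by (intro mult_right_mono) auto
    then show ?thesis
      using v by (intro mult_left_mono) auto
  qed
  also have "\<dots> = \<bar>(v - v0) * (v + v0)\<bar>"
    using v v0 by (simp add: abs_mult)
  also have "(v - v0) * (v + v0) = (r - 1) * (r + 1)"
    using v0 r by (simp add: algebra_simps power2_eq_square)
  also have "\<bar>(r - 1) * (r + 1)\<bar> = \<bar>r - 1\<bar> * (r + 1)"
    using r by (simp add: abs_mult)
  finally have "sqrt \<delta> / 4 * \<bar>v - v0\<bar> \<le> \<bar>r - 1\<bar>"
    by (rule mult_right_le_imp_le) (use r in auto)
  then show ?thesis
    by (simp add: r_def v0_def)
qed

text \<open>The exponent \<open>- 1 / 2\<close> comes from splitting the Cauchy kernel as \<open>\<bar>w - z\<bar>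
  \<ge> sqrt \<bar>cos \<theta> - \<alpha>\<bar> * sqrt \<bar>\<bar>w\<bar> - 1\<bar>\<close>, which
  decouples the two variables. Note that \<open>skern A 0 = 0\<close>.\<close>

definition skern :: "real \<Rightarrow> real \<Rightarrow> real" where
  "skern A y = exp (- (A * y\<^sup>2)) * \<bar>y\<bar> powr (- 1 / 2)"

lemma skern_nonneg [simp]: "0 \<le> skern A y"
  by (simp add: skern_def)

lemma skern_measurable [measurable]: "skern A \<in> borel_measurable borel"
  unfolding skern_def[abs_def] by measurable

text \<open>The value 0 at the singularity breaks the monotonicity there, whence y must not
  vanish.\<close>

lemma skern_mono:
  assumes "\<bar>y\<bar> \<le> \<bar>x\<bar>" "y \<noteq> 0" "0 \<le> A"
  shows "skern A x \<le> skern A y"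
  unfolding skern_def using assms
  by (intro mult_mono powr_mono2') (auto intro!: mult_left_mono simp: abs_le_square_iff)

text \<open>The power 1/4 comes from the singular factor. With the Jacobian A^(-1/2) each integral
  of \<open>skern\<close> contributes A^(-1/4), and the two integrations, over circle and line,
  together give 1 / sqrt A.\<close>

lemma skern_scale:
  assumes "0 < A"
  shows "skern A y = A powr (1 / 4) * skern 1 (sqrt A * y)"
proof -
  have "\<bar>sqrt A * y\<bar> powr (- 1 / 2) = A powr (- 1 / 4) * \<bar>y\<bar> powr (- 1 / 2)"
    using assms by (simp add: abs_mult powr_mult powr_half_sqrt[symmetric] powr_powr)
  then show ?thesis
    using assms powr_add[of A "1 / 4" "- 1 / 4"] by (simp add: skern_def power_mult_distrib)
qed

text \<open>The majorant is the integrable power on (0, 1), its mirror image, and the Gaussian for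
  |x| >= 1.\<close>

lemma integrable_skern_1: "integrable lborel (skern 1)"
proof (rule Bochner_Integration.integrable_bound)
  let ?p = "\<lambda>x::real. indicator {0<..<1} x * x powr (- 1 / 2)"
  have "set_integrable lborel (einterval 0 1) (\<lambda>x. x powr (- 1 / 2))"
  proof (rule interval_integral_FTC_nonneg(1)[where F="\<lambda>x. 2 * sqrt x" and A=0 and B=2])
    fix x :: real assume "0 < ereal x" "ereal x < 1"
    then show "((\<lambda>x. 2 * sqrt x) has_real_derivative x powr (- 1 / 2)) (at x)"
      by (auto intro!: derivative_eq_intros simp: powr_minus powr_half_sqrt)
  next
    show "(((\<lambda>x. 2 * sqrt x) \<circ> real_of_ereal) \<longlongrightarrow> 0) (at_right 0)"
      unfolding zero_ereal_def ereal_tendsto_simps by (auto intro!: tendsto_eq_intros)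
    show "(((\<lambda>x. 2 * sqrt x) \<circ> real_of_ereal) \<longlongrightarrow> 2) (at_left 1)"
      unfolding one_ereal_def ereal_tendsto_simps by (auto intro!: tendsto_eq_intros)
  qed (auto intro!: continuous_intros)
  then have p: "integrable lborel ?p"
    by (simp add: set_integrable_def zero_ereal_def one_ereal_def)
  have p': "integrable lborel (\<lambda>x. ?p (0 + (- 1) * x))"
    using lborel_integrable_real_affine[OF p, of "- 1" 0] by simp
  show "integrable lborel (\<lambda>x. ?p x + ?p (0 + (- 1) * x) + exp (- (1 * x\<^sup>2)))"
    by (intro Bochner_Integration.integrable_add p p' integrable_gauss) auto
  have "skern 1 x \<le> ?p x + ?p (0 + (- 1) * x) + exp (- (1 * x\<^sup>2))" for x
  proof (cases "\<bar>x\<bar> < 1")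
    case True
    have "skern 1 x \<le> 1 * \<bar>x\<bar> powr (- 1 / 2)"
      unfolding skern_def by (intro mult_right_mono) auto
    also have "\<dots> \<le> ?p x + ?p (0 + (- 1) * x) + exp (- (1 * x\<^sup>2))"
      using True by (cases "x = 0"; cases "x > 0") (auto simp: abs_if indicator_def)
    finally show ?thesis .
  next
    case False
    have "skern 1 x \<le> exp (- (1 * x\<^sup>2)) * 1"
      unfolding skern_def using False powr_mono[of "- 1 / 2" 0 "\<bar>x\<bar>"] by (intro mult_left_mono) (auto
          split: if_splits)
    moreover have "0 \<le> ?p x" "0 \<le> ?p (0 + (- 1) * x)"
      by (simp_all add: indicator_def)
    ultimately show ?thesis
      by linarith
  qed
  then show "AE x in lborel. norm (skern 1 x) \<le> norm (?p x + ?p (0 + (- 1) * x) + exp (- (1 * x\<^sup>2)))"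
    by (intro AE_I2) (smt (verit) norm_ge_zero real_norm_def skern_nonneg)
qed measurable

definition skern_int :: real where
  "skern_int = (LBINT y. skern 1 y)"

lemma skern_int_nonneg: "0 \<le> skern_int"
  unfolding skern_int_def by simp

lemma integral_skern_affine:
  assumes "0 < A" "c \<noteq> 0"
  shows "integrable lborel (\<lambda>y. skern A (t + c * y))"
    and "(LBINT y. skern A (t + c * y)) = skern_int * A powr (- 1 / 4) / \<bar>c\<bar>"
proof -
  have eq: "skern A (t + c * y) = A powr (1 / 4) * skern 1 (sqrt A * t + (sqrt A * c) * y)" for y
    using assms by (subst skern_scale) (auto simp: algebra_simps)
  have 1: "integrable lborel (\<lambda>y. skern 1 (sqrt A * t + (sqrt A * c) * y))"
    using assms by (intro lborel_integrable_real_affine integrable_skern_1) auto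
  then show "integrable lborel (\<lambda>y. skern A (t + c * y))"
    unfolding eq by (rule integrable_mult_right)
  have "skern_int = \<bar>sqrt A * c\<bar> * (LBINT y. skern 1 (sqrt A * t + (sqrt A * c) * y))"
    unfolding skern_int_def using assms
    by (subst lborel_integral_real_affine[where c="sqrt A * c" and t="sqrt A * t"]) auto
  then have "(LBINT y. skern A (t + c * y)) = A powr (1 / 4) * (skern_int / (sqrt A * \<bar>c\<bar>))"
    unfolding eq using assms by (simp add: field_simps abs_mult)
  also have "\<dots> = skern_int * (A powr (1 / 4) * A powr (- 1 / 2)) / \<bar>c\<bar>"
    using assms by (simp add: powr_minus powr_half_sqrt field_simps)
  finally show "(LBINT y. skern A (t + c * y)) = skern_int * A powr (- 1 / 4) / \<bar>c\<bar>"
    by (simp flip: powr_add)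
qed

text \<open>The circle meets the line Re = \<alpha> at the angles arccos \<alpha> and 2 pi - arccos
  \<alpha>; each summand of g majorises on the half circle that contains its crossing. The excluded
  t form a null set.\<close>

lemma integral_skern_cos_le:
  assumes A: "0 < A" and \<delta>: "0 < \<delta>" and \<alpha>: "\<bar>\<alpha>\<bar> \<le> 1 - \<delta>"
  defines "g \<equiv> \<lambda>t. skern A (sqrt \<delta> / 4 * (2 * pi * t - arccos \<alpha>)) + skern A (sqrt
      \<delta> / 4 * (2 * pi - 2 * pi * t - arccos \<alpha>))"
  shows "integrable lborel g"
    and "(LBINT t. g t) = 4 * skern_int * A powr (- 1 / 4) / (pi * sqrt \<delta>)"
    and "\<lbrakk>0 \<le> t; t \<le> 1; 2 * pi * t \<noteq> arccos \<alpha>; 2 * pi * t \<noteq> 2 * pi -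
        arccos \<alpha>\<rbrakk> \<Longrightarrow> skern A (cos (2 * pi * t) - \<alpha>) \<le> g t"
proof -
  define c where "c = sqrt \<delta> / 4"
  have c: "0 < c"
    using \<delta> by (simp add: c_def)
  have g: "g = (\<lambda>t. skern A (- c * arccos \<alpha> + (2 * pi * c) * t) + skern A (c * (2 * pi - arccos
      \<alpha>) + (- 2 * pi * c) * t))"
    unfolding g_def c_def by (simp add: algebra_simps)
  have nz: "2 * pi * c \<noteq> 0" "- 2 * pi * c \<noteq> 0"
    using c by auto
  note i1 = integral_skern_affine[OF A nz(1), of "- c * arccos \<alpha>"]
  note i2 = integral_skern_affine[OF A nz(2), of "c * (2 * pi - arccos \<alpha>)"]
  show "integrable lborel g"
    unfolding g by (intro Bochner_Integration.integrable_add i1 i2)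
  have "(LBINT t. g t) = 2 * (skern_int * A powr (- 1 / 4) / (2 * pi * c))"
    unfolding g Bochner_Integration.integral_add[OF i1(1) i2(1)] i1(2) i2(2)
    using c by (simp add: abs_mult)
  then show "(LBINT t. g t) = 4 * skern_int * A powr (- 1 / 4) / (pi * sqrt \<delta>)"
    by (simp add: c_def)
  assume t: "0 \<le> t" "t \<le> 1" "2 * pi * t \<noteq> arccos \<alpha>" "2 * pi * t \<noteq> 2 * pi - arccos
      \<alpha>"
  show "skern A (cos (2 * pi * t) - \<alpha>) \<le> g t"
  proof (cases "t \<le> 1 / 2")
    case True
    have "c * \<bar>2 * pi * t - arccos \<alpha>\<bar> \<le> \<bar>cos (2 * pi * t) - \<alpha>\<bar>"
      unfolding c_def using t True \<delta> \<alpha> by (intro abs_cos_diff_ge) auto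
    then have "skern A (cos (2 * pi * t) - \<alpha>) \<le> skern A (c * (2 * pi * t - arccos \<alpha>))"
      using t c A by (intro skern_mono) (auto simp: abs_mult)
    also have "\<dots> \<le> g t"
      by (simp add: g_def c_def)
    finally show ?thesis .
  next
    case False
    have cs: "cos (2 * pi - 2 * pi * t) = cos (2 * pi * t)"
      by (simp add: cos_diff)
    have "c * \<bar>2 * pi - 2 * pi * t - arccos \<alpha>\<bar> \<le> \<bar>cos (2 * pi - 2 * pi * t) -
        \<alpha>\<bar>"
      unfolding c_def using t False \<delta> \<alpha> by (intro abs_cos_diff_ge) auto
    then have "skern A (cos (2 * pi * t) - \<alpha>) \<le> skern A (c * (2 * pi - 2 * pi * t - arccos \<alpha>))"
      using t c A unfolding cs by (intro skern_mono) (auto simp: abs_mult)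
    also have "\<dots> \<le> g t"
      by (simp add: g_def c_def)
    finally show ?thesis .
  qed
qed

text \<open>On the circle |z^m| = 1, so the bound does not depend on the truncation degree m. This
  later permits both m of order N and m tending to infinity.\<close>

lemma norm_ctail_le:
  assumes f: "f holomorphic_on UNIV" and A: "0 < A" and \<delta>: "0 < \<delta>" and \<alpha>:
      "\<bar>\<alpha>\<bar> \<le> 1 - \<delta>"
    and bound: "\<And>\<theta>. norm (f (cis \<theta>)) \<le> C * exp (- (A * (cos \<theta> - \<alpha>)\<^sup>2))"
    and w: "Re w = \<alpha>" "norm w \<noteq> 1"
  shows "norm (ctail f m w) \<le> C * (4 * skern_int * A powr (- 1 / 4) / (pi * sqrt \<delta>)) * \<bar>norm w
      - 1\<bar> powr (- 1 / 2)"
proof -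
  let ?c = "circlepath 0 1 :: real \<Rightarrow> complex"
  define g where "g = (\<lambda>t. skern A (sqrt \<delta> / 4 * (2 * pi * t - arccos \<alpha>)) + skern A (sqrt
      \<delta> / 4 * (2 * pi - 2 * pi * t - arccos \<alpha>)))"
  note g = integral_skern_cos_le[OF A \<delta> \<alpha>, folded g_def]
  have C: "0 \<le> C"
    using order.trans[OF norm_ge_zero bound[of 0]] by (simp add: zero_le_mult_iff)
  define h where "h = (\<lambda>t. f (?c t) / (?c t ^ m * (w - ?c t)) * (2 * of_real pi * \<i> * exp (2 *
      of_real pi * \<i> * of_real t)))"
  have ct: "?c t = cis (2 * pi * t)" for t
    by (simp add: circlepath cis_conv_exp mult_ac)
  have h: "h = (\<lambda>t. 2 * of_real pi * \<i> * (f (cis (2 * pi * t)) / (cis (2 * pi * t) ^ m * (w - cis (2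
      * pi * t))) * cis (2 * pi * t)))"
    unfolding h_def ct by (rule ext) (simp add: cis_conv_exp mult_ac)
  have wne: "w \<noteq> cis t" for t
    using w by auto
  have "continuous_on S (\<lambda>t. f (cis (2 * pi * t)))" for S
    using holomorphic_on_imp_continuous_on[OF f] by (rule continuous_on_compose2) (auto intro!: continuous_intros)
  then have hc: "continuous_on {0..1} h"
    unfolding h using wne by (intro continuous_intros) auto
  have hi: "set_integrable lborel {0..1} h"
    using hc by (rule borel_integrable_atLeastAtMost')
  have "contour_integral ?c (\<lambda>z. f z / (z ^ m * (w - z))) = integral {0..1} h"
    unfolding contour_integral_integral h_def vector_derivative_circlepath by simp
  also have "\<dots> = (LINT t:{0..1}|lborel. h t)"
    using set_borel_integral_eq_integral(2)[OF hi] by simp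
  finally have ci: "contour_integral ?c (\<lambda>z. f z / (z ^ m * (w - z))) = (LINT t:{0..1}|lborel. h t)" .
  let ?q = "\<bar>norm w - 1\<bar> powr (- 1 / 2)"
  have pt: "norm (h t) \<le> 2 * pi * (C * ?q * g t)"
    if t: "0 \<le> t" "t \<le> 1" "2 * pi * t \<noteq> arccos \<alpha>" "2 * pi * t \<noteq> 2 * pi - arccos
        \<alpha>" for t
  proof -
    let ?z = "cis (2 * pi * t)"
    let ?p = "\<bar>cos (2 * pi * t) - \<alpha>\<bar>"
    have p: "0 < ?p"
    proof -
      have "cos (2 * pi * t) \<noteq> \<alpha>"
      proof
        assume *: "cos (2 * pi * t) = \<alpha>"
        show False
        proof (cases "t \<le> 1 / 2")
          case True
          then have "arccos (cos (2 * pi * t)) = 2 * pi * t"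
            using t by (intro arccos_cos) auto
          then show False using * t by simp
        next
          case False
          then have "arccos (cos (2 * pi - 2 * pi * t)) = 2 * pi - 2 * pi * t"
            using t by (intro arccos_cos) (auto simp: field_simps)
          then show False using * t by (simp add: cos_diff)
        qed
      qed
      then show ?thesis by simp
    qed
    have q: "0 < \<bar>norm w - 1\<bar>"
      using w by simp
    have le: "?p \<le> norm (w - ?z)" "\<bar>norm w - 1\<bar> \<le> norm (w - ?z)"
    proof -
      show "?p \<le> norm (w - ?z)"
        using abs_Re_le_cmod[of "w - ?z"] w by (simp add: abs_minus_commute)
      show "\<bar>norm w - 1\<bar> \<le> norm (w - ?z)"
        using norm_triangle_ineq3[of w ?z] by simp
    qed
    \<comment> \<open>Both the horizontal distance and the radial distance bound |w - z| from below,
      hence so does their geometric mean.\<close>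
    have "?p powr (1 / 2) * \<bar>norm w - 1\<bar> powr (1 / 2) \<le> norm (w - ?z) powr (1 / 2) * norm (w -
        ?z) powr (1 / 2)"
      using le by (intro mult_mono powr_mono2) auto
    also have "\<dots> = norm (w - ?z)"
      using p le by (simp flip: powr_add)
    finally have "1 / norm (w - ?z) \<le> 1 / (?p powr (1 / 2) * \<bar>norm w - 1\<bar> powr (1 / 2))"
      using p q by (intro divide_left_mono mult_pos_pos) (use le in auto)
    also have "\<dots> = ?p powr (- 1 / 2) * ?q"
      by (simp add: powr_minus field_simps)
    finally have inv: "1 / norm (w - ?z) \<le> ?p powr (- 1 / 2) * ?q" .
    have "norm (h t) = 2 * pi * (norm (f ?z) * (1 / norm (w - ?z)))"
      by (simp add: h norm_mult norm_divide norm_power)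
    also have "\<dots> \<le> 2 * pi * (C * exp (- (A * (cos (2 * pi * t) - \<alpha>)\<^sup>2)) * (?p powr (- 1
        / 2) * ?q))"
      using C by (intro mult_left_mono mult_mono bound inv) auto
    also have "\<dots> = 2 * pi * (C * ?q * skern A (cos (2 * pi * t) - \<alpha>))"
      by (simp add: skern_def)
    also have "\<dots> \<le> 2 * pi * (C * ?q * g t)"
      using C integral_skern_cos_le(3)[OF A \<delta> \<alpha> t] by (intro mult_left_mono) (auto simp: g_def)
    finally show ?thesis .
  qed
  have "norm (LINT t:{0..1}|lborel. h t) \<le> (LBINT t. 2 * pi * (C * ?q * g t))"
    unfolding set_lebesgue_integral_def
  proof (rule order.trans[OF integral_norm_bound], rule integral_mono_AE)
    show "integrable lborel (\<lambda>t. norm (indicator {0..1} t *\<^sub>R h t))"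
      using hi unfolding set_integrable_def by (rule integrable_norm)
    show "integrable lborel (\<lambda>t. 2 * pi * (C * ?q * g t))"
      by (intro integrable_mult_right g)
    have "AE t in lborel. t \<noteq> arccos \<alpha> / (2 * pi)" "AE t in lborel. t \<noteq> 1 - arccos
        \<alpha> / (2 * pi)"
      by (rule AE_lborel_singleton)+
    then show "AE t in lborel. norm (indicator {0..1} t *\<^sub>R h t) \<le> 2 * pi * (C * ?q * g t)"
    proof eventually_elim
      case (elim t)
      have "0 \<le> g t"
        by (simp add: g_def)
      moreover have "norm (h t) \<le> 2 * pi * (C * ?q * g t)" if "0 \<le> t" "t \<le> 1"
        using that elim by (intro pt) (auto simp: field_simps)
      ultimately show ?case
        using C by (auto simp: indicator_def)
    qed
  qed
  also have "\<dots> = 2 * pi * (C * ?q * (4 * skern_int * A powr (- 1 / 4) / (pi * sqrt \<delta>)))"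
    by (simp only: integral_mult_right_zero g(2))
  finally show ?thesis
    unfolding ctail_def norm_mult ci by (simp add: norm_divide norm_mult field_simps)
qed

text \<open>\<open>ctail\<close> is not known to be measurable, so the integrand is any \<open>E\<close> that
  agrees with the product off the circle.\<close>

lemma norm_integral_ctail_le:
  assumes f: "f holomorphic_on UNIV" and A: "0 < A" and \<delta>: "0 < \<delta>" and \<alpha>:
      "\<bar>\<alpha>\<bar> \<le> 1 - \<delta>"
    and bound: "\<And>\<theta>. norm (f (cis \<theta>)) \<le> C * exp (- (A * (cos \<theta> - \<alpha>)\<^sup>2))"
    and E: "\<And>v. norm (Complex \<alpha> v) \<noteq> 1 \<Longrightarrow> E v = Q v * ctail f m (Complex
        \<alpha> v)"
    and Q: "\<And>v. norm (Q v) \<le> D * exp (- (A * (norm (Complex \<alpha> v) - 1)\<^sup>2))"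
  shows "norm (LBINT v. E v) \<le> C * D * (32 * skern_int\<^sup>2 / (pi * \<delta>)) / sqrt A"
    and "E \<in> borel_measurable lborel \<Longrightarrow> integrable lborel E"
proof -
  define v0 where "v0 = sqrt (1 - \<alpha>\<^sup>2)"
  define c where "c = sqrt \<delta> / 4"
  have c: "0 < c"
    using \<delta> by (simp add: c_def)
  have C: "0 \<le> C"
    using order.trans[OF norm_ge_zero bound[of 0]] by (simp add: zero_le_mult_iff)
  have D: "0 \<le> D"
    using order.trans[OF norm_ge_zero Q[of 0]] by (simp add: zero_le_mult_iff)
  define K where "K = C * D * (4 * skern_int * A powr (- 1 / 4) / (pi * sqrt \<delta>))"
  have K: "0 \<le> K"
    using C D \<delta> skern_int_nonneg by (simp add: K_def)
  define g where "g = (\<lambda>v. skern A (- c * v0 + c * v) + skern A (- c * v0 + (- c) * v))"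
  have nz: "c \<noteq> 0" "- c \<noteq> 0"
    using c by auto
  note i1 = integral_skern_affine[OF A nz(1), of "- c * v0"]
  note i2 = integral_skern_affine[OF A nz(2), of "- c * v0"]
  have gi: "integrable lborel g"
    unfolding g_def by (intro Bochner_Integration.integrable_add i1 i2)
  have gint: "(LBINT t. g t) = 8 * skern_int * A powr (- 1 / 4) / sqrt \<delta>"
    unfolding g_def Bochner_Integration.integral_add[OF i1(1) i2(1)] i1(2) i2(2)
    using c by (simp add: c_def)
  have pt: "norm (E v) \<le> K * g v" if v: "v \<noteq> v0" "v \<noteq> - v0" for v
  proof -
    let ?w = "Complex \<alpha> v"
    have nw: "norm ?w = sqrt (\<alpha>\<^sup>2 + v\<^sup>2)"
      by (simp add: cmod_def)
    \<comment> \<open>Near its two crossings with the circle the line also separates from it at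
      linear speed, so the radial factor can be replaced by \<open>skern\<close> in v.\<close>
    have c_le: "c * \<bar>\<bar>v\<bar> - v0\<bar> \<le> \<bar>norm ?w - 1\<bar>"
      using abs_sqrt_diff_ge[of "\<bar>v\<bar>", OF _ \<delta> \<alpha>] by (simp add: c_def v0_def nw)
    have vv: "\<bar>v\<bar> - v0 \<noteq> 0"
      using v by (auto simp: abs_if split: if_splits)
    have ne: "norm ?w \<noteq> 1"
    proof
      assume "norm ?w = 1"
      then have "c * \<bar>\<bar>v\<bar> - v0\<bar> \<le> 0" using c_le by simp
      then show False using c vv by (simp add: mult_le_0_iff)
    qed
    have "norm (E v) \<le> (D * exp (- (A * (norm ?w - 1)\<^sup>2))) *
       (C * (4 * skern_int * A powr (- 1 / 4) / (pi * sqrt \<delta>)) * \<bar>norm ?w - 1\<bar> powr (- 1 / 2))"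
      unfolding E[OF ne] norm_mult using ne D by (intro mult_mono Q norm_ctail_le[OF f A \<delta> \<alpha>
          bound]) auto
    also have "\<dots> = K * skern A (norm ?w - 1)"
      by (simp add: K_def skern_def)
    also have "\<dots> \<le> K * skern A (c * (\<bar>v\<bar> - v0))"
      using K c vv c_le A by (intro mult_left_mono skern_mono) (auto simp: abs_mult)
    \<comment> \<open>|v| - v0 is v - v0 or - v - v0, the arguments of the two summands of g up to
      the factor c.\<close>
    also have "\<dots> \<le> K * g v"
      using K by (intro mult_left_mono) (auto simp: g_def abs_if algebra_simps)
    finally show ?thesis .
  qed
  have ae: "AE v in lborel. norm (E v) \<le> K * g v"
  proof -
    have "AE v in lborel. v \<noteq> v0" "AE v in lborel. v \<noteq> - v0"
      by (rule AE_lborel_singleton)+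
    then show ?thesis
      by eventually_elim (rule pt)
  qed
  show "integrable lborel E" if "E \<in> borel_measurable lborel"
  proof (rule Bochner_Integration.integrable_bound[OF integrable_mult_right[OF gi, of K] that])
    show "AE v in lborel. norm (E v) \<le> norm (K * g v)"
      using ae by eventually_elim (rule order.trans, assumption, simp)
  qed
  show "norm (LBINT v. E v) \<le> C * D * (32 * skern_int\<^sup>2 / (pi * \<delta>)) / sqrt A"
  \<comment> \<open>A non-integrable function has Bochner integral 0, so the estimate holds without
    any measurability.\<close>
  proof (cases "integrable lborel E")
    case True
    have "norm (LBINT v. E v) \<le> (LBINT v. K * g v)"
    proof (rule order.trans[OF integral_norm_bound], rule integral_mono_AE)
      show "AE v in lborel. norm (E v) \<le> K * g v"
        by (rule ae)
    qed (use True gi in auto)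
    also have "\<dots> = K * (8 * skern_int * A powr (- 1 / 4) / sqrt \<delta>)"
      by (simp add: gint)
    also have "\<dots> = C * D * (32 * skern_int\<^sup>2 / (pi * (sqrt \<delta> * sqrt \<delta>))) * (A powr (-
        1 / 4) * A powr (- 1 / 4))"
      by (simp only: K_def power2_eq_square times_divide_eq_right times_divide_eq_left divide_divide_eq_left mult_ac)
         (simp add: mult_ac)?
    also have "A powr (- 1 / 4) * A powr (- 1 / 4) = 1 / sqrt A"
      using A by (simp add: powr_minus powr_half_sqrt field_simps flip: powr_add)
    finally show ?thesis
      using \<delta> by simp
  next
    case False
    then show ?thesis
      using C D \<delta> A by (simp add: not_integrable_integral_eq)
  qed
qed

section \<open>The Hermite sums as line integrals\<close>

lemma AE_Complex_norm_neq: "AE v in lborel. norm (Complex a v) \<noteq> 1 \<and> Complex a v \<noteq> 0"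
proof -
  have "AE v in lborel. v \<noteq> sqrt (1 - a\<^sup>2)" "AE v in lborel. v \<noteq> - sqrt (1 - a\<^sup>2)"
      "AE v in lborel. v \<noteq> (0::real)"
    by (rule AE_lborel_singleton)+
  then show ?thesis
  proof eventually_elim
    case (elim v)
    have "v = sqrt (1 - a\<^sup>2) \<or> v = - sqrt (1 - a\<^sup>2)" if "norm (Complex a v) = 1"
    proof -
      have "v\<^sup>2 = 1 - a\<^sup>2"
        using that by (simp add: cmod_def algebra_simps)
      then have "sqrt (1 - a\<^sup>2) = \<bar>v\<bar>"
        by (metis real_sqrt_abs)
      then show ?thesis by auto
    qed
    then show ?case
      using elim by (auto simp: complex_eq_iff)
  qed
qed

lemma integrable_inside:
  assumes "continuous_on UNIV f"
  shows "integrable lborel (\<lambda>v. if norm (Complex a v) < 1 then f v else 0 :: complex)"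
proof (rule Bochner_Integration.integrable_bound)
  have "continuous_on {-1..1} f"
    using assms by (rule continuous_on_subset) auto
  then have "set_integrable lborel {-1..1} f"
    by (rule borel_integrable_atLeastAtMost')
  then show "integrable lborel (\<lambda>v. indicator {-1..1} v *\<^sub>R f v)"
    by (simp add: set_integrable_def)
  have [measurable]: "f \<in> borel_measurable borel"
    using assms by (rule borel_measurable_continuous_onI)
  show "(\<lambda>v. if norm (Complex a v) < 1 then f v else 0) \<in> borel_measurable lborel"
    by measurable
  show "AE v in lborel. norm (if norm (Complex a v) < 1 then f v else 0) \<le> norm (indicator {-1..1} v
      *\<^sub>R f v)"
  proof (intro AE_I2)
    fix v
    show "norm (if norm (Complex a v) < 1 then f v else 0) \<le> norm (indicator {-1..1} v *\<^sub>R f v)"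
      using abs_Im_le_cmod[of "Complex a v"] by (auto simp: indicator_def abs_le_iff)
  qed
qed

lemma hgen_sum_eq_ctail:
  assumes "norm u \<noteq> 1"
  shows "(\<Sum>j<m. of_real (hcoeff X \<rho> j) * u ^ j) = (if norm u < 1 then hgen X \<rho> u else 0) + u ^ m
      * ctail (hgen X \<rho>) m u"
  using taylor_eq_ctail[OF hgen_holomorphic assms] by (simp only: higher_deriv_hgen_0)

text \<open>The sum is finite, so it moves inside the integral at once. The part |u| < 1 lies on a
  bounded piece of the line, so the sign of \<kappa> - \<rho>, that is of the time difference, is
  irrelevant here.\<close>

lemma finite_sum_eq_integral:
  fixes X X' \<rho> \<kappa> a :: real
  assumes "0 < \<kappa>"
  defines "G \<equiv> gexp (- 2 * X' * \<kappa>) (2 * \<kappa>\<^sup>2)"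
  obtains E where
    "\<And>v. norm (Complex a v) \<noteq> 1 \<Longrightarrow> E v = (Complex a v ^ (m + d) * G (Complex a v)) *
        ctail (hgen X \<rho>) m (Complex a v)"
    "(\<Sum>j<m. of_real (hcoeff X \<rho> j) * (LBINT v. Complex a v ^ (j + d) * G (Complex a v))) =
      (LBINT v. (if norm (Complex a v) < 1 then Complex a v ^ d * gexp (2 * X * \<rho> - 2 * X' * \<kappa>) (2
          * \<kappa>\<^sup>2 - 2 * \<rho>\<^sup>2) (Complex a v) else 0)) +
      (LBINT v. E v)"
proof
  let ?u = "Complex a"
  let ?A = "\<lambda>v. if norm (?u v) < 1 then ?u v ^ d * gexp (2 * X * \<rho> - 2 * X' * \<kappa>) (2 *
      \<kappa>\<^sup>2 - 2 * \<rho>\<^sup>2) (?u v) else 0"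
  let ?S = "\<lambda>v. \<Sum>j<m. of_real (hcoeff X \<rho> j) * (?u v ^ (j + d) * G (?u v))"
  have int: "integrable lborel (\<lambda>v. ?u v ^ j * G (?u v))" for j
    unfolding G_def using assms by (intro integrable_power_gexp) auto
  have Si: "integrable lborel ?S"
    by (intro Bochner_Integration.integrable_sum integrable_mult_right int)
  have Ai: "integrable lborel ?A"
    by (intro integrable_inside continuous_intros)
  \<comment> \<open>The witness for E is this difference of two integrable functions, so the
    integral splits without any knowledge about \<open>ctail\<close>.\<close>
  show "?S v - ?A v = (?u v ^ (m + d) * G (?u v)) * ctail (hgen X \<rho>) m (?u v)" if "norm (?u v) \<noteq> 1" for v
  proof -
    have "?S v = ?u v ^ d * G (?u v) * (\<Sum>j<m. of_real (hcoeff X \<rho> j) * ?u v ^ j)"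
      by (simp add: sum_distrib_left power_add mult_ac)
    also have "\<dots> = ?u v ^ d * (G (?u v) * (if norm (?u v) < 1 then hgen X \<rho> (?u v) else 0)) +
        (?u v ^ (m + d) * G (?u v)) * ctail (hgen X \<rho>) m (?u v)"
      unfolding hgen_sum_eq_ctail[OF that] by (simp add: power_add algebra_simps)
    finally show ?thesis
      by (simp add: G_def hgen_eq_gexp gexp_mult)
  qed
  have "(\<Sum>j<m. of_real (hcoeff X \<rho> j) * (LBINT v. ?u v ^ (j + d) * G (?u v))) = (LBINT v. ?S v)"
    by (subst Bochner_Integration.integral_sum) (auto intro: int)
  also have "(LBINT v. ?S v) = (LBINT v. ?A v) + (LBINT v. ?S v - ?A v)"
    by (subst Bochner_Integration.integral_diff[OF Si Ai]) simp
  finally show "(\<Sum>j<m. of_real (hcoeff X \<rho> j) * (LBINT v. ?u v ^ (j + d) * G (?u v))) =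
      (LBINT v. ?A v) + (LBINT v. ?S v - ?A v)" .
qed

text \<open>Uniformity in L costs the factor q > 1 in the quadratic exponent; a q below \<kappa> /
  \<rho> is still beaten by the Gaussian weight.\<close>

lemma hgen_partial_sum_bound:
  fixes u :: complex
  assumes "1 < q" "1 \<le> r" "norm u \<le> r"
  shows "norm (\<Sum>j<L. of_real (hcoeff X \<rho> (p + k + j)) * u ^ (p + j)) \<le>
    exp (2 * \<bar>X * \<rho>\<bar> * (q * r) + \<rho>\<^sup>2 * (q * r)\<^sup>2) * (q / (q - 1))"
proof -
  have "norm (\<Sum>j<L. of_real (hcoeff X \<rho> (p + k + j)) * u ^ (p + j)) \<le> (\<Sum>j<L. \<bar>hcoeff X
      \<rho> (p + k + j)\<bar> * r ^ (p + k + j))"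
  proof (rule sum_norm_le)
    fix j
    have "norm u ^ (p + j) \<le> r ^ (p + j)"
      using assms by (intro power_mono) auto
    also have "\<dots> \<le> r ^ (p + k + j)"
      using assms by (intro power_increasing) auto
    finally show "norm (of_real (hcoeff X \<rho> (p + k + j)) * u ^ (p + j)) \<le> \<bar>hcoeff X \<rho> (p + k
        + j)\<bar> * r ^ (p + k + j)"
      by (auto simp: norm_mult norm_power intro!: mult_left_mono)
  qed
  also have "\<dots> = (\<Sum>j\<in>(\<lambda>j. p + k + j) ` {..<L}. \<bar>hcoeff X \<rho> j\<bar> * r ^ j)"
    by (subst sum.reindex) auto
  also have "\<dots> \<le> (\<Sum>j<p + k + L. \<bar>hcoeff X \<rho> j\<bar> * r ^ j)"
    using assms by (intro sum_mono2) auto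
  also have "\<dots> \<le> exp (2 * \<bar>X * \<rho>\<bar> * (q * \<bar>r\<bar>) + \<rho>\<^sup>2 * (q *
      \<bar>r\<bar>)\<^sup>2) * (q / (q - 1))"
    by (rule hcoeff_sum_bound[OF assms(1)])
  finally show ?thesis
    using assms by simp
qed

text \<open>Inside the circle the full value of \<open>hgen\<close> cancels against the truncated
  sum, outside it survives: the complement of the situation for the finite sum, with the opposite
  remainder.\<close>

lemma hgen_tail_sums:
  assumes "u \<noteq> 0" "norm u \<noteq> 1"
  shows "(\<lambda>j. of_real (hcoeff X \<rho> (p + k + j)) * u ^ (p + j)) sums
    ((if 1 < norm u then hgen X \<rho> u / u ^ k else 0) - u ^ p * ctail (hgen X \<rho>) (p + k) u)"
proof -
  have "(\<lambda>j. of_real (hcoeff X \<rho> (j + (p + k))) * u ^ (j + (p + k))) sums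
      (hgen X \<rho> u - (\<Sum>j<p + k. of_real (hcoeff X \<rho> j) * u ^ j))"
    using sums_split_initial_segment[OF hcoeff_sums] .
  then have "(\<lambda>j. of_real (hcoeff X \<rho> (j + (p + k))) * u ^ (j + (p + k)) / u ^ k) sums
      ((hgen X \<rho> u - (\<Sum>j<p + k. of_real (hcoeff X \<rho> j) * u ^ j)) / u ^ k)"
    by (rule sums_divide)
  moreover have "(\<lambda>j. of_real (hcoeff X \<rho> (j + (p + k))) * u ^ (j + (p + k)) / u ^ k) =
      (\<lambda>j. of_real (hcoeff X \<rho> (p + k + j)) * u ^ (p + j))"
    using assms by (auto simp: power_add add_ac)
  moreover have "(hgen X \<rho> u - (\<Sum>j<p + k. of_real (hcoeff X \<rho> j) * u ^ j)) / u ^ k =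
      (if 1 < norm u then hgen X \<rho> u / u ^ k else 0) - u ^ p * ctail (hgen X \<rho>) (p + k) u"
    unfolding hgen_sum_eq_ctail[OF assms(2)] using assms by (auto simp: field_simps power_add)
  ultimately show ?thesis
    by simp
qed

lemma norm_ge_1_power: "norm (if 1 < norm u then z / u ^ k else 0) \<le> norm (z :: complex)"
  by (auto simp: norm_divide norm_power divide_le_eq mult_le_cancel_left1 one_le_power)

lemma integrable_outside:
  assumes "0 < \<sigma>"
  shows "integrable lborel (\<lambda>v. if 1 < norm (Complex a v) then gexp \<beta> \<sigma> (Complex a v) /
      Complex a v ^ k else 0)"
proof (rule Bochner_Integration.integrable_bound)
  show "integrable lborel (\<lambda>v. gexp \<beta> \<sigma> (Complex a v))"
    using integrable_power_gexp[OF assms, of a 0] by simp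
qed (use norm_ge_1_power in auto)

text \<open>\<rho> < \<kappa> leaves a Gaussian majorant for all partial sums, so dominated
  convergence exchanges sum and integral.\<close>

lemma series_eq_integral:
  fixes X X' \<rho> \<kappa> a :: real
  assumes "0 < \<rho>" "\<rho> < \<kappa>"
  defines "G \<equiv> gexp (- 2 * X' * \<kappa>) (2 * \<kappa>\<^sup>2)"
  obtains E where
    "\<And>v. norm (Complex a v) \<noteq> 1 \<Longrightarrow> E v = (Complex a v ^ p * G (Complex a v)) * ctail
        (hgen X \<rho>) (p + k) (Complex a v)"
    "(\<lambda>j. of_real (hcoeff X \<rho> (p + k + j)) * (LBINT v. Complex a v ^ (p + j) * G (Complex a v))) sums
      ((LBINT v. (if 1 < norm (Complex a v) then gexp (2 * X * \<rho> - 2 * X' * \<kappa>) (2 *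
          \<kappa>\<^sup>2 - 2 * \<rho>\<^sup>2) (Complex a v) / Complex a v ^ k else 0)) -
      (LBINT v. E v))"
proof -
  let ?u = "Complex a"
  let ?F = "hgen X \<rho>"
  let ?A = "\<lambda>v. if 1 < norm (?u v) then gexp (2 * X * \<rho> - 2 * X' * \<kappa>) (2 * \<kappa>\<^sup>2
      - 2 * \<rho>\<^sup>2) (?u v) / ?u v ^ k else 0"
  let ?S = "\<lambda>L v. \<Sum>j<L. of_real (hcoeff X \<rho> (p + k + j)) * (?u v ^ (p + j) * G (?u v))"
  let ?E = "\<lambda>v. (?u v ^ p * G (?u v)) * ctail ?F (p + k) (?u v)"
  \<comment> \<open>Defined through \<open>lim\<close>, the pointwise sum is measurable by
    construction; off a null set it is the true limit.\<close>
  define S where "S = (\<lambda>v. lim (\<lambda>L. ?S L v))"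
  have int: "integrable lborel (\<lambda>v. ?u v ^ j * G (?u v))" for j
    unfolding G_def using assms by (intro integrable_power_gexp) auto
  have Si: "integrable lborel (?S L)" for L
    by (intro Bochner_Integration.integrable_sum integrable_mult_right int)
  have meas: "?S L \<in> borel_measurable lborel" for L
    using Si by (rule borel_measurable_integrable)
  have "\<rho>\<^sup>2 < \<kappa>\<^sup>2"
    using assms by (intro power_strict_mono) auto
  then have Ai: "integrable lborel ?A"
    by (intro integrable_outside) auto
  have S: "(\<lambda>L. ?S L v) \<longlonglongrightarrow> ?A v - ?E v" if "norm (?u v) \<noteq> 1" "?u v
      \<noteq> 0" for v
  proof -
    have "(\<lambda>L. G (?u v) * (\<Sum>j<L. of_real (hcoeff X \<rho> (p + k + j)) * ?u v ^ (p + j)))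
        \<longlonglongrightarrow>
       G (?u v) * ((if 1 < norm (?u v) then ?F (?u v) / ?u v ^ k else 0) - ?u v ^ p * ctail ?F (p + k) (?u v))"
      by (intro tendsto_mult_left hgen_tail_sums[unfolded sums_def] that)
    moreover have "G (?u v) * (\<Sum>j<L. of_real (hcoeff X \<rho> (p + k + j)) * ?u v ^ (p + j)) = ?S L v" for L
      by (simp add: sum_distrib_left mult_ac)
    moreover have "G (?u v) * ((if 1 < norm (?u v) then ?F (?u v) / ?u v ^ k else 0) - ?u v ^ p * ctail ?F (p +
        k) (?u v)) = ?A v - ?E v"
    proof -
      have "G (?u v) * ?F (?u v) = gexp (2 * X * \<rho> - 2 * X' * \<kappa>) (2 * \<kappa>\<^sup>2 - 2 *
          \<rho>\<^sup>2) (?u v)"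
        by (simp add: G_def hgen_eq_gexp gexp_mult)
      then have "?A v = G (?u v) * (if 1 < norm (?u v) then ?F (?u v) / ?u v ^ k else 0)"
        by simp
      then show ?thesis
        by (simp only: right_diff_distrib mult_ac)
    qed
    ultimately show ?thesis
      by simp
  qed
  have Slim: "(\<lambda>L. ?S L v) \<longlonglongrightarrow> S v" if "norm (?u v) \<noteq> 1" "?u v \<noteq> 0" for v
    unfolding S_def limI[OF S[OF that]] by (rule S[OF that])
  have [measurable]: "S \<in> borel_measurable lborel"
    unfolding S_def by (rule borel_measurable_lim_metric) (rule meas)
  \<comment> \<open>q lies between 1, for the geometric series, and \<kappa> / \<rho>, for the decay
    rate c below.\<close>
  obtain q where q: "1 < q" "q < \<kappa> / \<rho>"
    using dense[of 1 "\<kappa> / \<rho>"] assms by auto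
  then have q\<rho>: "\<rho> * q < \<kappa>"
    using assms by (simp add: field_simps)
  define b where "b = 1 + \<bar>a\<bar>"
  define c where "c = \<kappa>\<^sup>2 - (\<rho> * q)\<^sup>2"
  have c: "0 < c"
    unfolding c_def using q\<rho> q assms by (simp add: power_strict_mono)
  define C where "C = exp (2 * \<bar>X * \<rho>\<bar> * q * b + (\<rho> * q)\<^sup>2 * b\<^sup>2) * (q / (q -
      1)) * exp (- 2 * X' * \<kappa> * a + \<kappa>\<^sup>2 * a\<^sup>2)"
  define w where "w = (\<lambda>v. C * exp ((2 * \<bar>X * \<rho>\<bar> * q + 2 * (\<rho> * q)\<^sup>2 * b) *
      \<bar>v\<bar> - c * v\<^sup>2))"
  have wi: "integrable lborel w"
    unfolding w_def by (intro integrable_mult_right integrable_exp_abs_gauss c)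
  have bound: "norm (?S L v) \<le> w v" for L v
  proof -
    have "norm (?S L v) = norm (\<Sum>j<L. of_real (hcoeff X \<rho> (p + k + j)) * ?u v ^ (p + j)) * norm (G (?u v))"
      unfolding norm_mult[symmetric] by (simp add: sum_distrib_left sum_distrib_right mult_ac)
    also have "\<dots> \<le> exp (2 * \<bar>X * \<rho>\<bar> * (q * (b + \<bar>v\<bar>)) + \<rho>\<^sup>2 * (q
        * (b + \<bar>v\<bar>))\<^sup>2) * (q / (q - 1)) * norm (G (?u v))"
      using cmod_le[of "?u v"] q by (intro mult_right_mono hgen_partial_sum_bound) (auto simp: b_def)
    also have "\<dots> = w v"
    proof -
      have expo: "2 * y * (q * (b + r)) + \<rho>\<^sup>2 * (q * (b + r))\<^sup>2 + (- 2 * X' * \<kappa> * a + 2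
          * \<kappa>\<^sup>2 / 2 * (a\<^sup>2 - r\<^sup>2)) =
        2 * y * q * b + (\<rho> * q)\<^sup>2 * b\<^sup>2 + (- 2 * X' * \<kappa> * a + \<kappa>\<^sup>2 * a\<^sup>2) +
        ((2 * y * q + 2 * (\<rho> * q)\<^sup>2 * b) * r - (\<kappa>\<^sup>2 - (\<rho> * q)\<^sup>2) *
            r\<^sup>2)" for y r
        by (simp add: power2_eq_square algebra_simps)
      have "exp (2 * \<bar>X * \<rho>\<bar> * (q * (b + \<bar>v\<bar>)) + \<rho>\<^sup>2 * (q * (b +
          \<bar>v\<bar>))\<^sup>2) * (q / (q - 1)) * norm (G (?u v)) =
        exp (2 * \<bar>X * \<rho>\<bar> * (q * (b + \<bar>v\<bar>)) + \<rho>\<^sup>2 * (q * (b +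
            \<bar>v\<bar>))\<^sup>2 + (- 2 * X' * \<kappa> * a + 2 * \<kappa>\<^sup>2 / 2 * (a\<^sup>2 -
                \<bar>v\<bar>\<^sup>2))) * (q / (q - 1))"
        unfolding G_def norm_gexp exp_add power2_abs by (simp only: mult_ac)
      also have "\<dots> = w v"
        unfolding expo unfolding w_def C_def c_def exp_add power2_abs by (simp only: mult_ac)
      finally show ?thesis .
    qed
    finally show ?thesis .
  qed
  have lim: "(\<lambda>L. LBINT v. ?S L v) \<longlonglongrightarrow> (LBINT v. S v)"
    and SI: "integrable lborel S"
  proof -
    have "AE v in lborel. (\<lambda>L. ?S L v) \<longlonglongrightarrow> S v"
      using AE_Complex_norm_neq[of a] by eventually_elim (use Slim in auto)
    moreover have "AE v in lborel. norm (?S L v) \<le> w v" for L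
      using bound by (rule AE_I2)
    ultimately show "(\<lambda>L. LBINT v. ?S L v) \<longlonglongrightarrow> (LBINT v. S v)" "integrable lborel S"
      by (rule integral_dominated_convergence[OF \<open>S \<in> _\<close> meas wi],
          rule integrable_dominated_convergence[OF \<open>S \<in> _\<close> meas wi])
  qed
  define E where "E = (\<lambda>v. if v = 0 then (if a = 0 then ?E 0 else ?A 0 - S 0) else ?A v - S v)"
  have E: "E v = ?E v" if "norm (?u v) \<noteq> 1" for v
  proof (cases "?u v = 0")
    case True
    then show ?thesis by (auto simp: E_def complex_eq_iff)
  next
    case False
    have "S v = ?A v - ?E v"
      by (rule LIMSEQ_unique[OF Slim[OF that False] S[OF that False]])
    then have "?E v = ?A v - S v"
      by (simp only: diff_diff_eq2 add_diff_cancel_left')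
    then show ?thesis
      using False by (auto simp: E_def complex_eq_iff)
  qed
  have "(LBINT v. E v) = (LBINT v. ?A v - S v)"
  proof (rule integral_cong_AE)
    have "AE v in lborel. v \<noteq> (0::real)"
      by (rule AE_lborel_singleton)
    then show "AE v in lborel. E v = ?A v - S v"
      by eventually_elim (auto simp: E_def)
    have [measurable]: "?A \<in> borel_measurable lborel"
      using Ai by (rule borel_measurable_integrable)
    show "E \<in> borel_measurable lborel" "(\<lambda>v. ?A v - S v) \<in> borel_measurable lborel"
      unfolding E_def by measurable
  qed
  also have "\<dots> = (LBINT v. ?A v) - (LBINT v. S v)"
    by (rule Bochner_Integration.integral_diff[OF Ai SI])
  finally have EI: "(LBINT v. ?A v) - (LBINT v. E v) = (LBINT v. S v)"
    by simp
  have "(\<Sum>j<L. of_real (hcoeff X \<rho> (p + k + j)) * (LBINT v. ?u v ^ (p + j) * G (?u v))) = (LBINT v.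
      ?S L v)" for L
    by (subst Bochner_Integration.integral_sum) (auto intro: int)
  then have "(\<lambda>j. of_real (hcoeff X \<rho> (p + k + j)) * (LBINT v. ?u v ^ (p + j) * G (?u v))) sums
      ((LBINT v. ?A v) - (LBINT v. E v))"
    unfolding sums_def EI using lim by simp
  with E show thesis
    by (rule that)
qed

section \<open>The error term in the bulk scaling\<close>

definition edge_pos :: "real \<Rightarrow> nat \<Rightarrow> real \<Rightarrow> real" where
  "edge_pos a N x = sqrt (2 * real N) * a + x / sqrt (2 * real N)"

text \<open>The macroscopic part N a and the microscopic part x / 2 separate without error
  term.\<close>

lemma edge_pos_mult:
  assumes "0 < N"
  shows "edge_pos a N x * sqrt (real N / 2) = real N * a + x / 2"
proof -
  have "sqrt (2 * real N) * sqrt (real N / 2) = sqrt (real N * real N)"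
    by (simp flip: real_sqrt_mult)
  then have 1: "sqrt (2 * real N) * sqrt (real N / 2) = real N"
    by simp
  have "sqrt (real N / 2) / sqrt (2 * real N) = sqrt (1 / 4)"
    using assms by (simp add: field_simps flip: real_sqrt_divide)
  then have 2: "sqrt (real N / 2) / sqrt (2 * real N) = 1 / 2"
    by (simp add: real_sqrt_divide)
  have "edge_pos a N x * sqrt (real N / 2) = a * (sqrt (2 * real N) * sqrt (real N / 2)) + x * (sqrt (real N /
      2) / sqrt (2 * real N))"
    by (simp add: edge_pos_def algebra_simps)
  then show ?thesis
    unfolding 1 2 by simp
qed

text \<open>The prefactor is exactly what is left over: \<rho>^m / (2^m' \<kappa>^m') contains N^((m
  - m') / 2) and 2^(- (m + m') / 2); the latter is the normalisation of the h*, the former the power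
  of N, since m - m' = n - n'.\<close>

lemma scaled_DBM_term:
  fixes t t' X X' a :: real
  assumes N: "0 < N" and m: "int m = int (N + n) + l" and m': "int m' = int (N + n') + l"
  defines "\<rho> \<equiv> sqrt (real N / 2)" and "\<tau> \<equiv> t' - t"
  defines "\<kappa> \<equiv> exp \<tau> * \<rho>"
  shows "complex_of_real (exp (- real N * \<tau>) * real N powr ((real n - real n') / 2) * (2 * real N) powr (-
      1 / 2) *
      DBM_term (N + n, X, t) (N + n', X', t') l) =
    of_real (exp (\<tau> * (real n' + 1)) / (2 * pi)) *
      (of_real (hcoeff X \<rho> m) * (LBINT v. Complex a v ^ m' * gexp (- 2 * X' * \<kappa>) (2 *
          \<kappa>\<^sup>2) (Complex a v)))"
proof -
  have \<rho>: "0 < \<rho>" and \<kappa>: "0 < \<kappa>"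
    using N by (auto simp: \<rho>_def \<kappa>_def)
  define y where "y = sqrt (real N)"
  define z :: real where "z = sqrt 2"
  have y: "0 < y" and z: "0 < z" "z * z = 2"
    using N by (auto simp: y_def z_def)
  have \<rho>yz: "\<rho> = y / z"
    by (simp add: \<rho>_def y_def z_def real_sqrt_divide)
  have p1: "real N powr ((real n - real n') / 2) = y ^ m / y ^ m'"
  proof -
    have "real n - real n' = real m - real m'"
      using m m' by linarith
    then have "real N powr ((real n - real n') / 2) = (real N powr (1 / 2)) powr (real m - real m')"
      by (simp add: powr_powr)
    also have "\<dots> = y ^ m / y ^ m'"
      using y N by (simp add: powr_half_sqrt y_def[symmetric] powr_diff powr_realpow)
    finally show ?thesis .
  qed
  have p2: "(2 * real N) powr (- 1 / 2) = 1 / (z * y)"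
    by (simp add: powr_minus powr_half_sqrt real_sqrt_mult z_def y_def field_simps)
  have sq: "sqrt (fact m' / fact m) * (hermite_star (int m) X * hermite_star (int m') X') =
      herm m X * herm m' X' / (sqrt pi * fact m * z ^ m * z ^ m')"
    by (simp add: hermite_star_nat real_sqrt_mult real_sqrt_divide real_sqrt_power z_def field_simps)
  \<comment> \<open>As m' = N + n' + l, the exponent - (N + l) equals (n' + 1) - (m' + 1); the
    second part is absorbed by \<kappa>^(m' + 1).\<close>
  have e: "exp (- real N * \<tau>) * exp (- of_int l * \<tau>) = exp (\<tau> * (real n' + 1)) / exp \<tau> ^ (m' + 1)"
  proof -
    have "real m' = real N + real n' + of_int l"
      using m' by linarith
    then show ?thesis
      by (simp add: exp_of_nat_mult[symmetric] exp_diff[symmetric] exp_add[symmetric] algebra_simps del: power_Suc)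
  qed
  have D: "DBM_term (N + n, X, t) (N + n', X', t') l =
     exp (- of_int l * \<tau>) * (herm m X * herm m' X' / (sqrt pi * fact m * z ^ m * z ^ m')) * exp (- (X'\<^sup>2))"
    unfolding sq[symmetric] DBM_term_def prod.case m[symmetric] m'[symmetric] nat_int \<tau>_def by (simp add:
        mult_ac)
  have "exp (- real N * \<tau>) * real N powr ((real n - real n') / 2) * (2 * real N) powr (- 1 / 2) *
      DBM_term (N + n, X, t) (N + n', X', t') l =
     (exp (- real N * \<tau>) * exp (- of_int l * \<tau>)) * (y ^ m / y ^ m' / (z * y) *
       (herm m X * herm m' X' / (sqrt pi * fact m * z ^ m * z ^ m')) * exp (- (X'\<^sup>2)))"
    unfolding p1 p2 D by simp
  also have "\<dots> = exp (\<tau> * (real n' + 1)) / (2 * pi) *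
     (hcoeff X \<rho> m * (sqrt pi * exp (- (X'\<^sup>2)) * herm m' X' / (2 ^ m' * \<kappa> ^ (m' + 1))))"
  proof -
    have 2: "(2::real) ^ m' = z ^ m' * z ^ m'"
      using z by (simp flip: power_mult_distrib)
    have 3: "2 * pi = z * z * (sqrt pi * sqrt pi)"
      using z by simp
    show ?thesis
      unfolding e hcoeff_def \<kappa>_def \<rho>yz power_mult_distrib 2 3
      using y z(1) by (simp add: field_simps power_divide)
  qed
  finally show ?thesis
    unfolding integral_power_gexp[OF \<kappa>] by (simp only: of_real_mult)
qed

lemma exp_minus_1_bound:
  fixes \<tau> :: real
  assumes "\<bar>\<tau>\<bar> \<le> 1 / 2"
  shows "\<bar>exp \<tau> - 1\<bar> \<le> 2 * \<bar>\<tau>\<bar>"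
proof (cases "0 \<le> \<tau>")
  case True
  then have "exp \<tau> \<le> 1 + \<tau> + \<tau>\<^sup>2"
    using assms by (intro exp_bound) auto
  moreover have "\<tau>\<^sup>2 \<le> \<tau>"
    using True assms by (simp add: power2_eq_square mult_left_le)
  ultimately show ?thesis
    using True by auto
next
  case False
  have "1 + \<tau> \<le> exp \<tau>" "exp \<tau> \<le> 1"
    using False by (auto intro: exp_ge_add_one_self)
  then show ?thesis
    using False by linarith
qed

text \<open>log r <= r - 1 at the critical radius 1. Then N (r - 1) - N r^2 / 2 is the perfect
  square - N (r - 1)^2 / 2 minus N / 2.\<close>

lemma power_le_exp: "0 \<le> r \<Longrightarrow> r ^ k \<le> exp (real k * (r - 1))" for r :: real
  using exp_ge_add_one_self[of "r - 1"] power_mono[of r "exp (r - 1)" k]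
  by (simp add: exp_of_nat_mult)

lemma norm_hgen_cis_le:
  assumes "0 < N"
  shows "norm (hgen (edge_pos a N x) (sqrt (real N / 2)) (cis \<theta>)) \<le>
    exp (\<bar>x\<bar> + real N * a\<^sup>2 + real N / 2) * exp (- (real N / 4 * (cos \<theta> - a)\<^sup>2))"
proof -
  have "Re ((cis \<theta>)\<^sup>2) = 2 * (cos \<theta>)\<^sup>2 - 1"
    by (simp add: Re_power2 sin_squared_eq)
  moreover have "Re (2 * of_real r * z - of_real q * w) = 2 * r * Re z - q * Re w" for r q z w
    by simp
  ultimately have "norm (hgen (edge_pos a N x) (sqrt (real N / 2)) (cis \<theta>)) =
     exp (2 * (real N * a + x / 2) * cos \<theta> - real N / 2 * (2 * (cos \<theta>)\<^sup>2 - 1))"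
    unfolding hgen_def edge_pos_mult[OF assms] norm_exp_eq_Re by simp
  also have "\<dots> \<le> exp (\<bar>x\<bar> + real N * a\<^sup>2 + real N / 2 - real N / 4 * (cos \<theta> -
      a)\<^sup>2)"
  proof -
    have "x * cos \<theta> \<le> \<bar>x\<bar>"
      using abs_cos_le_one[of \<theta>] abs_le_D1[of "x * cos \<theta>" "\<bar>x\<bar>"] by (simp add: abs_mult
          mult_left_le)
    \<comment> \<open>The rate N on the circle is weakened to N / 4, the rate that is available on
      the line.\<close>
    moreover have "real N / 4 * (cos \<theta> - a)\<^sup>2 \<le> real N * (cos \<theta> - a)\<^sup>2"
      by (intro mult_right_mono) auto
    moreover have "2 * (real N * a + x / 2) * cos \<theta> - real N / 2 * (2 * (cos \<theta>)\<^sup>2 - 1) =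
        x * cos \<theta> + real N * a\<^sup>2 + real N / 2 - real N * (cos \<theta> - a)\<^sup>2"
    proof -
      obtain h where h: "real N = 2 * h"
        by (metis mult.commute nonzero_mult_div_cancel_left times_divide_eq_right zero_neq_numeral)
      show ?thesis
        unfolding h by (simp add: power2_eq_square algebra_simps)
    qed
    ultimately show ?thesis
      unfolding exp_le_cancel_iff by linarith
  qed
  finally show ?thesis
    by (simp flip: exp_add)
qed

text \<open>For s = 0 and n' = 0 the decay rate in |w| - 1 is N / 2. Half of it pays for the time
  shift and the surplus power n'; this is the condition 4 (S + n') <= N. The constant exp (- N a^2 -
  N / 2) is the inverse of the one on the circle.\<close>

lemma norm_power_gexp_edge_le:
  fixes N n' :: nat and a x' s S :: real
  assumes N: "0 < N" "S \<le> real N" "4 * (S + real n') \<le> real N" and s: "\<bar>s\<bar> \<le> S" and a: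
      "\<bar>a\<bar> \<le> 1"
  defines "\<kappa> \<equiv> exp (s / (2 * real N)) * sqrt (real N / 2)"
  shows "norm (Complex a v ^ (N + n') * gexp (- 2 * edge_pos a N x' * \<kappa>) (2 * \<kappa>\<^sup>2) (Complex
      a v)) \<le>
    exp (S\<^sup>2 + 2 * \<bar>x'\<bar> + S + real n' - real N * a\<^sup>2 - real N / 2) * exp (- (real N / 4 *
        (norm (Complex a v) - 1)\<^sup>2))"
proof -
  define r where "r = norm (Complex a v)"
  define \<tau> where "\<tau> = s / (2 * real N)"
  define E where "E = exp \<tau>"
  have \<tau>: "\<bar>\<tau>\<bar> \<le> 1 / 2" "2 * \<bar>\<tau>\<bar> \<le> S / real N"
    using N s by (auto simp: \<tau>_def abs_mult field_simps)
  have v2: "v\<^sup>2 = r\<^sup>2 - a\<^sup>2" and r: "0 \<le> r"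
    by (auto simp: r_def cmod_power2)
  have \<kappa>2: "\<kappa>\<^sup>2 = real N / 2 * E\<^sup>2"
    by (simp add: \<kappa>_def E_def \<tau>_def power_mult_distrib)
  have X\<kappa>: "edge_pos a N x' * \<kappa> = E * (real N * a + x' / 2)"
    using edge_pos_mult[OF N(1), of a x'] by (simp add: \<kappa>_def E_def \<tau>_def mult_ac)
  have E: "E \<le> 2" "0 \<le> E" "(E - 1)\<^sup>2 \<le> (S / real N)\<^sup>2" "1 - S / real N \<le> E\<^sup>2"
  proof -
    have le: "\<bar>E - 1\<bar> \<le> 2 * \<bar>\<tau>\<bar>"
      unfolding E_def using \<tau> by (intro exp_minus_1_bound)
    then show "E \<le> 2"
      using \<tau> by linarith
    have "\<bar>E - 1\<bar> \<le> \<bar>S / real N\<bar>"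
      using le \<tau> by linarith
    then show "(E - 1)\<^sup>2 \<le> (S / real N)\<^sup>2"
      by (simp only: abs_le_square_iff)
    have "1 + 2 * \<tau> \<le> E\<^sup>2"
      using exp_ge_add_one_self[of "2 * \<tau>"] by (simp add: E_def exp_double)
    then show "1 - S / real N \<le> E\<^sup>2"
      using \<tau> by linarith
    show "0 \<le> E" by (simp add: E_def)
  qed
  have b1: "real N * a\<^sup>2 * (E - 1)\<^sup>2 \<le> S\<^sup>2"
  proof -
    have "a\<^sup>2 \<le> 1"
      using a by (simp add: abs_square_le_1)
    then have "real N * a\<^sup>2 * (E - 1)\<^sup>2 \<le> real N * 1 * (S / real N)\<^sup>2"
      using E by (intro mult_mono) auto
    also have "\<dots> = S\<^sup>2 / real N"
      using N by (simp add: power2_eq_square)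
    also have "\<dots> \<le> S\<^sup>2 / 1"
      using N by (intro divide_left_mono) auto
    finally show ?thesis by simp
  qed
  have b2: "- (a * E * x') \<le> 2 * \<bar>x'\<bar>"
  proof -
    have "- (a * E * x') \<le> \<bar>a\<bar> * E * \<bar>x'\<bar>"
      using E abs_ge_minus_self[of "a * E * x'"] by (simp add: abs_mult)
    also have "\<dots> \<le> 1 * 2 * \<bar>x'\<bar>"
      using a E by (intro mult_mono) auto
    finally show ?thesis by simp
  qed
  have b3: "real N / 2 * (1 - E\<^sup>2) * r\<^sup>2 \<le> S / 2 * r\<^sup>2"
  proof (rule mult_right_mono)
    have "real N / 2 * (1 - E\<^sup>2) \<le> real N / 2 * (S / real N)"
      using E by (intro mult_left_mono) auto
    then show "real N / 2 * (1 - E\<^sup>2) \<le> S / 2"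
      using N by simp
  qed auto
  \<comment> \<open>The only place where unbounded r has to be compensated by the spare rate N /
    4.\<close>
  have b4: "S / 2 * r\<^sup>2 + real n' * (r - 1) \<le> S + real n' + real N / 4 * (r - 1)\<^sup>2"
  proof -
    have S: "0 \<le> S" using s by auto
    have "S / 2 * r\<^sup>2 \<le> S / 2 * (2 + 2 * (r - 1)\<^sup>2)"
      using S sum_power2_ge_zero[of "r - 2" 0] by (intro mult_left_mono) (auto simp: power2_eq_square algebra_simps)
    moreover have "real n' * (r - 1) \<le> real n' * (1 + (r - 1)\<^sup>2)"
    proof (rule mult_left_mono)
      show "r - 1 \<le> 1 + (r - 1)\<^sup>2"
        using zero_le_power2[of "r - 1 - 1 / 2"] by (simp add: power2_eq_square algebra_simps)
    qed auto
    moreover have "(S + real n') * (r - 1)\<^sup>2 \<le> real N / 4 * (r - 1)\<^sup>2"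
      using N by (intro mult_right_mono) auto
    ultimately show ?thesis
      by (simp add: algebra_simps)
  qed
  have "norm (Complex a v ^ (N + n') * gexp (- 2 * edge_pos a N x' * \<kappa>) (2 * \<kappa>\<^sup>2) (Complex a v)) =
     r ^ (N + n') * exp (- 2 * (edge_pos a N x' * \<kappa>) * a + \<kappa>\<^sup>2 * (a\<^sup>2 - v\<^sup>2))"
    unfolding norm_mult norm_power norm_gexp r_def by (simp add: mult_ac)
  also have "\<dots> \<le> exp (real (N + n') * (r - 1)) * exp (- 2 * (edge_pos a N x' * \<kappa>) * a +
      \<kappa>\<^sup>2 * (a\<^sup>2 - v\<^sup>2))"
    using r by (intro mult_right_mono power_le_exp) auto
  also have "\<dots> = exp (real N * (r - 1) + real n' * (r - 1) - 2 * real N * a\<^sup>2 * E - a * E * x' +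
      real N / 2 * E\<^sup>2 * (2 * a\<^sup>2 - r\<^sup>2))"
    unfolding X\<kappa> \<kappa>2 v2 by (simp add: power2_eq_square algebra_simps flip: exp_add)
  also have "real N * (r - 1) + real n' * (r - 1) - 2 * real N * a\<^sup>2 * E - a * E * x' + real N / 2 *
      E\<^sup>2 * (2 * a\<^sup>2 - r\<^sup>2) =
     real N * a\<^sup>2 * (E - 1)\<^sup>2 - real N * a\<^sup>2 - a * E * x' + real N / 2 * (1 - E\<^sup>2) *
         r\<^sup>2 + real n' * (r - 1)
     - real N / 2 * (r - 1)\<^sup>2 - real N / 2"
    by (simp add: power2_eq_square field_simps)
  also have "exp \<dots> \<le> exp (S\<^sup>2 + 2 * \<bar>x'\<bar> + S + real n' - real N * a\<^sup>2 - real N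
      / 2 - real N / 4 * (r - 1)\<^sup>2)"
    unfolding exp_le_cancel_iff using b1 b2 b3 b4 by linarith
  finally show ?thesis
    by (simp add: r_def flip: exp_add)
qed

text \<open>The exponentially large and small constants of circle and line cancel. Here \<delta> = 1
  - |a| and A = N / 4, so 1 / sqrt (N / 4) turns 32 into 64.\<close>

lemma edge_error_bound:
  fixes N n' :: nat and a x x' s S B :: real
  assumes N: "0 < N" "S \<le> real N" "4 * (S + real n') \<le> real N" and s: "\<bar>s\<bar> \<le> S" and a:
      "\<bar>a\<bar> < 1"
    and B: "\<bar>x\<bar> \<le> B" "\<bar>x'\<bar> \<le> B"
  defines "\<kappa> \<equiv> exp (s / (2 * real N)) * sqrt (real N / 2)"
  assumes E: "\<And>v. norm (Complex a v) \<noteq> 1 \<Longrightarrow> E v =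
      (Complex a v ^ (N + n') * gexp (- 2 * edge_pos a N x' * \<kappa>) (2 * \<kappa>\<^sup>2) (Complex a v)) *
      ctail (hgen (edge_pos a N x) (sqrt (real N / 2))) m (Complex a v)"
  shows "norm (LBINT v. E v) \<le> exp (S\<^sup>2 + 3 * B + S + real n') * (64 * skern_int\<^sup>2 / (pi * (1 -
      \<bar>a\<bar>))) / sqrt (real N)"
proof -
  have "norm (LBINT v. E v) \<le> exp (\<bar>x\<bar> + real N * a\<^sup>2 + real N / 2) *
      exp (S\<^sup>2 + 2 * \<bar>x'\<bar> + S + real n' - real N * a\<^sup>2 - real N / 2) *
      (32 * skern_int\<^sup>2 / (pi * (1 - \<bar>a\<bar>))) / sqrt (real N / 4)"
  proof (rule norm_integral_ctail_le(1)[OF hgen_holomorphic _ _ _ norm_hgen_cis_le[OF N(1)] E])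
    show "norm (Complex a v ^ (N + n') * gexp (- 2 * edge_pos a N x' * \<kappa>) (2 * \<kappa>\<^sup>2)
        (Complex a v)) \<le>
    exp (S\<^sup>2 + 2 * \<bar>x'\<bar> + S + real n' - real N * a\<^sup>2 - real N / 2) * exp (- (real N / 4 *
        (norm (Complex a v) - 1)\<^sup>2))" for v
      unfolding \<kappa>_def using N s a by (intro norm_power_gexp_edge_le) auto
  qed (use N a in auto)
  also have "\<dots> = exp (S\<^sup>2 + (\<bar>x\<bar> + 2 * \<bar>x'\<bar>) + S + real n') * (64 *
      skern_int\<^sup>2 / (pi * (1 - \<bar>a\<bar>))) / sqrt (real N)"
    by (simp add: real_sqrt_divide algebra_simps flip: exp_add)
  also have "\<dots> \<le> exp (S\<^sup>2 + 3 * B + S + real n') * (64 * skern_int\<^sup>2 / (pi * (1 -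
      \<bar>a\<bar>))) / sqrt (real N)"
    using a B by (intro divide_right_mono mult_right_mono) auto
  finally show ?thesis .
qed

section \<open>Convergence of the parameters\<close>

lemma exp_minus_1_minus_bound:
  fixes \<tau> :: real
  assumes "\<tau> \<le> 1"
  shows "\<bar>exp \<tau> - 1 - \<tau>\<bar> \<le> \<tau>\<^sup>2"
proof -
  have "exp \<tau> \<le> 1 + \<tau> + \<tau>\<^sup>2"
  proof (cases "0 \<le> \<tau>")
    case True
    then show ?thesis
      using assms by (intro exp_bound) auto
  next
    case False
    \<comment> \<open>For negative \<tau> the product is 1 - \<tau>^3 >= 1, and 1 - \<tau> is then
      replaced by the larger exp (- \<tau>).\<close>
    have "1 \<le> (1 + \<tau> + \<tau>\<^sup>2) * (1 - \<tau>)"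
      using False by (simp add: algebra_simps power2_eq_square mult_nonneg_nonpos mult_nonpos_nonneg zero_le_mult_iff)
    also have "\<dots> \<le> (1 + \<tau> + \<tau>\<^sup>2) * exp (- \<tau>)"
    proof (rule mult_left_mono)
      show "1 - \<tau> \<le> exp (- \<tau>)"
        using exp_ge_add_one_self[of "- \<tau>"] by simp
      show "0 \<le> 1 + \<tau> + \<tau>\<^sup>2"
        using zero_le_power2[of "\<tau> + 1 / 2"] by (simp add: power2_eq_square algebra_simps)
    qed
    finally show ?thesis
      by (simp add: exp_minus field_simps)
  qed
  moreover have "1 + \<tau> \<le> exp \<tau>"
    by (rule exp_ge_add_one_self)
  ultimately show ?thesis
    by linarith
qed

lemma norm_exp_diff_le:
  fixes A B :: complex
  assumes "Re A \<le> M" "Re B \<le> M"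
  shows "norm (exp A - exp B) \<le> exp M * norm (A - B)"
proof (rule field_differentiable_bound[where S="{z. Re z \<le> M}" and f'=exp])
  show "convex {z. Re z \<le> M}"
    by (rule convex_halfspace_Re_le)
qed (use assms in \<open>auto intro: DERIV_exp has_field_derivative_at_within simp: norm_exp_eq_Re\<close>)

text \<open>With \<tau> = s / (2 N), the term 2 N a (1 - exp \<tau>) of \<beta> produces the drift -
  a s, and \<sigma> = N (exp (2 \<tau>) - 1) tends to s. The inequality s <= \<sigma> keeps the
  Gaussian decay at least as strong as in the limit.\<close>

lemma edge_parameters:
  fixes N :: nat and a x x' s S B :: real
  assumes N: "0 < N" "2 * S \<le> real N" and s: "\<bar>s\<bar> \<le> S" and a: "\<bar>a\<bar> \<le> 1" and B:
      "\<bar>x'\<bar> \<le> B"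
  defines "\<rho> \<equiv> sqrt (real N / 2)"
  defines "\<kappa> \<equiv> exp (s / (2 * real N)) * \<rho>"
  defines "\<beta> \<equiv> 2 * edge_pos a N x * \<rho> - 2 * edge_pos a N x' * \<kappa>" and "\<sigma>
      \<equiv> 2 * \<kappa>\<^sup>2 - 2 * \<rho>\<^sup>2"
  shows "\<bar>\<beta> - (x - x' - a * s)\<bar> \<le> (B + S) * \<bar>s\<bar> / real N" "\<bar>\<sigma> -
      s\<bar> \<le> s\<^sup>2 / real N" "s \<le> \<sigma>"
proof -
  define \<tau> where "\<tau> = s / (2 * real N)"
  have s_eq: "s = 2 * real N * \<tau>"
    using N by (simp add: \<tau>_def)
  have \<tau>: "\<bar>\<tau>\<bar> \<le> 1 / 4" "real N * \<bar>\<tau>\<bar> = \<bar>s\<bar> / 2"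
    using N s by (auto simp: \<tau>_def abs_mult field_simps)
  have \<beta>: "\<beta> = 2 * real N * a + x - exp \<tau> * (2 * real N * a + x')"
  proof -
    have "\<beta> = 2 * (edge_pos a N x * \<rho>) - 2 * exp \<tau> * (edge_pos a N x' * \<rho>)"
      by (simp add: \<beta>_def \<kappa>_def \<tau>_def mult_ac)
    then show ?thesis
      unfolding \<rho>_def edge_pos_mult[OF N(1)] by (simp add: algebra_simps)
  qed
  have "\<beta> - (x - x' - a * s) = - x' * (exp \<tau> - 1) - 2 * real N * a * (exp \<tau> - 1 - \<tau>)"
    unfolding \<beta> s_eq by (simp add: algebra_simps)
  also have "\<bar>\<dots>\<bar> \<le> \<bar>x'\<bar> * \<bar>exp \<tau> - 1\<bar> + 2 * real N * \<bar>a\<bar>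
      * \<bar>exp \<tau> - 1 - \<tau>\<bar>"
    by (intro order.trans[OF abs_triangle_ineq4]) (simp add: abs_mult)
  also have "\<dots> \<le> B * (2 * \<bar>\<tau>\<bar>) + 2 * real N * 1 * \<tau>\<^sup>2"
    using B a \<tau> by (intro add_mono mult_mono exp_minus_1_bound exp_minus_1_minus_bound) auto
  also have "\<dots> = (2 * B * real N * \<bar>\<tau>\<bar> + 2 * (real N * \<bar>\<tau>\<bar>)\<^sup>2) / real N"
    using N by (simp add: power2_eq_square field_simps)
  also have "\<dots> = (B * \<bar>s\<bar> + \<bar>s\<bar> * \<bar>s\<bar> / 2) / real N"
    unfolding mult.assoc[of "2 * B"] \<tau>(2) by (simp add: power2_eq_square)
  also have "\<dots> \<le> ((B + S) * \<bar>s\<bar>) / real N"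
  proof (rule divide_right_mono)
    have "\<bar>s\<bar> * \<bar>s\<bar> \<le> S * \<bar>s\<bar>" "0 \<le> \<bar>s\<bar> * \<bar>s\<bar>"
      using s by (intro mult_right_mono mult_nonneg_nonneg; simp)+
    then show "B * \<bar>s\<bar> + \<bar>s\<bar> * \<bar>s\<bar> / 2 \<le> (B + S) * \<bar>s\<bar>"
      unfolding distrib_right by linarith
  qed simp
  finally show "\<bar>\<beta> - (x - x' - a * s)\<bar> \<le> (B + S) * \<bar>s\<bar> / real N" .
  have \<sigma>: "\<sigma> = real N * (exp (2 * \<tau>) - 1)"
    by (simp add: \<sigma>_def \<kappa>_def \<rho>_def \<tau>_def power_mult_distrib algebra_simps flip: exp_double)
  have \<sigma>': "\<sigma> - s = real N * (exp (2 * \<tau>) - 1 - 2 * \<tau>)"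
    unfolding \<sigma> s_eq by (simp add: algebra_simps)
  have "\<bar>\<sigma> - s\<bar> \<le> real N * (2 * \<tau>)\<^sup>2"
    unfolding \<sigma>' abs_mult using \<tau> by (intro mult_mono exp_minus_1_minus_bound) auto
  also have "\<dots> = s\<^sup>2 / real N"
    unfolding s_eq using N by (simp add: power2_eq_square)
  finally show "\<bar>\<sigma> - s\<bar> \<le> s\<^sup>2 / real N" .
  have "0 \<le> \<sigma> - s"
  proof -
    have "1 + 2 * \<tau> \<le> exp (2 * \<tau>)"
      by (rule exp_ge_add_one_self)
    then show ?thesis
      unfolding \<sigma>' by (intro mult_nonneg_nonneg) linarith+
  qed
  then show "s \<le> \<sigma>" by simp
qed

section \<open>Comparison of the line integrals with their limits\<close>

lemma Re_gexp_arg: "Re (of_real \<beta> * Complex a v + of_real \<sigma> / 2 * (Complex a v)\<^sup>2) = \<beta>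
    * a + \<sigma> / 2 * (a\<^sup>2 - v\<^sup>2)"
  by (simp add: power2_eq_square)

lemma gexp_diff_le:
  assumes "c + \<beta> * a + \<sigma> / 2 * (a\<^sup>2 - v\<^sup>2) \<le> M" "\<beta>' * a + \<sigma>' / 2 *
      (a\<^sup>2 - v\<^sup>2) \<le> M"
  shows "norm (of_real (exp c) * gexp \<beta> \<sigma> (Complex a v) - gexp \<beta>' \<sigma>' (Complex a v)) \<le>
    exp M * (\<bar>c\<bar> + \<bar>\<beta> - \<beta>'\<bar> * norm (Complex a v) + \<bar>\<sigma> -
        \<sigma>'\<bar> / 2 * (norm (Complex a v))\<^sup>2)"
proof -
  let ?u = "Complex a v"
  let ?A = "of_real c + (of_real \<beta> * ?u + of_real \<sigma> / 2 * ?u\<^sup>2)" and ?B = "of_real \<beta>'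
      * ?u + of_real \<sigma>' / 2 * ?u\<^sup>2"
  have "of_real (exp c) * gexp \<beta> \<sigma> ?u = exp ?A"
    by (simp add: gexp_def exp_add exp_of_real)
  then have "norm (of_real (exp c) * gexp \<beta> \<sigma> ?u - gexp \<beta>' \<sigma>' ?u) = norm (exp ?A - exp ?B)"
    by (simp add: gexp_def)
  also have "\<dots> \<le> exp M * norm (?A - ?B)"
  proof (rule norm_exp_diff_le)
    show "Re ?A \<le> M"
      unfolding plus_complex.sel(1)[of "of_real c"] Re_gexp_arg using assms(1) by simp
    show "Re ?B \<le> M"
      unfolding Re_gexp_arg by (rule assms(2))
  qed
  also have "?A - ?B = of_real c + of_real (\<beta> - \<beta>') * ?u + of_real ((\<sigma> - \<sigma>') / 2) *
      ?u\<^sup>2"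
    by (simp add: algebra_simps diff_divide_distrib)
  also have "norm \<dots> \<le> \<bar>c\<bar> + \<bar>\<beta> - \<beta>'\<bar> * norm ?u + \<bar>\<sigma> -
      \<sigma>'\<bar> / 2 * (norm ?u)\<^sup>2"
    by (intro order.trans[OF norm_triangle_ineq] add_mono) (auto simp: norm_mult norm_power simp flip:
        of_real_diff of_real_divide)
  finally show ?thesis
    by simp
qed

lemma mult_exp_neg_le:
  fixes y :: real
  shows "y * exp (- (y\<^sup>2 / 2)) \<le> exp (- (y\<^sup>2 / 4))" "y\<^sup>2 * exp (- (y\<^sup>2 / 2)) \<le>
      4 * exp (- (y\<^sup>2 / 4))"
proof -
  have e: "exp (- (y\<^sup>2 / 2)) = exp (- (y\<^sup>2 / 4)) * exp (- (y\<^sup>2 / 4))"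
    by (simp flip: exp_add)
  have 1: "1 + y\<^sup>2 / 4 \<le> exp (y\<^sup>2 / 4)"
    by (rule exp_ge_add_one_self)
  have "y \<le> 1 + y\<^sup>2 / 4"
    using zero_le_power2[of "y / 2 - 1"] by (simp add: power2_eq_square field_simps)
  then have "y \<le> exp (y\<^sup>2 / 4)" "y\<^sup>2 \<le> 4 * exp (y\<^sup>2 / 4)"
    using 1 by linarith+
  then have "y * exp (- (y\<^sup>2 / 4)) \<le> 1" "y\<^sup>2 * exp (- (y\<^sup>2 / 4)) \<le> 4"
    by (auto simp: exp_minus field_simps)
  then show "y * exp (- (y\<^sup>2 / 2)) \<le> exp (- (y\<^sup>2 / 4))" "y\<^sup>2 * exp (- (y\<^sup>2 / 2))
      \<le> 4 * exp (- (y\<^sup>2 / 4))"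
    unfolding e by (auto simp: mult_le_cancel_right1 simp flip: mult.assoc)
qed

text \<open>In the variable y = sqrt s |v| one factor sqrt s is left over, exactly what the Gaussian
  integral of rate s / 4 takes away; the powers of y are absorbed by half of the decay.\<close>

lemma gauss_weight_bound:
  fixes s S D v :: real
  assumes "0 < s" "s \<le> S" "0 \<le> D"
  shows "s * (D + D * \<bar>v\<bar> + s * v\<^sup>2) * exp (- (s * v\<^sup>2 / 2)) \<le> (D * sqrt S + D + 4 *
      sqrt S) * (sqrt s * exp (- (s / 4 * v\<^sup>2)))"
proof -
  define y where "y = sqrt s * \<bar>v\<bar>"
  have y2: "y\<^sup>2 = s * v\<^sup>2"
    using assms by (simp add: y_def power_mult_distrib)
  have ss: "s = sqrt s * sqrt s"
    using assms by simp
  have le: "sqrt s \<le> sqrt S"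
    using assms by simp
  have "s * (D + D * \<bar>v\<bar> + s * v\<^sup>2) * exp (- (s * v\<^sup>2 / 2)) =
     sqrt s * (sqrt s * D * exp (- (y\<^sup>2 / 2)) + D * (y * exp (- (y\<^sup>2 / 2))) + sqrt s * (y\<^sup>2 *
         exp (- (y\<^sup>2 / 2))))"
  proof -
    have "q * q * (D + D * r + q * q * r\<^sup>2) * e = q * (q * D * e + D * (q * r * e) + q * (q * q *
        r\<^sup>2 * e))" for q r e :: real
      by (simp add: algebra_simps)
    from this[of "sqrt s" "\<bar>v\<bar>" "exp (- (s * v\<^sup>2 / 2))"] show ?thesis
      unfolding y2 by (simp only: ss[symmetric] power2_abs y_def)
  qed
  also have "\<dots> \<le> sqrt s * (sqrt S * D * exp (- (y\<^sup>2 / 4)) + D * exp (- (y\<^sup>2 / 4)) + sqrt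
      S * (4 * exp (- (y\<^sup>2 / 4))))"
    using assms le by (intro mult_left_mono add_mono mult_mono mult_exp_neg_le) auto
  also have "\<dots> = (D * sqrt S + D + 4 * sqrt S) * (sqrt s * exp (- (s / 4 * v\<^sup>2)))"
    unfolding y2 by (simp add: algebra_simps)
  finally show ?thesis .
qed

text \<open>M is crude on purpose: it only has to bound all exponents independently of N and of the
  size of s.\<close>

lemma edge_exponents:
  fixes N n' :: nat and a x x' s S B :: real
  assumes N: "0 < N" "2 * S \<le> real N" and s: "\<bar>s\<bar> \<le> S" and a: "\<bar>a\<bar> \<le> 1" and B:
      "\<bar>x\<bar> \<le> B" "\<bar>x'\<bar> \<le> B"
  defines "\<rho> \<equiv> sqrt (real N / 2)"
  defines "\<kappa> \<equiv> exp (s / (2 * real N)) * \<rho>"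
  defines "\<beta> \<equiv> 2 * edge_pos a N x * \<rho> - 2 * edge_pos a N x' * \<kappa>" and "\<sigma>
      \<equiv> 2 * \<kappa>\<^sup>2 - 2 * \<rho>\<^sup>2"
    and "c \<equiv> s / (2 * real N) * (real n' + 1)" and "\<beta>' \<equiv> x - x' - a * s"
  defines "M \<equiv> (real n' + 1) * S + 2 * B + 3 * S + (B + S) * S + S\<^sup>2"
  shows "\<bar>c\<bar> \<le> (real n' + 1) * \<bar>s\<bar> / real N"
    and "\<bar>c\<bar> + \<bar>\<beta> * a\<bar> + \<bar>\<sigma>\<bar> \<le> M" "\<bar>\<beta>' * a\<bar> +
        \<bar>s\<bar> \<le> M"
proof -
  have S: "0 \<le> S" and B0: "0 \<le> B" and N1: "1 \<le> real N"
    using s B N by auto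
  note par = edge_parameters(1)[OF N s a B(2), of x, folded \<rho>_def, folded \<kappa>_def, folded \<beta>_def
      \<sigma>_def \<beta>'_def]
    edge_parameters(2,3)[OF N s a B(2), folded \<rho>_def, folded \<kappa>_def, folded \<beta>_def \<sigma>_def
        \<beta>'_def]
  show c: "\<bar>c\<bar> \<le> (real n' + 1) * \<bar>s\<bar> / real N"
  proof -
    have "\<bar>real n' + 1\<bar> = real n' + 1"
      by simp
    then have "\<bar>c\<bar> = (real n' + 1) * \<bar>s\<bar> / real N / 2"
      by (simp add: c_def abs_mult mult.commute)
    moreover have "0 \<le> (real n' + 1) * \<bar>s\<bar> / real N"
      by simp
    moreover have "z / 2 \<le> z" if "0 \<le> z" for z :: real
      using that by simp
    ultimately show ?thesis by (simp only:)
  qed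
  have c': "\<bar>c\<bar> \<le> (real n' + 1) * S"
  proof -
    have "(real n' + 1) * \<bar>s\<bar> / real N \<le> (real n' + 1) * S / 1"
      using s N1 S by (intro frac_le mult_left_mono) auto
    then show ?thesis using c by simp
  qed
  have b': "\<bar>\<beta>'\<bar> \<le> 2 * B + S"
  proof -
    have "\<bar>a * s\<bar> \<le> 1 * S"
      unfolding abs_mult using a s by (intro mult_mono) auto
    then show ?thesis
      using B by (simp add: \<beta>'_def)
  qed
  have b: "\<bar>\<beta>\<bar> \<le> 2 * B + S + (B + S) * S"
  proof -
    have "(B + S) * \<bar>s\<bar> / real N \<le> (B + S) * S / 1"
      using s N1 S B0 by (intro frac_le mult_left_mono) auto
    then show ?thesis
      using b' par(1) by simp
  qed
  have sg: "\<bar>\<sigma>\<bar> \<le> S + S\<^sup>2"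
  proof -
    have "s\<^sup>2 / real N \<le> S\<^sup>2 / 1"
      using s N1 abs_le_square_iff[of s S] S by (intro frac_le) auto
    then show ?thesis
      using par(2) s by simp
  qed
  have ba: "\<bar>y * a\<bar> \<le> \<bar>y\<bar>" for y
    using a by (simp add: abs_mult mult_left_le)
  show "\<bar>c\<bar> + \<bar>\<beta> * a\<bar> + \<bar>\<sigma>\<bar> \<le> M"
    using c' b sg ba[of \<beta>] S unfolding M_def by linarith
  show "\<bar>\<beta>' * a\<bar> + \<bar>s\<bar> \<le> M"
    using b' s ba[of \<beta>'] S B0 unfolding M_def by (smt (verit) mult_nonneg_nonneg zero_le_power2 of_nat_0_le_iff)
qed

lemma half_square_diff_le:
  fixes \<sigma> s a v :: real
  assumes "s \<le> \<sigma>" "0 \<le> s" "\<bar>a\<bar> \<le> 1"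
  shows "\<sigma> / 2 * (a\<^sup>2 - v\<^sup>2) \<le> \<bar>\<sigma>\<bar> - s * v\<^sup>2 / 2"
proof -
  have "a\<^sup>2 \<le> 1"
    using assms by (simp add: abs_square_le_1)
  then have "\<sigma> / 2 * a\<^sup>2 \<le> \<sigma> / 2 * 1"
    using assms by (intro mult_left_mono) auto
  moreover have "s / 2 * v\<^sup>2 \<le> \<sigma> / 2 * v\<^sup>2"
    using assms by (intro mult_right_mono) auto
  ultimately show ?thesis
    using assms by (simp add: algebra_simps)
qed

text \<open>The bound is uniform down to \<open>s = 0\<close>: both parameters differ by \<open>O(s / N)\<close>
  and the variance even by \<open>O(s\<^sup>2 / N)\<close>, which compensates the loss of \<open>s powr
  (- 1 / 2)\<close> in the Gaussian integral.\<close>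

lemma outside_integral_diff:
  fixes N n' k :: nat and a x x' s S B :: real
  assumes N: "0 < N" "2 * S \<le> real N" and s: "0 < s" "s \<le> S" and a: "\<bar>a\<bar> \<le> 1" and B:
      "\<bar>x\<bar> \<le> B" "\<bar>x'\<bar> \<le> B"
  defines "\<rho> \<equiv> sqrt (real N / 2)"
  defines "\<kappa> \<equiv> exp (s / (2 * real N)) * \<rho>"
  defines "\<beta> \<equiv> 2 * edge_pos a N x * \<rho> - 2 * edge_pos a N x' * \<kappa>" and "\<sigma>
      \<equiv> 2 * \<kappa>\<^sup>2 - 2 * \<rho>\<^sup>2"
    and "c \<equiv> s / (2 * real N) * (real n' + 1)" and "\<beta>' \<equiv> x - x' - a * s"
  defines "M \<equiv> (real n' + 1) * S + 2 * B + 3 * S + (B + S) * S + S\<^sup>2" and "D \<equiv> real n' + 1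
      + B + 2 * S"
  shows "norm (of_real (exp c) * (LBINT v. (if 1 < norm (Complex a v) then gexp \<beta> \<sigma> (Complex a v)
      / Complex a v ^ k else 0))
      - (LBINT v. (if 1 < norm (Complex a v) then gexp \<beta>' s (Complex a v) / Complex a v ^ k else 0))) \<le>
    exp M * (D * sqrt S + D + 4 * sqrt S) * sqrt (4 * pi) / real N"
proof -
  have s': "\<bar>s\<bar> \<le> S" using s by auto
  have S: "0 \<le> S" and B0: "0 \<le> B"
    using s B by auto
  note par = edge_parameters(1)[OF N s' a B(2), of x, folded \<rho>_def, folded \<kappa>_def, folded
      \<beta>_def \<sigma>_def \<beta>'_def]
    edge_parameters(2,3)[OF N s' a B(2), folded \<rho>_def, folded \<kappa>_def, folded \<beta>_def
        \<sigma>_def \<beta>'_def]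
  note ex = edge_exponents[OF N s' a B, of n', folded \<rho>_def, folded \<kappa>_def, folded \<beta>_def
      \<sigma>_def c_def \<beta>'_def M_def]
  have D: "0 \<le> D"
    using S B0 by (simp add: D_def)
  let ?u = "Complex a"
  let ?f = "\<lambda>v. if 1 < norm (?u v) then gexp \<beta> \<sigma> (?u v) / ?u v ^ k else 0"
  let ?g = "\<lambda>v. if 1 < norm (?u v) then gexp \<beta>' s (?u v) / ?u v ^ k else 0"
  define W where "W = exp M * (D * sqrt S + D + 4 * sqrt S) / real N"
  have fi: "integrable lborel ?f" and gi: "integrable lborel ?g"
    using s par(3) by (intro integrable_outside; linarith)+
  have pt: "norm (of_real (exp c) * ?f v - ?g v) \<le> W * (sqrt s * exp (- (s / 4 * v\<^sup>2)))" for v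
  proof -
    have "norm (of_real (exp c) * ?f v - ?g v) = norm (if 1 < norm (?u v) then (of_real (exp c) * gexp \<beta>
        \<sigma> (?u v) - gexp \<beta>' s (?u v)) / ?u v ^ k else 0)"
      by (simp add: diff_divide_distrib)
    also have "\<dots> \<le> norm (of_real (exp c) * gexp \<beta> \<sigma> (?u v) - gexp \<beta>' s (?u v))"
      by (rule norm_ge_1_power)
    also have "\<dots> \<le> exp (M - s * v\<^sup>2 / 2) * (\<bar>c\<bar> + \<bar>\<beta> - \<beta>'\<bar> *
        norm (?u v) + \<bar>\<sigma> - s\<bar> / 2 * (norm (?u v))\<^sup>2)"
    proof (rule gexp_diff_le)
      show "c + \<beta> * a + \<sigma> / 2 * (a\<^sup>2 - v\<^sup>2) \<le> M - s * v\<^sup>2 / 2"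
        using half_square_diff_le[OF par(3) _ a, of v] ex(2) s by linarith
      show "\<beta>' * a + s / 2 * (a\<^sup>2 - v\<^sup>2) \<le> M - s * v\<^sup>2 / 2"
        using half_square_diff_le[of s s a v] ex(3) s a by linarith
    qed
    also have "\<dots> \<le> exp (M - s * v\<^sup>2 / 2) * (s * (D + D * \<bar>v\<bar> + s * v\<^sup>2) / real N)"
    proof (rule mult_left_mono)
      have nu: "norm (?u v) \<le> 1 + \<bar>v\<bar>" "(norm (?u v))\<^sup>2 \<le> 1 + v\<^sup>2"
        using cmod_le[of "?u v"] a by (auto simp: cmod_power2 abs_square_le_1)
      have "\<bar>c\<bar> + \<bar>\<beta> - \<beta>'\<bar> * norm (?u v) + \<bar>\<sigma> - s\<bar> / 2 * (norm
          (?u v))\<^sup>2 \<le>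
         (real n' + 1) * s / real N + (B + S) * s / real N * (1 + \<bar>v\<bar>) + s\<^sup>2 / real N / 2 * (1
             + v\<^sup>2)"
        using ex(1) par(1,2) nu s S B0 by (intro add_mono mult_mono divide_right_mono) auto
      also have "\<dots> = s * ((real n' + 1) + (B + S) * (1 + \<bar>v\<bar>) + s / 2 + s / 2 * v\<^sup>2) / real N"
        using N by (simp add: power2_eq_square field_simps)
      also have "\<dots> \<le> s * (D + D * \<bar>v\<bar> + s * v\<^sup>2) / real N"
      proof (intro divide_right_mono mult_left_mono)
        have "(B + S) * \<bar>v\<bar> \<le> D * \<bar>v\<bar>" "s / 2 * v\<^sup>2 \<le> s * v\<^sup>2"
          using S B0 s by (auto intro!: mult_right_mono simp: D_def)
        with s S show "(real n' + 1) + (B + S) * (1 + \<bar>v\<bar>) + s / 2 + s / 2 * v\<^sup>2 \<le> D + D *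
            \<bar>v\<bar> + s * v\<^sup>2"
        proof -
          have "(B + S) * (1 + \<bar>v\<bar>) = B + S + (B + S) * \<bar>v\<bar>"
            by (simp add: algebra_simps)
          moreover have "D = real n' + 1 + B + 2 * S"
            by (simp add: D_def)
          ultimately show ?thesis
            using \<open>(B + S) * \<bar>v\<bar> \<le> D * \<bar>v\<bar>\<close> \<open>s / 2 * v\<^sup>2 \<le>
                s * v\<^sup>2\<close> s S by linarith
        qed
      qed (use s in auto)
      finally show "\<bar>c\<bar> + \<bar>\<beta> - \<beta>'\<bar> * norm (?u v) + \<bar>\<sigma> - s\<bar> / 2
          * (norm (?u v))\<^sup>2 \<le> s * (D + D * \<bar>v\<bar> + s * v\<^sup>2) / real N" .
    qed auto
    also have "\<dots> = exp M * (s * (D + D * \<bar>v\<bar> + s * v\<^sup>2) * exp (- (s * v\<^sup>2 / 2))) / real N"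
    proof -
      have "exp (M - s * v\<^sup>2 / 2) = exp M * exp (- (s * v\<^sup>2 / 2))"
        by (simp flip: exp_add)
      then show ?thesis
        by (simp only: times_divide_eq_right mult_ac)
    qed
    also have "\<dots> \<le> exp M * ((D * sqrt S + D + 4 * sqrt S) * (sqrt s * exp (- (s / 4 * v\<^sup>2)))) /
        real N"
      using s D by (intro divide_right_mono mult_left_mono gauss_weight_bound) auto
    finally show ?thesis
      by (simp add: W_def)
  qed
  have "norm (of_real (exp c) * (LBINT v. ?f v) - (LBINT v. ?g v)) = norm (LBINT v. of_real (exp c) * ?f v - ?g v)"
    by (subst Bochner_Integration.integral_diff[OF integrable_mult_right[OF fi] gi]) simp
  also have "\<dots> \<le> (LBINT v. W * (sqrt s * exp (- (s / 4 * v\<^sup>2))))"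
  proof (rule order.trans[OF integral_norm_bound], rule integral_mono)
    show "integrable lborel (\<lambda>v. W * (sqrt s * exp (- (s / 4 * v\<^sup>2))))"
      using s by (intro integrable_mult_right integrable_gauss) auto
    show "integrable lborel (\<lambda>v. norm (of_real (exp c) * ?f v - ?g v))"
      by (intro integrable_norm Bochner_Integration.integrable_diff integrable_mult_right fi gi)
  qed (rule pt)
  also have "\<dots> = W * (sqrt s * sqrt (pi / (s / 4)))"
    using s by (simp only: integral_mult_right_zero) (subst integrable_gauss(2), auto)
  \<comment> \<open>Here s cancels, so the bound does not degenerate as s tends to 0.\<close>
  also have "sqrt s * sqrt (pi / (s / 4)) = sqrt (4 * pi)"
    unfolding real_sqrt_mult[symmetric] using s by simp
  finally show ?thesis
    by (simp add: W_def)
qed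

lemma inside_integral_diff:
  fixes N n' k :: nat and a x x' s S B :: real
  assumes N: "0 < N" "2 * S \<le> real N" and s: "\<bar>s\<bar> \<le> S" and a: "\<bar>a\<bar> \<le> 1" and B:
      "\<bar>x\<bar> \<le> B" "\<bar>x'\<bar> \<le> B"
  defines "\<rho> \<equiv> sqrt (real N / 2)"
  defines "\<kappa> \<equiv> exp (s / (2 * real N)) * \<rho>"
  defines "\<beta> \<equiv> 2 * edge_pos a N x * \<rho> - 2 * edge_pos a N x' * \<kappa>" and "\<sigma>
      \<equiv> 2 * \<kappa>\<^sup>2 - 2 * \<rho>\<^sup>2"
    and "c \<equiv> s / (2 * real N) * (real n' + 1)" and "\<beta>' \<equiv> x - x' - a * s"
  defines "M \<equiv> (real n' + 1) * S + 2 * B + 3 * S + (B + S) * S + S\<^sup>2" and "D \<equiv> (real n' +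
      1) * S + (B + S) * S + S\<^sup>2"
  shows "norm (of_real (exp c) * (LBINT v. (if norm (Complex a v) < 1 then Complex a v ^ k * gexp \<beta>
      \<sigma> (Complex a v) else 0))
      - (LBINT v. (if norm (Complex a v) < 1 then Complex a v ^ k * gexp \<beta>' s (Complex a v) else 0))) \<le>
    exp M * D * 2 / real N"
proof -
  have S: "0 \<le> S" and B0: "0 \<le> B"
    using s B by auto
  note par = edge_parameters(1)[OF N s a B(2), of x, folded \<rho>_def, folded \<kappa>_def, folded \<beta>_def
      \<sigma>_def \<beta>'_def]
    edge_parameters(2,3)[OF N s a B(2), folded \<rho>_def, folded \<kappa>_def, folded \<beta>_def \<sigma>_def
        \<beta>'_def]
  note ex = edge_exponents[OF N s a B, of n', folded \<rho>_def, folded \<kappa>_def, folded \<beta>_def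
      \<sigma>_def c_def \<beta>'_def M_def]
  let ?u = "Complex a"
  let ?f = "\<lambda>v. if norm (?u v) < 1 then ?u v ^ k * gexp \<beta> \<sigma> (?u v) else 0"
  let ?g = "\<lambda>v. if norm (?u v) < 1 then ?u v ^ k * gexp \<beta>' s (?u v) else 0"
  have fi: "integrable lborel ?f" and gi: "integrable lborel ?g"
    by (intro integrable_inside continuous_intros)+
  have pt: "norm (of_real (exp c) * ?f v - ?g v) \<le> exp M * D / real N * indicator {-1..1} v" for v
  proof (cases "norm (?u v) < 1")
    case True
    have v: "\<bar>v\<bar> \<le> 1"
      using abs_Im_le_cmod[of "?u v"] True by simp
    have h: "\<sigma>' / 2 * (a\<^sup>2 - v\<^sup>2) \<le> \<bar>\<sigma>'\<bar>" for \<sigma>'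
    proof -
      have "\<bar>a\<^sup>2 - v\<^sup>2\<bar> \<le> 1"
        using a v abs_square_le_1[of a] abs_square_le_1[of v] zero_le_power2[of a] zero_le_power2[of v] by linarith
      then have "\<bar>\<sigma>' / 2 * (a\<^sup>2 - v\<^sup>2)\<bar> \<le> \<bar>\<sigma>' / 2\<bar> * 1"
        unfolding abs_mult by (intro mult_left_mono) auto
      then show ?thesis by linarith
    qed
    have half_le: "\<bar>\<sigma> - s\<bar> / 2 \<le> s\<^sup>2 / real N"
      by (rule order.trans[OF _ par(2)]) simp
    have "of_real (exp c) * ?f v - ?g v = ?u v ^ k * (of_real (exp c) * gexp \<beta> \<sigma> (?u v) - gexp
        \<beta>' s (?u v))"
      using True by (simp add: algebra_simps)
    also have "norm \<dots> \<le> 1 * norm (of_real (exp c) * gexp \<beta> \<sigma> (?u v) - gexp \<beta>' s (?u v))"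
      unfolding norm_mult norm_power using True by (intro mult_right_mono power_le_one) auto
    also have "\<dots> \<le> 1 * (exp M * (\<bar>c\<bar> + \<bar>\<beta> - \<beta>'\<bar> * norm (?u v) +
        \<bar>\<sigma> - s\<bar> / 2 * (norm (?u v))\<^sup>2))"
    proof (intro mult_left_mono gexp_diff_le)
      show "c + \<beta> * a + \<sigma> / 2 * (a\<^sup>2 - v\<^sup>2) \<le> M"
        using h[of \<sigma>] ex(2) by linarith
      show "\<beta>' * a + s / 2 * (a\<^sup>2 - v\<^sup>2) \<le> M"
        using h[of s] ex(3) by linarith
    qed auto
    also have "\<dots> \<le> 1 * (exp M * ((real n' + 1) * \<bar>s\<bar> / real N + (B + S) * \<bar>s\<bar> /
        real N * 1 + s\<^sup>2 / real N * 1))"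
      using ex(1) par(1) half_le True S B0
      by (intro mult_left_mono add_mono mult_mono) (auto intro: power_le_one)
    also have "\<dots> = exp M * ((real n' + 1) * \<bar>s\<bar> + (B + S) * \<bar>s\<bar> + s\<^sup>2) / real N"
      using N by (simp add: field_simps)
    also have "\<dots> \<le> exp M * D / real N"
      unfolding D_def using s S B0 abs_le_square_iff[of s S]
      by (intro divide_right_mono mult_left_mono add_mono) auto
    finally show ?thesis
      using v by (auto simp: abs_le_iff)
  next
    case False
    have "0 \<le> D"
      unfolding D_def using S B0 by simp
    then show ?thesis
      using False by (auto simp: indicator_def)
  qed
  have "norm (of_real (exp c) * (LBINT v. ?f v) - (LBINT v. ?g v)) = norm (LBINT v. of_real (exp c) * ?f v - ?g v)"
    by (subst Bochner_Integration.integral_diff[OF integrable_mult_right[OF fi] gi]) simp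
  also have "\<dots> \<le> (LBINT v. norm (of_real (exp c) * ?f v - ?g v))"
    by (rule integral_norm_bound)
  also have "\<dots> \<le> (LBINT v. exp M * D / real N * indicator {-1..1} (v::real))"
  proof (rule integral_mono)
    show "integrable lborel (\<lambda>v. norm (of_real (exp c) * ?f v - ?g v))"
      by (intro integrable_norm Bochner_Integration.integrable_diff integrable_mult_right fi gi)
  qed (use pt in auto)
  also have "\<dots> = exp M * D * 2 / real N"
    by simp
  finally show ?thesis .
qed

section \<open>The function phi as a line integral\<close>

lemma H_nonneg: "0 \<le> H k q"
  by (simp add: H_def)

lemma H_measurable [measurable]: "H k \<in> borel_measurable borel"
  unfolding H_def[abs_def] by measurable

lemma power_div_fact_le_exp: "0 \<le> y \<Longrightarrow> y ^ j / fact j \<le> exp y" for y :: real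
proof -
  assume y: "0 \<le> y"
  have "(\<Sum>i\<in>{j}. inverse (fact i) * y ^ i) \<le> (\<Sum>i. inverse (fact i) * y ^ i)"
    by (rule sum_le_suminf[OF summable_exp]) (use y in auto)
  then show ?thesis
    by (simp add: exp_def field_simps)
qed

text \<open>Half of the exponential decay pays for the power: y^(k - 1) / (k - 1)! <= exp y at y = q
  r / 2.\<close>

lemma H_exp_bound:
  assumes "0 < r"
  shows "H k q * exp (- (q * r)) \<le> (2 / r) ^ (k - 1) * (indicator {0..} q * exp (- (q * (r / 2))))"
proof (cases "0 \<le> q")
  case True
  have "H k q = (2 / r) ^ (k - 1) * ((q * r / 2) ^ (k - 1) / fact (k - 1))"
    using True assms by (simp add: H_def flip: power_mult_distrib)
  also have "\<dots> \<le> (2 / r) ^ (k - 1) * exp (q * r / 2)"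
    using True assms by (intro mult_left_mono power_div_fact_le_exp) auto
  finally have "H k q * exp (- (q * r)) \<le> (2 / r) ^ (k - 1) * exp (q * r / 2) * exp (- (q * r))"
    by (intro mult_right_mono) auto
  also have "\<dots> = (2 / r) ^ (k - 1) * exp (- (q * (r / 2)))"
    by (simp add: mult.assoc flip: exp_add)
  finally show ?thesis
    using True by simp
qed (simp add: H_def)

lemma integrable_exp_halfline:
  assumes "0 < r"
  shows "integrable lborel (\<lambda>q. indicator {0..} q * exp (- (q * r)) :: real)"
proof -
  have "integrable lborel (\<lambda>q. indicator {0<..} q * exp (- (q * r)) :: real)"
    using integrable_I0i_exp_mscale[OF assms] by (simp add: set_integrable_def)
  then show ?thesis
  proof (rule integrable_cong_AE_imp)
    have "AE q in lborel. q \<noteq> (0::real)"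
      by (rule AE_lborel_singleton)
    then show "AE q in lborel. indicator {0<..} q * exp (- (q * r)) = indicator {0..} q * exp (- (q * r))"
      by eventually_elim (auto simp: indicator_def)
  qed measurable
qed

lemma integrable_H_exp:
  assumes "0 < Re u"
  shows "integrable lborel (\<lambda>q. of_real (H k q) * exp (- (of_real q * u)))"
proof (rule Bochner_Integration.integrable_bound)
  show "integrable lborel (\<lambda>q. (2 / Re u) ^ (k - 1) * (indicator {0..} q * exp (- (q * (Re u / 2)))))"
    using assms by (intro integrable_mult_right integrable_exp_halfline) auto
  show "AE q in lborel. norm (of_real (H k q) * exp (- (of_real q * u))) \<le>
      norm ((2 / Re u) ^ (k - 1) * (indicator {0..} q * exp (- (q * (Re u / 2)))))"
  proof (intro AE_I2)
    fix q
    have "norm (of_real (H k q) * exp (- (of_real q * u))) = H k q * exp (- (q * Re u))"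
      by (simp add: norm_mult norm_exp_eq_Re H_nonneg)
    also have "\<dots> \<le> (2 / Re u) ^ (k - 1) * (indicator {0..} q * exp (- (q * (Re u / 2))))"
      by (rule H_exp_bound[OF assms])
    finally show "norm (of_real (H k q) * exp (- (of_real q * u))) \<le>
      norm ((2 / Re u) ^ (k - 1) * (indicator {0..} q * exp (- (q * (Re u / 2)))))"
      using assms by simp
  qed
qed measurable

text \<open>The Laplace transform of a power, by induction through integration by parts; the
  half-plane Re u > 0 is where the bead contour must pass the pole.\<close>

lemma integral_H_exp:
  assumes u: "0 < Re u"
  shows "(LBINT q. of_real (H (Suc j) q) * exp (- (of_real q * u))) = 1 / u ^ Suc j"
proof (induction j)
  have u0: "u \<noteq> 0"
    using u by auto
  have ofr: "(complex_of_real has_vector_derivative 1) (at q)" for q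
    using has_vector_derivative_of_real[OF DERIV_ident] by simp
  have ftc: "(LBINT q. indicator {0<..} q *\<^sub>R f q) = - F 0"
    if F: "\<And>q. (F has_vector_derivative f q) (at q)" and f: "\<And>q. isCont f q"
      and int: "integrable lborel (\<lambda>q. indicator {0<..} q *\<^sub>R f q)" and lim: "(F
          \<longlongrightarrow> 0) at_top" for F f :: "real \<Rightarrow> complex"
  proof -
    have "(F \<longlongrightarrow> F 0) (at_right 0)"
      using has_vector_derivative_continuous[OF F, of 0] by (simp add: isCont_def filterlim_at_split)
    then have "(LBINT q=0..\<infinity>. f q) = 0 - F 0"
      using F f int lim
      by (intro interval_integral_FTC_integrable[where F=F])
         (auto simp: zero_ereal_def ereal_tendsto_simps set_integrable_def)
    then show ?thesis
      by (simp add: interval_integral_to_infinity_eq[where a=0, unfolded zero_ereal_def[symmetric]]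
          set_lebesgue_integral_def)
  qed
  \<comment> \<open>On the open half-line \<open>H (Suc j)\<close> is the polynomial q^j / j!, so
    the jump of \<open>H 1\<close> at 0 does not meet the fundamental theorem.\<close>
  have Hi: "integrable lborel (\<lambda>q. indicator {0<..} q *\<^sub>R (of_real (H (Suc j) q) * exp (-
      (of_real q * u))))"
    and Heq: "(LBINT q. indicator {0<..} q *\<^sub>R (of_real (H (Suc j) q) * exp (- (of_real q * u)))) =
      (LBINT q. of_real (H (Suc j) q) * exp (- (of_real q * u)))" for j
  proof -
    have "AE q in lborel. q \<noteq> (0::real)"
      by (rule AE_lborel_singleton)
    then have ae: "AE q in lborel. indicator {0<..} q *\<^sub>R (of_real (H (Suc j) q) * exp (- (of_real q *
        u))) = of_real (H (Suc j) q) * exp (- (of_real q * u))"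
      by eventually_elim (auto simp: indicator_def H_def)
    show "integrable lborel (\<lambda>q. indicator {0<..} q *\<^sub>R (of_real (H (Suc j) q) * exp (- (of_real
        q * u))))"
      by (rule integrable_cong_AE_imp[OF integrable_H_exp[OF u, of "Suc j"]]) (use ae in \<open>auto elim:
          eventually_mono\<close>)
    show "(LBINT q. indicator {0<..} q *\<^sub>R (of_real (H (Suc j) q) * exp (- (of_real q * u)))) =
      (LBINT q. of_real (H (Suc j) q) * exp (- (of_real q * u)))"
      by (rule integral_cong_AE[OF _ _ ae]) measurable
  qed
  have lim: "((\<lambda>q. of_real (q ^ j / fact j) * exp (- (of_real q * u))) \<longlongrightarrow>
      (0::complex)) at_top" for j
  proof (rule Lim_null_comparison)
    have "((\<lambda>q. q ^ j / fact j * exp (- (q * Re u))) \<longlongrightarrow> 0) at_top"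
      using u by real_asymp
    then show "((\<lambda>q. \<bar>q ^ j / fact j * exp (- (q * Re u))\<bar>) \<longlongrightarrow> 0) at_top"
      by (rule tendsto_rabs_zero)
  qed (simp add: norm_mult norm_exp_eq_Re norm_divide norm_power abs_mult power_abs)
  {
    case 0
    have "(LBINT q. indicator {0<..} q *\<^sub>R (- u * exp (- (of_real q * u)))) = - exp (- (of_real 0 * u))"
    proof (rule ftc)
      show "((\<lambda>q. exp (- (of_real q * u))) has_vector_derivative - u * exp (- (of_real q * u))) (at q)" for q
      proof -
        have "((\<lambda>z. exp (- (z * u))) has_field_derivative - u * exp (- (of_real q * u))) (at (of_real q))"
          by (auto intro!: derivative_eq_intros)
        then show ?thesis
          using field_vector_diff_chain_at[OF ofr, of "\<lambda>z. exp (- (z * u))"] by (simp add: o_def)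
      qed
      have "integrable lborel (\<lambda>q. - u * (indicator {0<..} q *\<^sub>R (of_real (H (Suc 0) q) * exp (-
          (of_real q * u)))))"
        by (intro integrable_mult_right Hi)
      moreover have "(\<lambda>q. - u * (indicator {0<..} q *\<^sub>R (of_real (H (Suc 0) q) * exp (- (of_real
          q * u))))) =
          (\<lambda>q. indicator {0<..} q *\<^sub>R (- u * exp (- (of_real q * u))))"
        by (auto simp: indicator_def H_def)
      ultimately show "integrable lborel (\<lambda>q. indicator {0<..} q *\<^sub>R (- u * exp (- (of_real q * u))))"
        by (simp only:)
      show "((\<lambda>q. exp (- (of_real q * u))) \<longlongrightarrow> 0) at_top"
        using lim[of 0] by simp
    qed (auto intro!: continuous_intros)
    moreover have ind: "indicator {0<..} q *\<^sub>R (- u * exp (- (of_real q * u))) = - u * (indicator {0<..}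
        q *\<^sub>R (of_real (H (Suc 0) q) * exp (- (of_real q * u))))" for q :: real
      by (auto simp: indicator_def H_def)
    ultimately have "- u * (LBINT q. of_real (H (Suc 0) q) * exp (- (of_real q * u))) = - exp (- (of_real 0 * u))"
      unfolding ind integral_mult_right_zero Heq by simp
    then show ?case
      using u0 by (simp add: field_simps)
  next
    case (Suc j)
    let ?F = "\<lambda>q. of_real (q ^ Suc j / fact (Suc j)) * exp (- (of_real q * u))"
    let ?f = "\<lambda>q. of_real (q ^ j / fact j) * exp (- (of_real q * u)) - u * (of_real (q ^ Suc j / fact
        (Suc j)) * exp (- (of_real q * u)))"
    have ind: "indicator {0<..} q *\<^sub>R ?f q = indicator {0<..} q *\<^sub>R (of_real (H (Suc j) q) * exp (-
        (of_real q * u)))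
        - u * (indicator {0<..} q *\<^sub>R (of_real (H (Suc (Suc j)) q) * exp (- (of_real q * u))))" for q :: real
      by (auto simp: indicator_def H_def)
    have "(LBINT q. indicator {0<..} q *\<^sub>R ?f q) = - ?F 0"
    proof (rule ftc)
      show "(?F has_vector_derivative ?f q) (at q)" for q
      proof -
        have p1: "((\<lambda>z. z ^ Suc j / fact (Suc j)) has_field_derivative z ^ j / fact j) (at z)" for z ::
            complex
        proof -
          have "((\<lambda>z. z ^ Suc j / fact (Suc j)) has_field_derivative of_nat (Suc j) * z ^ j / fact (Suc
              j)) (at z)"
            by (intro DERIV_cdivide) (auto intro!: derivative_eq_intros simp del: power_Suc)
          moreover have "of_nat (Suc j) * z ^ j / fact (Suc j) = z ^ j / fact j"
            unfolding fact_Suc by (rule nonzero_mult_divide_mult_cancel_left) (rule of_nat_neq_0)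
          ultimately show ?thesis
            by (simp only:)
        qed
        have p2: "((\<lambda>z. exp (- (z * u))) has_field_derivative - u * exp (- (z * u))) (at z)" for z
          by (auto intro!: derivative_eq_intros)
        have "((\<lambda>z. z ^ Suc j / fact (Suc j) * exp (- (z * u))) has_field_derivative
            (z ^ j / fact j * exp (- (z * u)) - u * (z ^ Suc j / fact (Suc j) * exp (- (z * u))))) (at z)" for z
          by (rule DERIV_cong[OF DERIV_mult[OF p1 p2]]) (simp add: algebra_simps del: power_Suc fact_Suc)
        from this[of "of_real q"] show ?thesis
          using field_vector_diff_chain_at[OF ofr, of "\<lambda>z. z ^ Suc j / fact (Suc j) * exp (- (z * u))"]
          by (simp add: o_def del: power_Suc fact_Suc)
      qed
      show "integrable lborel (\<lambda>q. indicator {0<..} q *\<^sub>R ?f q)"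
        unfolding ind by (intro Bochner_Integration.integrable_diff integrable_mult_right Hi)
      show "(?F \<longlongrightarrow> 0) at_top"
        by (rule lim)
    qed (auto intro!: continuous_intros simp del: power_Suc fact_Suc)
    then have "(LBINT q. of_real (H (Suc j) q) * exp (- (of_real q * u))) - u * (LBINT q. of_real (H (Suc (Suc
        j)) q) * exp (- (of_real q * u))) = 0"
      unfolding ind Bochner_Integration.integral_diff[OF Hi integrable_mult_right[OF Hi]] integral_mult_right_zero Heq
      by simp
    then show ?case
      using Suc u0 by (simp add: field_simps)
  }
qed

text \<open>Fourier inversion of the Gaussian, for every abscissa c. The exponent (y - z)^2 / (2 s)
  forces the parameter 2 s.\<close>

lemma bm_density_eq_gexp:
  assumes "0 < s"
  shows "complex_of_real (bm_density (2 * s) y z) = 1 / (2 * of_real pi) * (LBINT v. gexp (y - z) s (Complex c v))"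
proof -
  have "sqrt (2 * pi / s) = 2 * pi / sqrt (pi * (2 * s))"
  proof -
    have "2 * pi / s = (2 * pi)\<^sup>2 / (pi * (2 * s))"
      using assms by (simp add: power2_eq_square)
    then show ?thesis
      by (simp only: real_sqrt_divide real_sqrt_abs) simp
  qed
  moreover have "(z - y)\<^sup>2 = (y - z)\<^sup>2"
    by (simp add: power2_commute)
  ultimately have "bm_density (2 * s) y z = 1 / (2 * pi) * (sqrt (2 * pi / s) * exp (- ((y - z)\<^sup>2 / (2 * s))))"
    by (simp add: bm_density_def)
  then show ?thesis
    unfolding integral_gexp[OF assms] by (simp only: of_real_mult of_real_divide of_real_1 of_real_numeral)
qed

text \<open>Inserting the Fourier form of the density and integrating over q first gives the Laplace
  transform of H, that is 1 / u^(j + 1); this needs a line to the right of 0.\<close>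

lemma H_conv_eq_integral:
  assumes s: "0 < s" and c: "0 < c"
  shows "complex_of_real (H_conv (Suc j) (2 * s) x z) =
    1 / (2 * of_real pi) * (LBINT v. gexp (x - z) s (Complex c v) / Complex c v ^ Suc j)"
proof -
  let ?f = "\<lambda>q v. of_real (H (Suc j) q) * gexp (x - q - z) s (Complex c v)"
  have f: "?f q v = gexp (x - z) s (Complex c v) * (of_real (H (Suc j) q) * exp (- (of_real q * Complex c v)))"
      for q v
  proof -
    have "of_real (x - q - z) * Complex c v + of_real s / 2 * (Complex c v)\<^sup>2 =
        (of_real (x - z) * Complex c v + of_real s / 2 * (Complex c v)\<^sup>2) + - (of_real q * Complex c v)"
      by (simp add: algebra_simps)
    then show ?thesis
      unfolding gexp_def by (simp only: exp_add mult_ac)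
  qed
  \<comment> \<open>The modulus factorises into a function of q and one of v, which gives absolute
    integrability on the product space.\<close>
  have nf: "norm (?f q v) = H (Suc j) q * exp (- (q * c)) * exp ((x - z) * c + s / 2 * (c\<^sup>2 -
      v\<^sup>2))" for q v
    by (simp add: norm_mult norm_gexp H_nonneg algebra_simps flip: exp_add)
  have Hi: "integrable lborel (\<lambda>q. H (Suc j) q * exp (- (q * c)))"
    using integrable_norm[OF integrable_H_exp[of "of_real c" "Suc j"]] c
    by (simp add: norm_mult norm_exp_eq_Re H_nonneg)
  have Gi: "integrable lborel (\<lambda>v. exp ((x - z) * c + s / 2 * (c\<^sup>2 - v\<^sup>2)))"
    using integrable_norm[OF integrable_power_gexp[OF s, of c 0 "x - z"]] by (simp add: norm_gexp)
  have int: "integrable (lborel \<Otimes>\<^sub>M lborel) (case_prod ?f)"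
  proof (rule lborel_pair.Fubini_integrable)
    show "case_prod ?f \<in> borel_measurable (lborel \<Otimes>\<^sub>M lborel)"
      unfolding gexp_def by measurable
    show "integrable lborel (\<lambda>q. LBINT v. norm (case_prod ?f (q, v)))"
      unfolding prod.case nf using Hi by simp
    show "AE q in lborel. integrable lborel (\<lambda>v. case_prod ?f (q, v))"
    proof (intro AE_I2)
      fix q
      show "integrable lborel (\<lambda>v. case_prod ?f (q, v))"
        using integrable_mult_right[OF integrable_power_gexp[OF s, of c 0 "x - q - z"], of "of_real (H (Suc j) q)"]
        by simp
    qed
  qed
  have "H_conv (Suc j) (2 * s) x z = (LBINT y. H (Suc j) (x - y) * bm_density (2 * s) y z)"
    using s by (simp add: H_conv_def)
  also have "\<dots> = (LBINT q. H (Suc j) q * bm_density (2 * s) (x - q) z)"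
    by (subst lborel_integral_real_affine[where c="-1" and t=x]) auto
  finally have "complex_of_real (H_conv (Suc j) (2 * s) x z) = (LBINT q. of_real (H (Suc j) q * bm_density (2 *
      s) (x - q) z))"
    by (simp only: integral_complex_of_real)
  also have "\<dots> = (LBINT q. 1 / (2 * of_real pi) * (LBINT v. ?f q v))"
    by (rule Bochner_Integration.integral_cong) (simp_all add: bm_density_eq_gexp[OF s, of _ _ c])
  also have "\<dots> = 1 / (2 * of_real pi) * (LBINT q. (LBINT v. ?f q v))"
    by simp
  also have "(LBINT q. (LBINT v. ?f q v)) = (LBINT v. (LBINT q. ?f q v))"
    by (rule lborel_pair.Fubini_integral[OF int, symmetric])
  also have "\<dots> = (LBINT v. gexp (x - z) s (Complex c v) / Complex c v ^ Suc j)"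
    unfolding f using c by (intro Bochner_Integration.integral_cong refl) (simp add: integral_H_exp del: power_Suc)
  finally show ?thesis .
qed

section \<open>Contour integrals of the bead kernel\<close>

lemma line_integral_FTC:
  fixes P f :: "complex \<Rightarrow> complex"
  assumes "v1 \<le> v2" and P: "\<And>v. v1 \<le> v \<Longrightarrow> v \<le> v2 \<Longrightarrow> (P
      has_field_derivative f (Complex c v)) (at (Complex c v))"
    and f: "continuous_on {v1..v2} (\<lambda>v. f (Complex c v))"
  shows "\<i> * (LBINT v. indicator {v1..v2} v *\<^sub>R f (Complex c v)) = P (Complex c v2) - P (Complex c v1)"
proof -
  have "((\<lambda>v. P (Complex c v)) has_vector_derivative \<i> * f (Complex c v)) (at v within {v1..v2})" if
      "v1 \<le> v" "v \<le> v2" for v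
  proof -
    have "(Complex c has_vector_derivative \<i>) (at v)"
      unfolding Complex_eq by (auto intro!: derivative_eq_intros)
    from field_vector_diff_chain_at[OF this P[OF that]]
    have "((\<lambda>v. P (Complex c v)) has_vector_derivative \<i> * f (Complex c v)) (at v)"
      unfolding o_def .
    then show ?thesis
      by (rule has_vector_derivative_at_within)
  qed
  then have "(LBINT v. indicator {v1..v2} v *\<^sub>R (\<i> * f (Complex c v))) = P (Complex c v2) - P (Complex c v1)"
    by (intro integral_FTC_atLeastAtMost assms(1) continuous_on_mult continuous_on_const f)
  moreover have "(\<lambda>v. indicator {v1..v2} v *\<^sub>R (\<i> * f (Complex c v))) = (\<lambda>v. \<i> *
      (indicator {v1..v2} v *\<^sub>R f (Complex c v)))"
    by auto
  ultimately show ?thesis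
    by (simp only: integral_mult_right_zero)
qed

lemma norm_Complex_less_1:
  assumes "\<bar>a\<bar> < 1"
  shows "norm (Complex a v) < 1 \<longleftrightarrow> \<bar>v\<bar> < sqrt (1 - a\<^sup>2)" "1 < norm (Complex
      a v) \<longleftrightarrow> sqrt (1 - a\<^sup>2) < \<bar>v\<bar>"
proof -
  have "norm (Complex a v) < 1 \<longleftrightarrow> v\<^sup>2 < 1 - a\<^sup>2"
    by (auto simp: cmod_def algebra_simps)
  also have "\<dots> \<longleftrightarrow> \<bar>v\<bar> < sqrt (1 - a\<^sup>2)"
    by (metis real_sqrt_abs real_sqrt_less_iff)
  finally show "norm (Complex a v) < 1 \<longleftrightarrow> \<bar>v\<bar> < sqrt (1 - a\<^sup>2)" .
  have "1 < norm (Complex a v) \<longleftrightarrow> 1 - a\<^sup>2 < v\<^sup>2"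
    by (auto simp: cmod_def algebra_simps)
  also have "\<dots> \<longleftrightarrow> sqrt (1 - a\<^sup>2) < \<bar>v\<bar>"
    by (metis real_sqrt_abs real_sqrt_less_iff)
  finally show "1 < norm (Complex a v) \<longleftrightarrow> sqrt (1 - a\<^sup>2) < \<bar>v\<bar>" .
qed

text \<open>Both sides are increments of one global primitive, so no reparametrisation of the
  segment is needed.\<close>

lemma contour_integral_segment:
  assumes a: "\<bar>a\<bar> < 1" and f: "f holomorphic_on UNIV"
  shows "contour_integral (linepath (u_minus a) (u_plus a)) f = \<i> * (LBINT v. (if norm (Complex a v) < 1
      then f (Complex a v) else 0))"
proof -
  define v0 where "v0 = sqrt (1 - a\<^sup>2)"
  have v0: "0 \<le> v0"
    using a by (simp add: v0_def abs_square_le_1)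
  obtain P where P: "\<And>u. (P has_field_derivative f u) (at u)"
    using holomorphic_convex_primitive'[OF convex_UNIV open_UNIV f] by auto
  have cf: "continuous_on S (\<lambda>v. f (Complex a v))" for S
    using holomorphic_on_imp_continuous_on[OF f] by (rule continuous_on_compose2) (auto intro!: continuous_intros)
  have "(f has_contour_integral (P (u_plus a) - P (u_minus a))) (linepath (u_minus a) (u_plus a))"
    using contour_integral_primitive[of UNIV P f "linepath (u_minus a) (u_plus a)"] P by auto
  then have "contour_integral (linepath (u_minus a) (u_plus a)) f = P (u_plus a) - P (u_minus a)"
    by (rule contour_integral_unique)
  also have "\<dots> = \<i> * (LBINT v. indicator {-v0..v0} v *\<^sub>R f (Complex a v))"
    unfolding u_plus_def u_minus_def v0_def[symmetric] using v0 P by (intro line_integral_FTC[symmetric] cf) auto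
  also have "(LBINT v. indicator {-v0..v0} v *\<^sub>R f (Complex a v)) = (LBINT v. (if norm (Complex a v) < 1
      then f (Complex a v) else 0))"
  proof (rule integral_cong_AE)
    have [measurable]: "(\<lambda>v. f (Complex a v)) \<in> borel_measurable borel"
      by (rule borel_measurable_continuous_onI[OF cf])
    show "(\<lambda>v. indicator {-v0..v0} v *\<^sub>R f (Complex a v)) \<in> borel_measurable lborel"
      "(\<lambda>v. if norm (Complex a v) < 1 then f (Complex a v) else 0) \<in> borel_measurable lborel"
      by measurable
    have "AE v in lborel. v \<noteq> v0" "AE v in lborel. v \<noteq> - v0"
      by (rule AE_lborel_singleton)+
    then show "AE v in lborel. indicator {-v0..v0} v *\<^sub>R f (Complex a v) = (if norm (Complex a v) < 1
        then f (Complex a v) else 0)"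
      unfolding norm_Complex_less_1[OF a] v0_def[symmetric]
      by eventually_elim (auto simp: indicator_def abs_if split: if_splits)
  qed
  finally show ?thesis .
qed

lemma tendsto_integral_truncated:
  fixes h :: "real \<Rightarrow> complex"
  assumes h: "integrable lborel h"
  shows "(\<lambda>n. LBINT v. indicator {- real n..real n} v *\<^sub>R h v) \<longlonglongrightarrow> (LBINT v. h v)"
proof (rule integral_dominated_convergence[where w="\<lambda>v. norm (h v)"])
  have [measurable]: "h \<in> borel_measurable lborel"
    using h by (rule borel_measurable_integrable)
  show "h \<in> borel_measurable lborel" "\<And>n. (\<lambda>v. indicator {- real n..real n} v *\<^sub>R h v)
      \<in> borel_measurable lborel"
    by measurable
  show "AE v in lborel. (\<lambda>n. indicator {- real n..real n} v *\<^sub>R h v) \<longlonglongrightarrow> h v"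
  proof (intro AE_I2 tendsto_eventually)
    fix v
    obtain n where "\<bar>v\<bar> \<le> real n"
      using real_arch_simple by blast
    then show "\<forall>\<^sub>F n in sequentially. indicator {- real n..real n} v *\<^sub>R h v = h v"
      unfolding eventually_sequentially by (intro exI[of _ n]) (auto simp: indicator_def abs_le_iff)
  qed
qed (use h in \<open>auto simp: indicator_def\<close>)

lemma u_plus_minus_eq_exp:
  assumes "\<bar>a\<bar> < 1"
  shows "u_plus a = exp (\<i> * of_real (arccos a))" "u_minus a = exp (\<i> * of_real (- arccos a))"
proof -
  have "u_plus a = cis (arccos a)" "u_minus a = cis (- arccos a)"
    using assms by (auto simp: u_plus_def u_minus_def complex_eq_iff sin_arccos_abs cos_arccos_abs)
  then show "u_plus a = exp (\<i> * of_real (arccos a))" "u_minus a = exp (\<i> * of_real (- arccos a))"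
    by (simp_all add: cis_conv_exp)
qed

text \<open>On the plane slit along the nonpositive reals the integrand has a primitive, so only the end points of
  the paths matter.\<close>

lemma contour_shift:
  fixes a c s \<beta> :: real and n n' k :: nat
  assumes a: "\<bar>a\<bar> < 1" and c: "0 < c" and s: "0 < s" and nn: "n' < n"
  defines "f \<equiv> \<lambda>u. gexp \<beta> s u / u ^ k"
  shows "\<i> * (LBINT v. f (Complex c v)) =
     \<i> * (LBINT v. (if 1 < norm (Complex a v) then f (Complex a v) else 0)) + contour_integral (bead_contour
         a n n') f"
proof -
  define v0 where "v0 = sqrt (1 - a\<^sup>2)"
  \<comment> \<open>For a <= 0 the outer half-lines avoid the slit only because they satisfy |Im u|
    >= v0 > 0, a consequence of |a| < 1.\<close>
  have v0: "0 < v0"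
    using a by (simp add: v0_def abs_square_less_1)
  define S where "S = - complex_of_real ` {..0}"
  have oS: "open S"
    unfolding S_def by (intro open_Compl closed_slot_left)
  have S0: "u \<noteq> 0" if "u \<in> S" for u
    using that by (auto simp: S_def)
  have SI: "u \<in> S" if "0 < Re u \<or> Im u \<noteq> 0" for u
    using that by (auto simp: S_def)
  have fh: "f holomorphic_on S"
    unfolding f_def using S0 by (intro holomorphic_intros) auto
  obtain P where P: "\<And>u. u \<in> S \<Longrightarrow> (P has_field_derivative f u) (at u)"
  proof -
    have "\<exists>g. \<forall>x\<in>S. (g has_field_derivative f x) (at x)"
    proof (rule holomorphic_starlike_primitive[where k="{}"])
      show "starlike S"
        unfolding S_def by (rule starlike_slotted_complex_plane_left)
    qed (use oS fh in \<open>auto intro: holomorphic_on_imp_continuous_on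
        holomorphic_on_imp_differentiable_at\<close>)
    then show thesis using that by blast
  qed
  have cf: "continuous_on T (\<lambda>v. f (Complex d v))" if "\<And>v. v \<in> T \<Longrightarrow> Complex d v
      \<in> S" for T d
    using that by (intro continuous_on_compose2[OF holomorphic_on_imp_continuous_on[OF fh]] continuous_intros) auto
  have contour: "contour_integral (bead_contour a n n') f = P (u_plus a) - P (u_minus a)"
  proof (cases "0 < a")
    case True
    have "path_image (linepath (u_minus a) (u_plus a)) \<subseteq> S"
    proof
      fix u assume "u \<in> path_image (linepath (u_minus a) (u_plus a))"
      then obtain r where "u = (1 - r) *\<^sub>R u_minus a + r *\<^sub>R u_plus a"
        by (auto simp: closed_segment_def)
      then have "Re u = (1 - r) * a + r * a"
        by (simp add: u_plus_def u_minus_def)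
      then have "Re u = a"
        by (simp add: algebra_simps)
      then show "u \<in> S"
        using True by (intro SI) auto
    qed
    then have "(f has_contour_integral (P (u_plus a) - P (u_minus a))) (linepath (u_minus a) (u_plus a))"
      using contour_integral_primitive[of S P f "linepath (u_minus a) (u_plus a)"] P
      by (auto intro: has_field_derivative_at_within)
    then show ?thesis
      using True by (simp add: bead_contour_def contour_integral_unique)
  next
    case False
    let ?g = "part_circlepath 0 1 (- arccos a) (arccos a)"
    have ar: "0 < arccos a" "arccos a < pi"
      using a arccos_lt_bounded[of a] by auto
    have "path_image ?g \<subseteq> S"
    proof
      fix u assume "u \<in> path_image ?g"
      then obtain \<theta> where th: "- arccos a \<le> \<theta>" "\<theta> \<le> arccos a" "u = cis \<theta>"
        using ar by (auto simp: path_image_part_circlepath cis_conv_exp)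
      show "u \<in> S"
      proof (cases "\<theta> = 0")
        case True
        then show ?thesis using th by (intro SI) auto
      next
        case False
        then have "0 < sin \<bar>\<theta>\<bar>"
          using th ar by (intro sin_gt_zero) auto
        then show ?thesis using th by (intro SI) (auto simp: abs_if split: if_splits)
      qed
    qed
    then have "(f has_contour_integral (P (pathfinish ?g) - P (pathstart ?g))) ?g"
      using P by (intro contour_integral_primitive[of S]) (auto intro: has_field_derivative_at_within)
    moreover have "pathfinish ?g = u_plus a" "pathstart ?g = u_minus a"
      using u_plus_minus_eq_exp[OF a] by simp_all
    ultimately show ?thesis
      using False nn by (simp add: bead_contour_def contour_integral_unique)
  qed
  let ?h = "\<lambda>v. if 1 < norm (Complex a v) then f (Complex a v) else 0"
  have hi: "integrable lborel ?h"
    unfolding f_def using s by (rule integrable_outside)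
  have ci: "integrable lborel (\<lambda>v. f (Complex c v))"
  proof (rule Bochner_Integration.integrable_bound)
    show "integrable lborel (\<lambda>v. (1 / c ^ k) *\<^sub>R gexp \<beta> s (Complex c v))"
      using integrable_power_gexp[OF s, of c 0 \<beta>] by (intro integrable_scaleR_right) simp
    show "AE v in lborel. norm (f (Complex c v)) \<le> norm ((1 / c ^ k) *\<^sub>R gexp \<beta> s (Complex c v))"
    proof (intro AE_I2)
      fix v
      have "c ^ k \<le> norm (Complex c v) ^ k"
        using c complex_Re_le_cmod[of "Complex c v"] by (intro power_mono) auto
      moreover have "0 < c ^ k"
        using c by simp
      ultimately have "norm (gexp \<beta> s (Complex c v)) / norm (Complex c v) ^ k \<le> norm (gexp \<beta> s
          (Complex c v)) / c ^ k"
        by (intro divide_left_mono mult_pos_pos) (auto intro: less_le_trans)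
      then show "norm (f (Complex c v)) \<le> norm ((1 / c ^ k) *\<^sub>R gexp \<beta> s (Complex c v))"
        using c by (simp add: f_def norm_divide norm_power)
    qed
    show "(\<lambda>v. f (Complex c v)) \<in> borel_measurable lborel"
      unfolding f_def by measurable
  qed
  \<comment> \<open>The contribution of the two horizontal segments that join the lines at the
    heights V and - V.\<close>
  define d where "d = (\<lambda>V. (P (Complex c V) - P (Complex a V)) - (P (Complex c (- V)) - P (Complex a (- V))))"
  have eq: "\<i> * (LBINT v. indicator {-V..V} v *\<^sub>R f (Complex c v)) - \<i> * (LBINT v. indicator
      {-V..V} v *\<^sub>R ?h v)
      - contour_integral (bead_contour a n n') f = d V" if V: "v0 < V" for V
  proof -
    have 1: "\<i> * (LBINT v. indicator {-V..V} v *\<^sub>R f (Complex c v)) = P (Complex c V) - P (Complex c (- V))"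
      using V v0 c by (intro line_integral_FTC P cf SI) auto
    have 2: "\<i> * (LBINT v. indicator {v0..V} v *\<^sub>R f (Complex a v)) = P (Complex a V) - P (Complex a v0)"
      using V v0 by (intro line_integral_FTC P cf SI) auto
    have 3: "\<i> * (LBINT v. indicator {-V..-v0} v *\<^sub>R f (Complex a v)) = P (Complex a (-v0)) - P
        (Complex a (-V))"
      using V v0 by (intro line_integral_FTC P cf SI) auto
    have i: "integrable lborel (\<lambda>v. indicator {v0..V} v *\<^sub>R f (Complex a v))" "integrable lborel
        (\<lambda>v. indicator {-V..-v0} v *\<^sub>R f (Complex a v))"
      using v0 unfolding set_integrable_def[symmetric] by (intro borel_integrable_atLeastAtMost' cf SI; simp)+
    have "(LBINT v. indicator {-V..V} v *\<^sub>R ?h v) =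
       (LBINT v. indicator {v0..V} v *\<^sub>R f (Complex a v) + indicator {-V..-v0} v *\<^sub>R f (Complex a v))"
    proof (rule integral_cong_AE)
      have "AE v in lborel. v \<noteq> v0" "AE v in lborel. v \<noteq> - v0"
        by (rule AE_lborel_singleton)+
      then show "AE v in lborel. indicator {-V..V} v *\<^sub>R ?h v = indicator {v0..V} v *\<^sub>R f (Complex
          a v) + indicator {-V..-v0} v *\<^sub>R f (Complex a v)"
        unfolding norm_Complex_less_1[OF a] v0_def[symmetric]
        by eventually_elim (use V v0 in \<open>auto simp: indicator_def abs_if split: if_splits\<close>)
      have [measurable]: "(\<lambda>v. f (Complex a v)) \<in> borel_measurable lborel"
        unfolding f_def by measurable
      show "(\<lambda>v. indicator {-V..V} v *\<^sub>R ?h v) \<in> borel_measurable lborel"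
        "(\<lambda>v. indicator {v0..V} v *\<^sub>R f (Complex a v) + indicator {-V..-v0} v *\<^sub>R f
            (Complex a v)) \<in> borel_measurable lborel"
        by measurable
    qed
    also have "\<dots> = (LBINT v. indicator {v0..V} v *\<^sub>R f (Complex a v)) + (LBINT v. indicator
        {-V..-v0} v *\<^sub>R f (Complex a v))"
      by (rule Bochner_Integration.integral_add[OF i])
    finally have 4: "\<i> * (LBINT v. indicator {-V..V} v *\<^sub>R ?h v) = P (Complex a V) - P (Complex a v0)
        + (P (Complex a (-v0)) - P (Complex a (-V)))"
      by (simp only: distrib_left 2 3)
    show ?thesis
      unfolding 1 4 contour d_def by (simp add: u_plus_def u_minus_def v0_def)
  qed
  have "(\<lambda>n. d (real n)) \<longlonglongrightarrow> 0"
  proof -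
    define m where "m = max \<bar>a\<bar> c"
    \<comment> \<open>On these segments |u| >= 1 disposes of the pole, and the modulus decays like
      exp (- s V^2 / 2).\<close>
    have bound: "norm (P (Complex c V) - P (Complex a V)) \<le> exp (\<bar>\<beta>\<bar> * m + s / 2 *
        (m\<^sup>2 - V\<^sup>2)) * \<bar>c - a\<bar>" if V: "1 \<le> \<bar>V\<bar>" for V
    proof -
      let ?L = "closed_segment (Complex a V) (Complex c V)"
      have L: "Im u = V \<and> \<bar>Re u\<bar> \<le> m" if u: "u \<in> ?L" for u
      proof -
        obtain r where r: "0 \<le> r" "r \<le> 1" "u = (1 - r) *\<^sub>R Complex a V + r *\<^sub>R Complex c V"
          using u by (auto simp: closed_segment_def)
        have "\<bar>(1 - r) * a + r * c\<bar> \<le> (1 - r) * \<bar>a\<bar> + r * \<bar>c\<bar>"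
          using r by (intro order.trans[OF abs_triangle_ineq]) (simp add: abs_mult)
        also have "\<dots> \<le> (1 - r) * m + r * m"
          using r c by (intro add_mono mult_left_mono) (auto simp: m_def)
        also have "\<dots> = m"
          by (simp add: algebra_simps)
        finally have "\<bar>(1 - r) * a + r * c\<bar> \<le> m" .
        moreover have "Re u = (1 - r) * a + r * c" "Im u = (1 - r) * V + r * V"
          unfolding r(3) by simp_all
        moreover have "(1 - r) * V + r * V = V"
          by (simp add: algebra_simps)
        ultimately show ?thesis
          by (simp only:)
      qed
      have "norm (P (Complex c V) - P (Complex a V)) \<le> exp (\<bar>\<beta>\<bar> * m + s / 2 * (m\<^sup>2 -
          V\<^sup>2)) * norm (Complex c V - Complex a V)"
      proof (rule field_differentiable_bound[where S="?L" and f'=f])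
        fix u assume u: "u \<in> ?L"
        have Lu: "Im u = V" "\<bar>Re u\<bar> \<le> m"
          using L[OF u] by blast+
        have "Im u \<noteq> 0"
          using Lu(1) V by linarith
        then have "u \<in> S"
          by (intro SI disjI2)
        then show "(P has_field_derivative f u) (at u within ?L)"
          by (rule has_field_derivative_at_within[OF P])
        have "1 \<le> norm u"
          using abs_Im_le_cmod[of u] V unfolding Lu(1) by linarith
        then have "1 \<le> norm u ^ k"
          by (rule one_le_power)
        then have "norm (gexp \<beta> s u) / norm u ^ k \<le> norm (gexp \<beta> s u) / 1"
          by (intro divide_left_mono) auto
        then have "norm (f u) \<le> norm (gexp \<beta> s u)"
          by (simp add: f_def norm_divide norm_power)
        also have "norm (gexp \<beta> s u) = exp (\<beta> * Re u + s / 2 * ((Re u)\<^sup>2 - V\<^sup>2))"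
        proof -
          have "Complex (Re u) V = u"
            unfolding Lu(1)[symmetric] by simp
          then show ?thesis
            using norm_gexp[of \<beta> s "Re u" V] by (simp only:)
        qed
        also have "\<dots> \<le> exp (\<bar>\<beta>\<bar> * m + s / 2 * (m\<^sup>2 - V\<^sup>2))"
        proof -
          have "\<beta> * Re u \<le> \<bar>\<beta>\<bar> * m"
            by (rule order.trans[OF abs_ge_self]) (use Lu(2) in \<open>auto simp: abs_mult intro!:
                mult_left_mono\<close>)
          moreover have "(Re u)\<^sup>2 \<le> m\<^sup>2"
            using Lu(2) by (intro abs_le_square_iff[THEN iffD1]) linarith
          then have "s / 2 * ((Re u)\<^sup>2 - V\<^sup>2) \<le> s / 2 * (m\<^sup>2 - V\<^sup>2)"
            using s by (intro mult_left_mono) auto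
          ultimately show ?thesis by simp
        qed
        finally show "norm (f u) \<le> exp (\<bar>\<beta>\<bar> * m + s / 2 * (m\<^sup>2 - V\<^sup>2))" .
      qed auto
      also have "norm (Complex c V - Complex a V) = \<bar>c - a\<bar>"
        by (simp add: cmod_def)
      finally show ?thesis .
    qed
    have lim: "(\<lambda>n. 2 * (exp (\<bar>\<beta>\<bar> * m + s / 2 * (m\<^sup>2 - (real n)\<^sup>2)) *
        \<bar>c - a\<bar>)) \<longlonglongrightarrow> 0"
      using s by real_asymp
    show ?thesis
    proof (rule Lim_null_comparison[OF _ lim])
      show "\<forall>\<^sub>F n in sequentially. norm (d (real n)) \<le> 2 * (exp (\<bar>\<beta>\<bar> * m + s
          / 2 * (m\<^sup>2 - (real n)\<^sup>2)) * \<bar>c - a\<bar>)"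
        using eventually_ge_at_top[of 1]
      proof eventually_elim
        case (elim n)
        then show ?case
          unfolding d_def using bound[of "real n"] bound[of "- real n"]
          by (intro order.trans[OF norm_triangle_ineq4]) auto
      qed
    qed
  qed
  moreover have "(\<lambda>n. d (real n)) \<longlonglongrightarrow> \<i> * (LBINT v. f (Complex c v)) - \<i> *
      (LBINT v. ?h v) - contour_integral (bead_contour a n n') f"
  proof (rule Lim_transform_eventually)
    show "(\<lambda>i. \<i> * (LBINT v. indicator {-real i..real i} v *\<^sub>R f (Complex c v)) - \<i> *
        (LBINT v. indicator {-real i..real i} v *\<^sub>R ?h v)
      - contour_integral (bead_contour a n n') f) \<longlonglongrightarrow> \<i> * (LBINT v. f (Complex c v)) -
          \<i> * (LBINT v. ?h v) - contour_integral (bead_contour a n n') f"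
      by (intro tendsto_intros tendsto_integral_truncated ci hi)
    obtain n0 where "v0 < real n0"
      using reals_Archimedean2 by blast
    then show "\<forall>\<^sub>F i in sequentially. \<i> * (LBINT v. indicator {-real i..real i} v *\<^sub>R f
        (Complex c v)) - \<i> * (LBINT v. indicator {-real i..real i} v *\<^sub>R ?h v)
      - contour_integral (bead_contour a n n') f = d (real i)"
      unfolding eventually_sequentially
    proof (intro exI[of _ n0] allI impI eq)
      fix i assume "n0 \<le> i"
      then have "real n0 \<le> real i"
        by simp
      then show "v0 < real i"
        using \<open>v0 < real n0\<close> by linarith
    qed
  qed
  ultimately show ?thesis
    using LIMSEQ_unique by (fastforce simp: algebra_simps)
qed

section \<open>Convergence away from equal times\<close>

definition scaled_DBM :: "real \<Rightarrow> nat \<Rightarrow> point \<Rightarrow> point \<Rightarrow> complex" where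
  "scaled_DBM a N = (\<lambda>(n, x, t) (n', x', t'). complex_of_real
     (exp (- real N * (t' / (2 * real N) - t / (2 * real N))) *
      real N powr ((real n - real n') / 2) * (2 * real N) powr (- 1 / 2) *
      K_DBM (N + n, edge_pos a N x, t / (2 * real N)) (N + n', edge_pos a N x', t' / (2 * real N))))"

lemma gexp_eq_exp:
  "exp (of_real (s / 2) * (u\<^sup>2 - 2 * of_real a * u) + u * of_real y) = gexp (y - a * s) s u"
  unfolding gexp_def by (rule arg_cong[where f=exp]) (simp add: algebra_simps)

lemma K_Bead_eq_inside:
  assumes a: "\<bar>a\<bar> < 1" and n: "n \<le> n'" and p: "\<not> precedes (n, x, t) (n', x', t')"
  shows "K_Bead a (n, x, t) (n', x', t') = 1 / (2 * of_real pi) *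
    (LBINT v. (if norm (Complex a v) < 1 then Complex a v ^ (n' - n) * gexp (x - x' - a * (t' - t)) (t' - t)
        (Complex a v) else 0))"
proof -
  have "u powi (int n' - int n) = u ^ (n' - n)" for u :: complex
    using n by (simp flip: of_nat_diff)
  then have "K_Bead a (n, x, t) (n', x', t') = 1 / (2 * of_real pi * \<i>) *
     contour_integral (linepath (u_minus a) (u_plus a)) (\<lambda>u. u ^ (n' - n) * gexp (x - x' - a * (t' -
         t)) (t' - t) u)"
    using n p by (simp only: K_Bead_def phi_Bead_def bead_contour_def gexp_eq_exp prod.case if_True if_False
        simp_thms) simp
  also have "\<dots> = 1 / (2 * of_real pi * \<i>) * (\<i> * (LBINT v. (if norm (Complex a v) < 1 then Complex
      a v ^ (n' - n) * gexp (x - x' - a * (t' - t)) (t' - t) (Complex a v) else 0)))"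
    by (subst contour_integral_segment[OF a]) (auto intro!: holomorphic_intros)
  finally show ?thesis
    by simp
qed

lemma K_Bead_eq_precedes:
  assumes n: "n' \<le> n" and p: "precedes (n, x, t) (n', x', t')"
  shows "K_Bead a (n, x, t) (n', x', t') = - of_real (H_conv (n - n') (2 * (t' - t)) x (x' + a * (t' - t))) +
    1 / (2 * of_real pi * \<i>) * contour_integral (bead_contour a n n') (\<lambda>u. gexp (x - x' - a * (t' -
        t)) (t' - t) u / u ^ (n - n'))"
proof -
  have pw: "u powi (int n' - int n) * z = z / u ^ (n - n')" for u z :: complex
  proof -
    have "int n' - int n = - int (n - n')"
      using n by simp
    then have "u powi (int n' - int n) = inverse (u ^ (n - n'))"
      by (simp only: power_int_minus power_int_of_nat)
    then show ?thesis
      by (simp add: field_simps)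
  qed
  show ?thesis
    using p by (simp only: K_Bead_def phi_Bead_def gexp_eq_exp pw prod.case if_True)
qed

text \<open>As a line integral, phi equals the outside part plus the very contour integral that
  occurs in \<open>K_Bead\<close>; the latter cancels. For n = n' there is no pole and the line Re u
  = a simply splits into its two parts.\<close>

lemma K_Bead_eq_outside:
  assumes a: "\<bar>a\<bar> < 1" and n: "n' \<le> n" and t: "t < t'"
  shows "K_Bead a (n, x, t) (n', x', t') = - (1 / (2 * of_real pi) *
    (LBINT v. (if 1 < norm (Complex a v) then gexp (x - x' - a * (t' - t)) (t' - t) (Complex a v) / Complex a v
        ^ (n - n') else 0)))"
proof -
  define s where "s = t' - t"
  define \<beta> where "\<beta> = x - x' - a * s"
  have s: "0 < s"
    using t by (simp add: s_def)
  have \<beta>: "x - (x' + a * s) = \<beta>"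
    by (simp add: \<beta>_def)
  have p: "precedes (n, x, t) (n', x', t')"
    using n t by (auto simp: precedes_def)
  let ?h = "\<lambda>v. if 1 < norm (Complex a v) then gexp \<beta> s (Complex a v) / Complex a v ^ (n - n') else 0"
  note K = K_Bead_eq_precedes[OF n p, of a, folded s_def, folded \<beta>_def]
  have "of_real (H_conv (n - n') (2 * s) x (x' + a * s)) =
     1 / (2 * of_real pi) * (LBINT v. ?h v) + 1 / (2 * of_real pi * \<i>) * contour_integral (bead_contour a n
         n') (\<lambda>u. gexp \<beta> s u / u ^ (n - n'))"
  proof (cases "n = n'")
    case True
    have hi: "integrable lborel ?h"
      using s by (rule integrable_outside)
    have gi: "integrable lborel (\<lambda>v. if norm (Complex a v) < 1 then gexp \<beta> s (Complex a v) else 0)"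
      by (intro integrable_inside continuous_intros)
    have "(LBINT v. gexp \<beta> s (Complex a v)) = (LBINT v. ?h v + (if norm (Complex a v) < 1 then gexp
        \<beta> s (Complex a v) else 0))"
    proof (rule integral_cong_AE)
      show "AE v in lborel. gexp \<beta> s (Complex a v) = ?h v + (if norm (Complex a v) < 1 then gexp \<beta>
          s (Complex a v) else 0)"
        using AE_Complex_norm_neq[of a] by eventually_elim (use True in auto)
    qed measurable
    also have "\<dots> = (LBINT v. ?h v) + (LBINT v. (if norm (Complex a v) < 1 then gexp \<beta> s (Complex a
        v) else 0))"
      by (rule Bochner_Integration.integral_add[OF hi gi])
    finally have "(LBINT v. gexp \<beta> s (Complex a v)) = \<dots>" .
    moreover have "of_real (H_conv (n - n') (2 * s) x (x' + a * s)) = 1 / (2 * of_real pi) * (LBINT v. gexp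
        \<beta> s (Complex a v))"
      using True bm_density_eq_gexp[OF s, of x "x' + a * s" a] by (simp only: H_conv_def diff_self_eq_0
          simp_thms if_True \<beta>)
    moreover have "contour_integral (bead_contour a n n') (\<lambda>u. gexp \<beta> s u / u ^ (n - n')) =
        \<i> * (LBINT v. (if norm (Complex a v) < 1 then gexp \<beta> s (Complex a v) else 0))"
      using True contour_integral_segment[OF a gexp_holomorphic, of \<beta> s] by (simp add: bead_contour_def)
    ultimately show ?thesis
      by (simp add: distrib_left)
  next
    case False
    then have "n' < n" and Suc: "n - n' = Suc (n - n' - 1)"
      using n by auto
    \<comment> \<open>Any positive abscissa would do in place of 1; a itself may lie at or to the
      left of the pole.\<close>
    have "complex_of_real (H_conv (n - n') (2 * s) x (x' + a * s)) = 1 / (2 * of_real pi) * (LBINT v. gexp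
        \<beta> s (Complex 1 v) / Complex 1 v ^ (n - n'))"
      using H_conv_eq_integral[OF s, of 1 "n - n' - 1" x "x' + a * s"] unfolding Suc[symmetric] \<beta> by simp
    also have "\<dots> = 1 / (2 * of_real pi * \<i>) * (\<i> * (LBINT v. gexp \<beta> s (Complex 1 v) / Complex
        1 v ^ (n - n')))"
      by simp
    also have "\<dots> = 1 / (2 * of_real pi * \<i>) * (\<i> * (LBINT v. ?h v) + contour_integral (bead_contour
        a n n') (\<lambda>u. gexp \<beta> s u / u ^ (n - n')))"
      using contour_shift[OF a _ s \<open>n' < n\<close>, of 1 \<beta> "n - n'"] by simp
    finally show ?thesis
      by (simp add: distrib_left)
  qed
  then show ?thesis
    unfolding K s_def[symmetric] \<beta>_def[symmetric] by simp
qed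

lemma DBM_term_eq_0: "int n + l < 0 \<Longrightarrow> DBM_term (n, x, t) (n', x', t') l = 0"
  by (simp add: DBM_term_def hermite_star_def)

lemma scaled_diff_eq:
  fixes I J E :: complex
  shows "of_real (e / (2 * pi)) * (I + E) - 1 / (2 * of_real pi) * J = 1 / (2 * of_real pi) * ((of_real e * I -
      J) + of_real e * E)"
    and "- (of_real (e / (2 * pi)) * (I - E)) - - (1 / (2 * of_real pi) * J) = 1 / (2 * of_real pi) * (-
        (of_real e * I - J) + of_real e * E)"
  by (simp_all add: field_simps)

lemma divide_le_divide_sqrt:
  fixes y r :: real
  assumes "1 \<le> r" "0 \<le> y"
  shows "y / r \<le> y / sqrt r"
proof (rule divide_left_mono)
  show "sqrt r \<le> r"
    using assms mult_left_mono[of 1 r r] by (intro real_le_lsqrt) (auto simp: power2_eq_square)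
qed (use assms in auto)

lemma norm_scaled_diff_le:
  fixes X Y :: complex
  shows "norm (1 / (2 * of_real pi) * (X + of_real (exp c) * Y)) \<le> norm X + exp c * norm Y"
proof -
  have "norm (1 / (2 * of_real pi) * (X + of_real (exp c) * Y)) = 1 / (2 * pi) * norm (X + of_real (exp c) * Y)"
    by (simp add: norm_mult norm_divide)
  also have "\<dots> \<le> 1 * norm (X + of_real (exp c) * Y)"
    using pi_ge_two by (intro mult_right_mono) auto
  also have "\<dots> \<le> norm X + exp c * norm Y"
    using norm_triangle_ineq[of X "of_real (exp c) * Y"] by (simp add: norm_mult)
  finally show ?thesis .
qed

text \<open>The lower level n decides where the sum stops: the Taylor polynomial has N + n terms and
  the moments are shifted by n' - n.\<close>

lemma scaled_DBM_bound_inside: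
  fixes n n' :: nat and a S B :: real
  assumes a: "\<bar>a\<bar> < 1" and n: "n \<le> n'"
  obtains K N0 where "\<And>N x t x' t'. \<lbrakk>N0 \<le> N; \<bar>t' - t\<bar> \<le> S; \<bar>x\<bar> \<le>
      B; \<bar>x'\<bar> \<le> B; \<not> precedes (n, x, t) (n', x', t')\<rbrakk> \<Longrightarrow>
    norm (scaled_DBM a N (n, x, t) (n', x', t') - K_Bead a (n, x, t) (n', x', t')) \<le> K / sqrt (real N)"
proof -
  define M where "M = (real n' + 1) * S + 2 * B + 3 * S + (B + S) * S + S\<^sup>2"
  define D where "D = (real n' + 1) * S + (B + S) * S + S\<^sup>2"
  define L where "L = exp (S\<^sup>2 + 3 * B + S + real n') * (64 * skern_int\<^sup>2 / (pi * (1 - \<bar>a\<bar>)))"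
  \<comment> \<open>2 S <= N serves the expansions of the exponentials, 4 (S + n') <= N the decay on
    the line.\<close>
  define N0 where "N0 = nat \<lceil>max 1 (max (2 * S) (4 * (S + real n')))\<rceil>"
  have "norm (scaled_DBM a N (n, x, t) (n', x', t') - K_Bead a (n, x, t) (n', x', t')) \<le> (exp M * D * 2 +
      exp M * L) / sqrt (real N)"
    if N0: "N0 \<le> N" and s: "\<bar>t' - t\<bar> \<le> S" and B: "\<bar>x\<bar> \<le> B" "\<bar>x'\<bar>
        \<le> B" and p: "\<not> precedes (n, x, t) (n', x', t')" for N x t x' t'
  proof -
    have "max 1 (max (2 * S) (4 * (S + real n'))) \<le> real N"
      using N0 unfolding N0_def by linarith
    then have N: "1 \<le> real N" "2 * S \<le> real N" "4 * (S + real n') \<le> real N"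
      by auto
    have S: "0 \<le> S" and B0: "0 \<le> B"
      using s B by auto
    have N': "0 < N" "S \<le> real N"
      using N S by auto
    define s where "s = t' - t"
    have s: "\<bar>s\<bar> \<le> S"
      using s by (simp add: s_def)
    define \<rho> where "\<rho> = sqrt (real N / 2)"
    define \<kappa> where "\<kappa> = exp (s / (2 * real N)) * \<rho>"
    define \<beta> where "\<beta> = 2 * edge_pos a N x * \<rho> - 2 * edge_pos a N x' * \<kappa>"
    define \<sigma> where "\<sigma> = 2 * \<kappa>\<^sup>2 - 2 * \<rho>\<^sup>2"
    define c where "c = s / (2 * real N) * (real n' + 1)"
    define \<beta>' where "\<beta>' = x - x' - a * s"
    have \<tau>: "t' / (2 * real N) - t / (2 * real N) = s / (2 * real N)"
      by (simp add: s_def diff_divide_distrib)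
    have \<kappa>: "0 < \<kappa>"
      using N' by (simp add: \<kappa>_def \<rho>_def)
    let ?G = "gexp (- 2 * edge_pos a N x' * \<kappa>) (2 * \<kappa>\<^sup>2)"
    let ?p = "(N + n, edge_pos a N x, t / (2 * real N))" and ?p' = "(N + n', edge_pos a N x', t' / (2 * real N))"
    obtain E where E: "\<And>v. norm (Complex a v) \<noteq> 1 \<Longrightarrow> E v = (Complex a v ^ ((N + n) +
        (n' - n)) * ?G (Complex a v)) * ctail (hgen (edge_pos a N x) \<rho>) (N + n) (Complex a v)"
      and sum: "(\<Sum>j<N + n. of_real (hcoeff (edge_pos a N x) \<rho> j) * (LBINT v. Complex a v ^ (j + (n' -
          n)) * ?G (Complex a v))) =
      (LBINT v. (if norm (Complex a v) < 1 then Complex a v ^ (n' - n) * gexp \<beta> \<sigma> (Complex a v)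
          else 0)) + (LBINT v. E v)"
      by (rule finite_sum_eq_integral[OF \<kappa>, where X="edge_pos a N x" and X'="edge_pos a N x'" and
          \<rho>=\<rho> and a=a and m="N + n" and d="n' - n",
            folded \<beta>_def \<sigma>_def]) (rule that; assumption)
    let ?I = "LBINT v. (if norm (Complex a v) < 1 then Complex a v ^ (n' - n) * gexp \<beta> \<sigma> (Complex
        a v) else 0)"
    let ?J = "LBINT v. (if norm (Complex a v) < 1 then Complex a v ^ (n' - n) * gexp \<beta>' s (Complex a v) else 0)"
    define g where "g = (\<lambda>j. of_real (hcoeff (edge_pos a N x) \<rho> j) * (LBINT v. Complex a v ^ (j +
        (n' - n)) * ?G (Complex a v)))"
    have prec: "\<not> precedes ?p ?p'"
      using p N' by (auto simp: precedes_def divide_less_cancel)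
    have "K_DBM ?p ?p' = (\<Sum>j. DBM_term ?p ?p' (- 1 - int j))"
      using prec by (simp add: K_DBM_def)
    also have "\<dots> = (\<Sum>j<N + n. DBM_term ?p ?p' (- 1 - int j))"
      by (rule suminf_finite) (auto intro!: DBM_term_eq_0)
    finally have Ks: "scaled_DBM a N (n, x, t) (n', x', t') = (\<Sum>j<N + n. complex_of_real
     (exp (- real N * (t' / (2 * real N) - t / (2 * real N))) * real N powr ((real n - real n') / 2) * (2 *
         real N) powr (- 1 / 2) *
      DBM_term ?p ?p' (- 1 - int j)))"
      by (simp only: scaled_DBM_def prod.case sum_distrib_left of_real_sum)
    \<comment> \<open>The kernel sums from the top degree downwards; its j-th term has degree N + n
      - 1 - j.\<close>
    also have "\<dots> = (\<Sum>j<N + n. of_real (exp c / (2 * pi)) * g (N + n - Suc j))"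
    proof (rule sum.cong[OF refl])
      fix j assume j: "j \<in> {..<N + n}"
      have "int (N + n - Suc j) = int (N + n) + (- 1 - int j)" "int (N + n - Suc j + (n' - n)) = int (N + n') +
          (- 1 - int j)"
        using j n by auto
      from scaled_DBM_term[OF N'(1) this, of "t' / (2 * real N)" "t / (2 * real N)" "edge_pos a N x" "edge_pos
          a N x'" a]
      show "complex_of_real
     (exp (- real N * (t' / (2 * real N) - t / (2 * real N))) * real N powr ((real n - real n') / 2) * (2 *
         real N) powr (- 1 / 2) *
      DBM_term ?p ?p' (- 1 - int j)) = of_real (exp c / (2 * pi)) * g (N + n - Suc j)"
        unfolding \<tau> \<rho>_def[symmetric] \<kappa>_def[symmetric] c_def[symmetric] g_def .
    qed
    also have "\<dots> = of_real (exp c / (2 * pi)) * (\<Sum>j<N + n. g j)"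
      unfolding sum_distrib_left[symmetric] sum.nat_diff_reindex ..
    also have "(\<Sum>j<N + n. g j) = ?I + (LBINT v. E v)"
      unfolding g_def by (rule sum)
    finally have K1: "scaled_DBM a N (n, x, t) (n', x', t') = of_real (exp c / (2 * pi)) * (?I + (LBINT v. E v))" .
    have K2: "K_Bead a (n, x, t) (n', x', t') = 1 / (2 * of_real pi) * ?J"
      unfolding K_Bead_eq_inside[OF a n p] s_def[symmetric] \<beta>'_def[symmetric] ..
    have E_le: "norm (LBINT v. E v) \<le> L / sqrt (real N)"
      unfolding L_def
    proof (rule edge_error_bound[OF N'(1) N'(2) N(3) s a B])
      fix v assume "norm (Complex a v) \<noteq> 1"
      then show "E v = (Complex a v ^ (N + n') * gexp (- 2 * edge_pos a N x' * (exp (s / (2 * real N)) * sqrt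
          (real N / 2)))
         (2 * (exp (s / (2 * real N)) * sqrt (real N / 2))\<^sup>2) (Complex a v)) * ctail (hgen (edge_pos a N
             x) (sqrt (real N / 2))) (N + n) (Complex a v)"
        using E[of v] n unfolding \<rho>_def[symmetric] \<kappa>_def[symmetric] by simp
    qed
    have IJ: "norm (of_real (exp c) * ?I - ?J) \<le> exp M * D * 2 / real N"
      unfolding M_def D_def \<beta>_def \<sigma>_def \<kappa>_def \<rho>_def c_def \<beta>'_def
      using a by (intro inside_integral_diff N' N s B) auto
    have c: "exp c \<le> exp M"
      using edge_exponents(2)[OF N'(1) N(2) s _ B, of a n'] a
      unfolding M_def[symmetric] c_def[symmetric] by auto
    have D: "0 \<le> D"
      unfolding D_def using S B0 by simp
    have "norm (scaled_DBM a N (n, x, t) (n', x', t') - K_Bead a (n, x, t) (n', x', t')) \<le> norm (of_real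
        (exp c) * ?I - ?J) + exp c * norm (LBINT v. E v)"
      unfolding K1 K2 scaled_diff_eq
      by (rule norm_scaled_diff_le)
    also have "\<dots> \<le> exp M * D * 2 / sqrt (real N) + exp M * (L / sqrt (real N))"
    proof (rule add_mono)
      have "exp M * D * 2 / real N \<le> exp M * D * 2 / sqrt (real N)"
        by (rule divide_le_divide_sqrt[OF N(1)]) (simp add: D)
      then show "norm (of_real (exp c) * ?I - ?J) \<le> exp M * D * 2 / sqrt (real N)"
        by (rule order.trans[OF IJ])
      show "exp c * norm (LBINT v. E v) \<le> exp M * (L / sqrt (real N))"
        by (rule mult_mono[OF c E_le exp_ge_zero norm_ge_zero])
    qed
    finally show ?thesis
      by (simp only: add_divide_distrib times_divide_eq_right)
  qed
  then show thesis
    by (rule that)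
qed

text \<open>The constants involve only the upper bound S of t' - t, so the estimate survives the
  limit of equal times.\<close>

lemma scaled_DBM_bound_outside:
  fixes n n' :: nat and a S B :: real
  assumes a: "\<bar>a\<bar> < 1" and n: "n' \<le> n"
  obtains K N0 where "\<And>N x t x' t'. \<lbrakk>N0 \<le> N; t < t'; t' - t \<le> S; \<bar>x\<bar> \<le> B;
      \<bar>x'\<bar> \<le> B\<rbrakk> \<Longrightarrow>
    norm (scaled_DBM a N (n, x, t) (n', x', t') - K_Bead a (n, x, t) (n', x', t')) \<le> K / sqrt (real N)"
proof -
  define M where "M = (real n' + 1) * S + 2 * B + 3 * S + (B + S) * S + S\<^sup>2"
  define D where "D = real n' + 1 + B + 2 * S"
  define W where "W = exp M * (D * sqrt S + D + 4 * sqrt S) * sqrt (4 * pi)"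
  define L where "L = exp (S\<^sup>2 + 3 * B + S + real n') * (64 * skern_int\<^sup>2 / (pi * (1 - \<bar>a\<bar>)))"
  define N0 where "N0 = nat \<lceil>max 1 (max (2 * S) (4 * (S + real n')))\<rceil>"
  have "norm (scaled_DBM a N (n, x, t) (n', x', t') - K_Bead a (n, x, t) (n', x', t')) \<le> (W + exp M * L) /
      sqrt (real N)"
    if N0: "N0 \<le> N" and t: "t < t'" "t' - t \<le> S" and B: "\<bar>x\<bar> \<le> B" "\<bar>x'\<bar> \<le>
        B" for N x t x' t'
  proof -
    have "max 1 (max (2 * S) (4 * (S + real n'))) \<le> real N"
      using N0 unfolding N0_def by linarith
    then have N: "1 \<le> real N" "2 * S \<le> real N" "4 * (S + real n') \<le> real N"
      by auto
    have S: "0 \<le> S" and B0: "0 \<le> B"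
      using t B by auto
    have N': "0 < N" "S \<le> real N"
      using N S by auto
    define s where "s = t' - t"
    have s0: "0 < s" "s \<le> S" and s: "\<bar>s\<bar> \<le> S"
      using t by (auto simp: s_def)
    define \<rho> where "\<rho> = sqrt (real N / 2)"
    define \<kappa> where "\<kappa> = exp (s / (2 * real N)) * \<rho>"
    define \<beta> where "\<beta> = 2 * edge_pos a N x * \<rho> - 2 * edge_pos a N x' * \<kappa>"
    define \<sigma> where "\<sigma> = 2 * \<kappa>\<^sup>2 - 2 * \<rho>\<^sup>2"
    define c where "c = s / (2 * real N) * (real n' + 1)"
    define \<beta>' where "\<beta>' = x - x' - a * s"
    have \<tau>: "t' / (2 * real N) - t / (2 * real N) = s / (2 * real N)"
      by (simp add: s_def diff_divide_distrib)
    have \<rho>: "0 < \<rho>"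
      using N' by (simp add: \<rho>_def)
    have "1 < exp (s / (2 * real N))"
      using s0 N' by simp
    then have \<kappa>: "\<rho> < \<kappa>"
      using \<rho> by (simp add: \<kappa>_def)
    let ?G = "gexp (- 2 * edge_pos a N x' * \<kappa>) (2 * \<kappa>\<^sup>2)"
    let ?p = "(N + n, edge_pos a N x, t / (2 * real N))" and ?p' = "(N + n', edge_pos a N x', t' / (2 * real N))"
    let ?I = "LBINT v. (if 1 < norm (Complex a v) then gexp \<beta> \<sigma> (Complex a v) / Complex a v ^ (n -
        n') else 0)"
    let ?J = "LBINT v. (if 1 < norm (Complex a v) then gexp \<beta>' s (Complex a v) / Complex a v ^ (n - n') else 0)"
    obtain E where E: "\<And>v. norm (Complex a v) \<noteq> 1 \<Longrightarrow> E v = (Complex a v ^ (N + n') *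
        ?G (Complex a v)) * ctail (hgen (edge_pos a N x) \<rho>) (N + n' + (n - n')) (Complex a v)"
      and sums: "(\<lambda>j. of_real (hcoeff (edge_pos a N x) \<rho> (N + n' + (n - n') + j)) * (LBINT v.
          Complex a v ^ (N + n' + j) * ?G (Complex a v))) sums
        (?I - (LBINT v. E v))"
      by (rule series_eq_integral[OF \<rho> \<kappa>, where X="edge_pos a N x" and X'="edge_pos a N x'" and a=a
          and p="N + n'" and k="n - n'",
            folded \<beta>_def \<sigma>_def]) (rule that; assumption)
    let ?C = "exp (- real N * (t' / (2 * real N) - t / (2 * real N))) * real N powr ((real n - real n') / 2) *
        (2 * real N) powr (- 1 / 2)"
    have trm: "complex_of_real (?C * DBM_term ?p ?p' (int j)) = of_real (exp c / (2 * pi)) * (of_real (hcoeff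
        (edge_pos a N x) \<rho> (N + n' + (n - n') + j)) *
         (LBINT v. Complex a v ^ (N + n' + j) * ?G (Complex a v)))" for j
    proof -
      have "int (N + n' + (n - n') + j) = int (N + n) + int j" "int (N + n' + j) = int (N + n') + int j"
        using n by auto
      from scaled_DBM_term[OF N'(1) this, of "t' / (2 * real N)" "t / (2 * real N)" "edge_pos a N x" "edge_pos
          a N x'" a]
      show ?thesis
        unfolding \<tau> \<rho>_def[symmetric] \<kappa>_def[symmetric] c_def[symmetric] .
    qed
    have "(\<lambda>j. complex_of_real (?C * DBM_term ?p ?p' (int j))) sums (of_real (exp c / (2 * pi)) * (?I -
        (LBINT v. E v)))"
      unfolding trm by (rule sums_mult[OF sums])
    then have cs: "(\<lambda>j. complex_of_real (?C * DBM_term ?p ?p' (int j))) sums (of_real (exp c / (2 *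
        pi)) * (?I - (LBINT v. E v)))" .
    \<comment> \<open>Convergence is known for the scaled terms; a nonzero prefactor transfers it to
      the terms of \<open>K_DBM\<close>, where \<open>suminf\<close> needs it.\<close>
    have C0: "?C \<noteq> 0"
      using N' by simp
    have "summable (\<lambda>j. ?C * DBM_term ?p ?p' (int j))"
      using sums_Re[OF cs] by (simp add: sums_iff)
    then have "summable (\<lambda>j. DBM_term ?p ?p' (int j))"
      using summable_cmult_iff[of ?C "\<lambda>j. DBM_term ?p ?p' (int j)"] C0 by blast
    then have "complex_of_real (?C * (\<Sum>j. DBM_term ?p ?p' (int j))) = of_real (exp c / (2 * pi)) * (?I -
        (LBINT v. E v))"
      by (intro sums_unique2[OF _ cs] sums_of_real sums_mult summable_sums)
    moreover have "precedes ?p ?p'"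
      using n t N' by (auto simp: precedes_def divide_strict_right_mono)
    ultimately have K1: "scaled_DBM a N (n, x, t) (n', x', t') = - (of_real (exp c / (2 * pi)) * (?I - (LBINT
        v. E v)))"
      by (simp add: scaled_DBM_def K_DBM_def)
    have K2: "K_Bead a (n, x, t) (n', x', t') = - (1 / (2 * of_real pi) * ?J)"
      unfolding K_Bead_eq_outside[OF a n t(1)] s_def[symmetric] \<beta>'_def[symmetric] ..
    have E_le: "norm (LBINT v. E v) \<le> L / sqrt (real N)"
      unfolding L_def
    proof (rule edge_error_bound[OF N'(1) N'(2) N(3) s a B])
      fix v assume "norm (Complex a v) \<noteq> 1"
      then show "E v = (Complex a v ^ (N + n') * gexp (- 2 * edge_pos a N x' * (exp (s / (2 * real N)) * sqrt
          (real N / 2)))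
         (2 * (exp (s / (2 * real N)) * sqrt (real N / 2))\<^sup>2) (Complex a v)) * ctail (hgen (edge_pos a N
             x) (sqrt (real N / 2))) (N + n' + (n - n')) (Complex a v)"
        using E[of v] unfolding \<rho>_def[symmetric] \<kappa>_def[symmetric] by simp
    qed
    have IJ: "norm (of_real (exp c) * ?I - ?J) \<le> W / real N"
      unfolding W_def M_def D_def \<beta>_def \<sigma>_def \<kappa>_def \<rho>_def c_def \<beta>'_def
      using a by (intro outside_integral_diff N' N s0 B) auto
    have c: "exp c \<le> exp M"
      using edge_exponents(2)[OF N'(1) N(2) s _ B, of a n'] a
      unfolding M_def[symmetric] c_def[symmetric] by auto
    have W: "0 \<le> W"
      unfolding W_def D_def using S B0 by simp
    have "norm (scaled_DBM a N (n, x, t) (n', x', t') - K_Bead a (n, x, t) (n', x', t')) \<le> norm (of_real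
        (exp c) * ?I - ?J) + exp c * norm (LBINT v. E v)"
      unfolding K1 K2 scaled_diff_eq by (rule order.trans[OF norm_scaled_diff_le]) (simp only:
          norm_minus_cancel order.refl)
    also have "\<dots> \<le> W / sqrt (real N) + exp M * (L / sqrt (real N))"
    proof (rule add_mono)
      have "W / real N \<le> W / sqrt (real N)"
        by (rule divide_le_divide_sqrt[OF N(1) W])
      then show "norm (of_real (exp c) * ?I - ?J) \<le> W / sqrt (real N)"
        by (rule order.trans[OF IJ])
      show "exp c * norm (LBINT v. E v) \<le> exp M * (L / sqrt (real N))"
        by (rule mult_mono[OF c E_le exp_ge_zero norm_ge_zero])
    qed
    finally show ?thesis
      by (simp only: add_divide_distrib times_divide_eq_right)
  qed
  then show thesis
    by (rule that)
qed

section \<open>Convergence of the series at equal times\<close>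

lemma tendsto_integral_Icc:
  fixes h :: "real \<Rightarrow> complex"
  assumes h: "integrable lborel (\<lambda>v. indicator {v0..} v *\<^sub>R h v)" and V: "filterlim V at_top
      sequentially"
  shows "(\<lambda>i. LBINT v. indicator {v0..V i} v *\<^sub>R h v) \<longlonglongrightarrow> (LBINT v.
      indicator {v0..} v *\<^sub>R h v)"
proof -
  let ?h = "\<lambda>v. indicator {v0..} v *\<^sub>R h v"
  have eq: "indicator {v0..V i} v *\<^sub>R h v = indicator {..V i} v *\<^sub>R ?h v" for i v
    by (auto simp: indicator_def)
  have [measurable]: "?h \<in> borel_measurable lborel"
    using h by (rule borel_measurable_integrable)
  show ?thesis
    unfolding eq
  proof (rule integral_dominated_convergence[where w="\<lambda>v. norm (?h v)"])
    show "?h \<in> borel_measurable lborel" "\<And>i. (\<lambda>v. indicator {..V i} v *\<^sub>R ?h v) \<in>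
        borel_measurable lborel"
      by measurable
    show "AE v in lborel. (\<lambda>i. indicator {..V i} v *\<^sub>R ?h v) \<longlonglongrightarrow> ?h v"
    proof (intro AE_I2 tendsto_eventually)
      fix v
      have "\<forall>\<^sub>F i in sequentially. v \<le> V i"
        using V by (simp add: filterlim_at_top)
      then show "\<forall>\<^sub>F i in sequentially. indicator {..V i} v *\<^sub>R ?h v = ?h v"
        by eventually_elim simp
    qed
    show "AE v in lborel. norm (indicator {..V i} v *\<^sub>R ?h v) \<le> norm (?h v)" for i
      by (rule AE_I2) (simp add: indicator_def)
  qed (rule integrable_norm[OF h])
qed

lemma integrable_inverse_square:
  "integrable lborel (\<lambda>v::real. inverse (1 + v\<^sup>2))"
  using integrable_inverse_1_plus_square by (simp add: set_integrable_def)

lemma integrable_line_power: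
  fixes c b v0 :: real
  assumes "0 < v0" "2 \<le> k"
  shows "integrable lborel (\<lambda>v. indicator {v0..} v *\<^sub>R (gexp b 0 (Complex c v) / Complex c v ^ k))"
proof (rule Bochner_Integration.integrable_bound)
  define m where "m = min 1 v0"
  have m: "0 < m" "m \<le> 1" "m \<le> v0"
    using assms by (auto simp: m_def)
  show "integrable lborel (\<lambda>v::real. (exp (b * c) * (2 / m ^ k)) * inverse (1 + v\<^sup>2))"
    by (intro integrable_mult_right integrable_inverse_square)
  show "AE v in lborel. norm (indicator {v0..} v *\<^sub>R (gexp b 0 (Complex c v) / Complex c v ^ k)) \<le>
      norm ((exp (b * c) * (2 / m ^ k)) * inverse (1 + v\<^sup>2))"
  proof (intro AE_I2)
    fix v
    show "norm (indicator {v0..} v *\<^sub>R (gexp b 0 (Complex c v) / Complex c v ^ k)) \<le> norm ((exp (b *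
        c) * (2 / m ^ k)) * inverse (1 + v\<^sup>2))"
    proof (cases "v0 \<le> v")
      case True
      have v: "0 < v" "1 \<le> v / m"
        using True m by auto
      have "1 + v\<^sup>2 \<le> 2 * (v / m)\<^sup>2"
      proof -
        have "v \<le> v / m"
          using v m by (simp add: le_divide_eq_1 pos_le_divide_eq mult_left_le)
        then have "v\<^sup>2 \<le> (v / m)\<^sup>2"
          using v by (intro power_mono) auto
        moreover have "1 \<le> (v / m)\<^sup>2"
          using v(2) by (rule one_le_power)
        ultimately show ?thesis by simp
      qed
      also have "\<dots> \<le> 2 * (v / m) ^ k"
        using v assms by (intro mult_left_mono power_increasing) auto
      also have "\<dots> = 2 / m ^ k * v ^ k"
        by (simp add: power_divide)
      also have "\<dots> \<le> 2 / m ^ k * norm (Complex c v) ^ k"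
        using v m abs_Im_le_cmod[of "Complex c v"] by (intro mult_left_mono power_mono) auto
      finally have "1 / norm (Complex c v) ^ k \<le> 2 / m ^ k * inverse (1 + v\<^sup>2)"
      proof -
        assume *: "1 + v\<^sup>2 \<le> 2 / m ^ k * norm (Complex c v) ^ k"
        have "0 < norm (Complex c v) ^ k"
          using v by (auto simp: complex_eq_iff)
        moreover have "0 < 1 + v\<^sup>2"
          by (simp add: add_pos_nonneg)
        moreover have "1 / x \<le> K * inverse d" if "0 < x" "0 < d" "d \<le> K * x" for x d K :: real
          using that by (simp add: field_simps)
        ultimately show ?thesis
          using * by blast
      qed
      then have "exp (b * c) * (1 / norm (Complex c v) ^ k) \<le> exp (b * c) * (2 / m ^ k * inverse (1 + v\<^sup>2))"
        by (intro mult_left_mono) auto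
      moreover have "norm (gexp b 0 (Complex c v) / Complex c v ^ k) = exp (b * c) * (1 / norm (Complex c v) ^ k)"
        by (simp add: norm_divide norm_power norm_gexp)
      moreover have "0 \<le> exp (b * c) * (2 / m ^ k) * inverse (1 + v\<^sup>2)"
        using m by simp
      ultimately show ?thesis
        using True m by (simp add: mult.assoc power_abs)
    qed simp
  qed
qed measurable

text \<open>For k >= 2 the integrand is absolutely integrable. For k = 1 the oscillation exp (i b v)
  is needed: one integration by parts trades it for the exponent 2.\<close>

lemma convergent_line_integral:
  fixes c b v0 :: real
  assumes v0: "0 < v0" and k: "1 \<le> k" "b \<noteq> 0 \<or> 2 \<le> k" and V: "filterlim V at_top sequentially"
  shows "convergent (\<lambda>i. LBINT v. indicator {v0..V i} v *\<^sub>R (gexp b 0 (Complex c v) / Complex c v ^ k))"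
proof (cases "2 \<le> k")
  case True
  show ?thesis
    by (rule convergentI[OF tendsto_integral_Icc[OF integrable_line_power[OF v0 True] V]])
next
  case False
  then have k1: "k = 1" and b: "b \<noteq> 0"
    using k by auto
  let ?f = "\<lambda>k v. gexp b 0 (Complex c v) / Complex c v ^ k"
  \<comment> \<open>The derivative of exp (b u) / (b u) is the integrand for k = 1 minus 1 / b times
    the one for k = 2.\<close>
  define P where "P = (\<lambda>u. gexp b 0 u / (of_real b * u))"
  have der: "(P has_field_derivative (gexp b 0 u / u ^ 1 - 1 / of_real b * (gexp b 0 u / u ^ 2))) (at u)" if "u
      \<noteq> 0" for u
    unfolding P_def gexp_def using that b
    by (auto intro!: derivative_eq_intros simp: field_simps power2_eq_square)
  have nz: "Complex c v \<noteq> 0" if "v0 \<le> v" for v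
    using that v0 by (auto simp: complex_eq_iff)
  have cont: "continuous_on {v0..V i} (?f k)" for i k
    using nz by (intro continuous_intros) auto
  have int: "integrable lborel (\<lambda>v. indicator {v0..V i} v *\<^sub>R ?f k v)" for i k
    using borel_integrable_atLeastAtMost'[OF cont] by (simp add: set_integrable_def)
  let ?I = "\<lambda>k i. LBINT v. indicator {v0..V i} v *\<^sub>R ?f k v"
  have eq: "?I 1 i = - \<i> * (P (Complex c (V i)) - P (Complex c v0)) + 1 / of_real b * ?I 2 i" if V: "v0
      \<le> V i" for i
  proof -
    have "\<i> * (LBINT v. indicator {v0..V i} v *\<^sub>R (?f 1 v - 1 / of_real b * ?f 2 v)) = P (Complex c (V
        i)) - P (Complex c v0)"
      using V by (intro line_integral_FTC[where f="\<lambda>u. gexp b 0 u / u ^ 1 - 1 / of_real b * (gexp b 0 u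
          / u ^ 2)"] der nz
          continuous_on_diff continuous_on_mult continuous_on_const cont)
    also have "(LBINT v. indicator {v0..V i} v *\<^sub>R (?f 1 v - 1 / of_real b * ?f 2 v)) =
       (LBINT v. indicator {v0..V i} v *\<^sub>R ?f 1 v - 1 / of_real b * (indicator {v0..V i} v *\<^sub>R ?f 2 v))"
      by (intro Bochner_Integration.integral_cong) (auto simp: indicator_def)
    also have "\<dots> = ?I 1 i - 1 / of_real b * ?I 2 i"
      unfolding Bochner_Integration.integral_diff[OF int integrable_mult_right[OF int]] integral_mult_right_zero ..
    finally have "\<i> * (?I 1 i - 1 / of_real b * ?I 2 i) = P (Complex c (V i)) - P (Complex c v0)" .
    then have "- \<i> * (\<i> * (?I 1 i - 1 / of_real b * ?I 2 i)) = - \<i> * (P (Complex c (V i)) - P (Complex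
        c v0))"
      by (rule arg_cong)
    moreover have "- \<i> * (\<i> * z) = z" for z
      by simp
    ultimately have "?I 1 i - 1 / of_real b * ?I 2 i = - \<i> * (P (Complex c (V i)) - P (Complex c v0))"
      by (simp only:)
    then show ?thesis
      by (simp only: diff_eq_eq)
  qed
  have P0: "(\<lambda>i. P (Complex c (V i))) \<longlonglongrightarrow> 0"
  proof (rule Lim_null_comparison)
    have "((\<lambda>v. exp (b * c) / (\<bar>b\<bar> * v)) \<longlongrightarrow> 0) at_top"
      using b by real_asymp
    then show "(\<lambda>i. exp (b * c) / (\<bar>b\<bar> * V i)) \<longlonglongrightarrow> 0"
      using V by (rule filterlim_compose)
    have "\<forall>\<^sub>F i in sequentially. v0 \<le> V i"
      using V by (simp add: filterlim_at_top)
    then show "\<forall>\<^sub>F i in sequentially. norm (P (Complex c (V i))) \<le> exp (b * c) /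
        (\<bar>b\<bar> * V i)"
    proof eventually_elim
      case (elim i)
      have "norm (P (Complex c (V i))) = exp (b * c) / (\<bar>b\<bar> * norm (Complex c (V i)))"
        by (simp add: P_def norm_divide norm_mult norm_gexp)
      also have "\<dots> \<le> exp (b * c) / (\<bar>b\<bar> * V i)"
        using elim v0 b abs_Im_le_cmod[of "Complex c (V i)"]
        by (intro divide_left_mono mult_left_mono mult_pos_pos) (auto simp: nz)
      finally show ?case .
    qed
  qed
  have "(\<lambda>i. ?I 2 i) \<longlonglongrightarrow> (LBINT v. indicator {v0..} v *\<^sub>R ?f 2 v)"
    by (rule tendsto_integral_Icc[OF integrable_line_power[OF v0] V]) simp
  then have "(\<lambda>i. - \<i> * (P (Complex c (V i)) - P (Complex c v0)) + 1 / of_real b * ?I 2 i)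
      \<longlonglongrightarrow>
      - \<i> * (0 - P (Complex c v0)) + 1 / of_real b * (LBINT v. indicator {v0..} v *\<^sub>R ?f 2 v)"
    by (intro tendsto_add tendsto_mult tendsto_diff tendsto_const P0)
  moreover have "\<forall>\<^sub>F i in sequentially. - \<i> * (P (Complex c (V i)) - P (Complex c v0)) + 1 /
      of_real b * ?I 2 i = ?I 1 i"
  proof -
    have "\<forall>\<^sub>F i in sequentially. v0 \<le> V i"
      using V by (simp add: filterlim_at_top)
    then show ?thesis
      by eventually_elim (rule eq[symmetric])
  qed
  ultimately have "(\<lambda>i. ?I 1 i) \<longlonglongrightarrow> - \<i> * (0 - P (Complex c v0)) + 1 / of_real
      b * (LBINT v. indicator {v0..} v *\<^sub>R ?f 2 v)"
    by (rule Lim_transform_eventually)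
  then show ?thesis
    unfolding k1 by (rule convergentI)
qed

lemma gexp_cnj: "gexp b \<sigma> (cnj u) = cnj (gexp b \<sigma> u)"
  by (simp add: gexp_def exp_cnj)

text \<open>The integrand commutes with conjugation, so reflecting v conjugates the
  integral.\<close>

lemma convergent_line_integral_neg:
  fixes c b v0 :: real
  assumes v0: "0 < v0" and k: "1 \<le> k" "b \<noteq> 0 \<or> 2 \<le> k" and V: "filterlim V at_top sequentially"
  shows "convergent (\<lambda>i. LBINT v. indicator {- V i..- v0} v *\<^sub>R (gexp b 0 (Complex c v) / Complex
      c v ^ k))"
proof -
  let ?f = "\<lambda>v. gexp b 0 (Complex c v) / Complex c v ^ k"
  have eq: "(LBINT v. indicator {- V i..- v0} v *\<^sub>R ?f v) = cnj (LBINT v. indicator {v0..V i} v *\<^sub>R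
      ?f v)" for i
  proof -
    have c: "Complex c (- v) = cnj (Complex c v)" for v
      by (simp add: complex_eq_iff)
    have "(LBINT v. indicator {- V i..- v0} v *\<^sub>R ?f v) = (LBINT v. indicator {- V i..- v0} (0 + (- 1) *
        v) *\<^sub>R ?f (0 + (- 1) * v))"
      by (subst lborel_integral_real_affine[where c="-1" and t=0]) simp_all
    also have "\<dots> = (LBINT v. cnj (indicator {v0..V i} v *\<^sub>R ?f v))"
      by (intro Bochner_Integration.integral_cong) (auto simp: c gexp_cnj indicator_def)
    also have "\<dots> = cnj (LBINT v. indicator {v0..V i} v *\<^sub>R ?f v)"
      by (rule Bochner_Integration.integral_cnj)
    finally show ?thesis .
  qed
  obtain l where "(\<lambda>i. LBINT v. indicator {v0..V i} v *\<^sub>R ?f v) \<longlonglongrightarrow> l"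
    using convergent_line_integral[OF assms, of c] by (auto simp: convergent_def)
  then have "(\<lambda>i. cnj (LBINT v. indicator {v0..V i} v *\<^sub>R ?f v)) \<longlonglongrightarrow> cnj l"
    by (rule tendsto_cnj)
  then show ?thesis
    unfolding eq by (rule convergentI)
qed

text \<open>Summation by parts against the remainders R of the convergent series, which are bounded
  and tend to 0.\<close>

lemma Abel_limit:
  fixes a :: "nat \<Rightarrow> real"
  assumes a: "summable a" and r: "\<And>i. 0 < r i" "\<And>i. r i < 1" and lim: "r \<longlonglongrightarrow> 1"
  shows "(\<lambda>i. \<Sum>j. a j * r i ^ j) \<longlonglongrightarrow> suminf a"
proof -
  define R where "R = (\<lambda>j. suminf a - (\<Sum>i<j. a i))"
  have R0: "R \<longlonglongrightarrow> 0"
    using tendsto_diff[OF tendsto_const summable_LIMSEQ[OF a], of "suminf a"] by (simp add: R_def)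
  have aR: "a j = R j - R (Suc j)" for j
    by (simp add: R_def)
  obtain C where C: "0 < C" "\<And>j. \<bar>R j\<bar> \<le> C"
    using Bseq_def[of R] convergent_imp_Bseq[OF convergentI[OF R0]] by auto
  have sR: "summable (\<lambda>j. \<bar>R (m + j)\<bar> * q ^ j)" if q: "0 < q" "q < 1" for q m
  proof (rule summable_comparison_test')
    show "summable (\<lambda>j. C * q ^ j)"
      using q by (intro summable_mult summable_geometric) auto
    show "norm (\<bar>R (m + j)\<bar> * q ^ j) \<le> C * q ^ j" for j
      using q C by (simp add: abs_mult mult_right_mono)
  qed
  have sR': "summable (\<lambda>j. R (m + j) * q ^ j)" if q: "0 < q" "q < 1" for q m
    by (rule summable_rabs_cancel) (use sR[OF q, of m] q in \<open>simp add: abs_mult\<close>)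
  \<comment> \<open>Writing a j = R j - R (j + 1) and shifting the index produces the factor 1 -
    q.\<close>
  have eq: "(\<Sum>j. a j * q ^ j) = suminf a - (1 - q) * (\<Sum>j. R (Suc j) * q ^ j)" if q: "0 < q" "q < 1" for q
  proof -
    have s1: "summable (\<lambda>j. R (Suc j) * q ^ j)"
      using sR'[OF q, of 1] by simp
    have s0: "summable (\<lambda>j. R j * q ^ j)"
      using sR'[OF q, of 0] by simp
    have "(\<Sum>j. a j * q ^ j) = (\<Sum>j. R j * q ^ j) - (\<Sum>j. R (Suc j) * q ^ j)"
      unfolding suminf_diff[OF s0 s1] aR by (simp add: left_diff_distrib)
    also have "(\<Sum>j. R j * q ^ j) = R 0 + (\<Sum>j. R (Suc j) * q ^ Suc j)"
      using suminf_split_head[OF s0] by simp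
    also have "(\<Sum>j. R (Suc j) * q ^ Suc j) = q * (\<Sum>j. R (Suc j) * q ^ j)"
      unfolding suminf_mult[OF s1, symmetric] by (simp add: mult_ac)
    finally show ?thesis
      by (simp add: R_def algebra_simps)
  qed
  have "(\<lambda>i. (1 - r i) * (\<Sum>j. R (Suc j) * r i ^ j)) \<longlonglongrightarrow> 0"
  proof (rule LIMSEQ_I)
    fix e :: real assume e: "0 < e"
    obtain J where J: "\<And>j. J \<le> j \<Longrightarrow> \<bar>R j\<bar> < e / 2"
      using LIMSEQ_D[OF R0, of "e / 2"] e by auto
    \<comment> \<open>The small remainders contribute at most e / 2 against the geometric series;
      the first J ones are bounded by C and disappear with 1 - q.\<close>
    have bound: "\<bar>(1 - q) * (\<Sum>j. R (Suc j) * q ^ j)\<bar> \<le> e / 2 + (1 - q) * (C * real J)" if q: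
        "0 < q" "q < 1" for q
    proof -
      have s1: "summable (\<lambda>j. \<bar>R (Suc j)\<bar> * q ^ j)"
        using sR[OF q, of 1] by simp
      have fin: "(\<lambda>j. if j < J then C else 0) sums (\<Sum>j<J. C)"
        using sums_If_finite[of "\<lambda>j. j < J" "\<lambda>_. C"] by (simp add: lessThan_def)
      have g: "(\<lambda>j. e / 2 * q ^ j) sums (e / 2 * (1 / (1 - q)))"
        using q by (intro sums_mult geometric_sums) auto
      have "\<bar>\<Sum>j. R (Suc j) * q ^ j\<bar> \<le> (\<Sum>j. \<bar>R (Suc j)\<bar> * q ^ j)"
        using summable_rabs[of "\<lambda>j. R (Suc j) * q ^ j"] s1 q by (simp add: abs_mult)
      also have "\<dots> \<le> (\<Sum>j. e / 2 * q ^ j + (if j < J then C else 0))"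
      proof (rule suminf_le[OF _ s1 sums_summable[OF sums_add[OF g fin]]])
        fix j
        show "\<bar>R (Suc j)\<bar> * q ^ j \<le> e / 2 * q ^ j + (if j < J then C else 0)"
        proof (cases "j < J")
          case True
          have "\<bar>R (Suc j)\<bar> * q ^ j \<le> C * 1"
            using C q by (intro mult_mono) (auto intro: power_le_one)
          then show ?thesis
            using True e q by (simp add: add_increasing)
        next
          case False
          then have "\<bar>R (Suc j)\<bar> \<le> e / 2"
            using J[of "Suc j"] by auto
          then show ?thesis
            using False q by (simp add: mult_right_mono)
        qed
      qed
      also have "\<dots> = e / 2 * (1 / (1 - q)) + (\<Sum>j<J. C)"
        using sums_unique[OF sums_add[OF g fin]] by simp
      finally have "(1 - q) * \<bar>\<Sum>j. R (Suc j) * q ^ j\<bar> \<le> (1 - q) * (e / 2 * (1 / (1 - q)) + C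
          * real J)"
        using q by (intro mult_left_mono) (auto simp: mult.commute)
      also have "\<dots> = e / 2 + (1 - q) * (C * real J)"
      proof -
        have *: "d * (x * (1 / d) + y) = x + d * y" if "d \<noteq> 0" for d x y :: real
          using that by (simp add: distrib_left)
        show ?thesis
          by (rule *) (use q in auto)
      qed
      finally show ?thesis
        using q by (simp add: abs_mult)
    qed
    have "(\<lambda>i. e / 2 + (1 - r i) * (C * real J)) \<longlonglongrightarrow> e / 2 + (1 - 1) * (C * real J)"
      by (intro tendsto_intros lim)
    then have "\<forall>\<^sub>F i in sequentially. e / 2 + (1 - r i) * (C * real J) < e"
      by (rule order_tendstoD(2)) (use e in simp)
    then obtain i0 where i0: "\<And>i. i0 \<le> i \<Longrightarrow> e / 2 + (1 - r i) * (C * real J) < e"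
      by (auto simp: eventually_sequentially)
    show "\<exists>no. \<forall>n\<ge>no. norm ((1 - r n) * (\<Sum>j. R (Suc j) * r n ^ j) - 0) < e"
    proof (intro exI allI impI)
      fix i assume "i0 \<le> i"
      then show "norm ((1 - r i) * (\<Sum>j. R (Suc j) * r i ^ j) - 0) < e"
        using bound[OF r, of i] i0[of i] by simp
    qed
  qed
  then have "(\<lambda>i. suminf a - (1 - r i) * (\<Sum>j. R (Suc j) * r i ^ j)) \<longlonglongrightarrow>
      suminf a - 0"
    by (intro tendsto_diff tendsto_const)
  then show ?thesis
    using eq[OF r] by simp
qed

section \<open>Remainders for a growing truncation degree\<close>

lemma hcoeff_scale: "hcoeff X r j = r ^ j * hcoeff X 1 j"
  by (simp add: hcoeff_def)

lemma hgen_scale: "hgen X 1 (of_real r * u) = hgen X r u"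
  by (simp add: hgen_def power_mult_distrib mult_ac)

lemma gexp_scale: "gexp (- 2 * X' * 1) (2 * 1\<^sup>2) (of_real r * u) = gexp (- 2 * X' * r) (2 * r\<^sup>2) u"
  by (simp add: gexp_def power_mult_distrib mult_ac)

text \<open>Completing the square in cos \<theta>; the centre X / (2 r) is the abscissa of the line
  Re w = X / 2 after division by r.\<close>

lemma norm_hgen_cis:
  assumes r: "0 < r"
  shows "norm (hgen X r (cis \<theta>)) = exp (X\<^sup>2 / 2 + r\<^sup>2) * exp (- (2 * r\<^sup>2 * (cos
      \<theta> - X / (2 * r))\<^sup>2))"
proof -
  have "Re ((cis \<theta>)\<^sup>2) = 2 * (cos \<theta>)\<^sup>2 - 1"
    by (simp add: Re_power2 sin_squared_eq)
  moreover have "Re (2 * of_real y * z - of_real q * w) = 2 * y * Re z - q * Re w" for y q z w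
    by simp
  ultimately have "norm (hgen X r (cis \<theta>)) = exp (2 * (X * r) * cos \<theta> - r\<^sup>2 * (2 * (cos
      \<theta>)\<^sup>2 - 1))"
    unfolding hgen_def norm_exp_eq_Re by simp
  also have "2 * (X * r) * cos \<theta> - r\<^sup>2 * (2 * (cos \<theta>)\<^sup>2 - 1) = X\<^sup>2 / 2 +
      r\<^sup>2 - 2 * r\<^sup>2 * (cos \<theta> - X / (2 * r))\<^sup>2"
    using r by (simp add: power2_eq_square field_simps)
  finally show ?thesis
    by (simp flip: exp_add)
qed

text \<open>The relation M = 2 r^2 puts the maximum of q^M exp (- r^2 q^2) at q = 1, on the
  circle.\<close>

lemma norm_power_gexp_scaled_le:
  fixes X X' r v :: real
  assumes r: "0 < r" "real M = 2 * r\<^sup>2" and k: "k < M"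
  defines "\<alpha> \<equiv> X / (2 * r)"
  shows "norm (Complex \<alpha> v ^ (M - k) * gexp (- 2 * X' * r) (2 * r\<^sup>2) (Complex \<alpha> v)) \<le>
    exp (real k - r\<^sup>2 + X\<^sup>2 / 2 - X * X') * exp (- (r\<^sup>2 * (norm (Complex \<alpha> v) - 1)\<^sup>2))"
proof -
  define q where "q = norm (Complex \<alpha> v)"
  have q: "0 \<le> q" and v2: "v\<^sup>2 = q\<^sup>2 - \<alpha>\<^sup>2"
    by (auto simp: q_def cmod_power2)
  have r\<alpha>: "r * \<alpha> = X / 2"
    using r by (simp add: \<alpha>_def)
  have "norm (Complex \<alpha> v ^ (M - k) * gexp (- 2 * X' * r) (2 * r\<^sup>2) (Complex \<alpha> v)) =
      q ^ (M - k) * exp (- 2 * X' * (r * \<alpha>) + 2 * (r * \<alpha>)\<^sup>2 - r\<^sup>2 * q\<^sup>2)"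
    unfolding norm_mult norm_power norm_gexp q_def[symmetric] v2
    by (simp add: power2_eq_square algebra_simps)
  also have "\<dots> \<le> exp (real (M - k) * (q - 1)) * exp (- 2 * X' * (r * \<alpha>) + 2 * (r *
      \<alpha>)\<^sup>2 - r\<^sup>2 * q\<^sup>2)"
    using q by (intro mult_right_mono power_le_exp) auto
  also have "\<dots> = exp (2 * r\<^sup>2 * (q - 1) - real k * (q - 1) - X * X' + X\<^sup>2 / 2 - r\<^sup>2 *
      q\<^sup>2)"
  proof -
    have Mk: "real (M - k) = 2 * r\<^sup>2 - real k"
      using k r(2) by (simp add: of_nat_diff)
    show ?thesis
      unfolding Mk r\<alpha> exp_add[symmetric] by (intro arg_cong[where f=exp]) (simp add: power2_eq_square
          algebra_simps)
  qed
  also have "\<dots> \<le> exp (real k - r\<^sup>2 + X\<^sup>2 / 2 - X * X' - r\<^sup>2 * (q - 1)\<^sup>2)"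
  proof -
    have "0 \<le> real k * q"
      using q by simp
    then show ?thesis
      by (simp add: power2_eq_square algebra_simps)
  qed
  also have "\<dots> = exp (real k - r\<^sup>2 + X\<^sup>2 / 2 - X * X') * exp (- (r\<^sup>2 * (q - 1)\<^sup>2))"
    unfolding exp_add[symmetric] by simp
  finally show ?thesis
    by (simp only: q_def)
qed

text \<open>The remainder after truncation at degree \<open>M\<close>, cut off at the radius \<open>sqrt (M /
  2)\<close> where the two Gaussian factors balance. The line \<open>Re w = X / 2\<close> passes through
  the corresponding points for every \<open>M\<close>.\<close>

definition htail :: "real \<Rightarrow> real \<Rightarrow> nat \<Rightarrow> nat \<Rightarrow> real
    \<Rightarrow> complex" where
  "htail X X' k M v = (let w = Complex (X / 2) v in
     if w = 0 then 0 else gexp (- 2 * X' * 1) (2 * 1\<^sup>2) w *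
       ((\<Sum>j<M. of_real (hcoeff X 1 j) * w ^ j) - (if norm w < sqrt (real M / 2) then hgen X 1 w else 0)) /
           w ^ k)"

lemma hgen_measurable [measurable (raw)]:
  "f \<in> borel_measurable M \<Longrightarrow> (\<lambda>x. hgen X \<rho> (f x)) \<in> borel_measurable M"
  unfolding hgen_eq_gexp by measurable

lemma htail_measurable [measurable]: "htail X X' k M \<in> borel_measurable borel"
  unfolding htail_def[abs_def] Let_def by measurable

text \<open>With r = sqrt (M / 2) the substitution r v brings the cut-off radius to 1 and the
  abscissa to X / (2 r), at most 1/2 in modulus, whence \<delta> = 1/2. The Jacobian r cancels 1 /
  sqrt (r^2), and w^k leaves r^(- k).\<close>

lemma htail_integral:
  assumes k: "k < M" and X: "\<bar>X\<bar> \<le> sqrt (real M / 2)"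
  shows "integrable lborel (htail X X' k M)"
    and "norm (LBINT v. htail X X' k M v) \<le>
      exp (X\<^sup>2 + real k - X * X') * (64 * skern_int\<^sup>2 / pi) / sqrt (real M / 2) ^ k"
proof -
  define r where "r = sqrt (real M / 2)"
  define \<alpha> where "\<alpha> = X / (2 * r)"
  have r: "0 < r" "real M = 2 * r\<^sup>2"
    using k by (auto simp: r_def)
  have \<alpha>: "\<bar>\<alpha>\<bar> \<le> 1 - 1 / 2"
    using X r by (simp add: \<alpha>_def r_def[symmetric] abs_mult field_simps)
  have w: "Complex (X / 2) (0 + r * v) = of_real r * Complex \<alpha> v" for v
    using r by (simp add: complex_eq_iff \<alpha>_def)
  define E where "E = (\<lambda>v. htail X X' k M (0 + r * v))"
  define Q where "Q = (\<lambda>v. (1 / r ^ k) *\<^sub>R (Complex \<alpha> v ^ (M - k) * gexp (- 2 * X' * r) (2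
      * r\<^sup>2) (Complex \<alpha> v)))"
  have E: "E v = Q v * ctail (hgen X r) M (Complex \<alpha> v)" if ne: "norm (Complex \<alpha> v) \<noteq> 1" for v
  proof (cases "Complex \<alpha> v = 0")
    \<comment> \<open>At w = 0 \<open>htail\<close> is 0 by definition, and Q v = 0 because M - k >
      0.\<close>
    case True
    then show ?thesis
      unfolding E_def htail_def Let_def w Q_def using k by simp
  next
    case False
    let ?u = "Complex \<alpha> v"
    have "(\<Sum>j<M. of_real (hcoeff X 1 j) * (of_real r * ?u) ^ j) = (\<Sum>j<M. of_real (hcoeff X r j) * ?u ^ j)"
      by (intro sum.cong refl) (simp add: hcoeff_scale[of X r] power_mult_distrib)
    moreover have "norm (of_real r * ?u) < r \<longleftrightarrow> norm ?u < 1"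
      using r by (simp add: norm_mult)
    ultimately have "E v = gexp (- 2 * X' * r) (2 * r\<^sup>2) ?u * (?u ^ M * ctail (hgen X r) M ?u) / (of_real
        r * ?u) ^ k"
      using False r unfolding E_def htail_def Let_def w gexp_scale hgen_scale r_def[symmetric]
          hgen_sum_eq_ctail[OF ne] by simp
    also have "?u ^ M = ?u ^ (M - k) * ?u ^ k"
      using k by (simp flip: power_add)
    finally show ?thesis
      using False r by (simp add: Q_def scaleR_conv_of_real power_mult_distrib field_simps)
  qed
  have Q: "norm (Q v) \<le> 1 / r ^ k * exp (real k - r\<^sup>2 + X\<^sup>2 / 2 - X * X') * exp (- (r\<^sup>2 *
      (norm (Complex \<alpha> v) - 1)\<^sup>2))" for v
    using norm_power_gexp_scaled_le[OF r k, of X v X'] r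
    unfolding Q_def norm_scaleR \<alpha>_def[symmetric] by (simp add: mult.assoc divide_right_mono)
  have F: "norm (hgen X r (cis \<theta>)) \<le> exp (X\<^sup>2 / 2 + r\<^sup>2) * exp (- (r\<^sup>2 * (cos
      \<theta> - \<alpha>)\<^sup>2))" for \<theta>
    unfolding norm_hgen_cis[OF r(1)] \<alpha>_def[symmetric] by (intro mult_left_mono) (auto simp: mult_right_mono)
  have r2: "0 < r\<^sup>2" "(0::real) < 1 / 2"
    using r by auto
  note bd = norm_integral_ctail_le[OF hgen_holomorphic r2 \<alpha> F E Q]
  have int: "integrable lborel E"
    by (rule bd(2)) (unfold E_def, measurable)
  then show hi: "integrable lborel (htail X X' k M)"
    unfolding E_def using lborel_integrable_real_affine_iff[of r "htail X X' k M" 0] r by simp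
  have "(LBINT v. htail X X' k M v) = \<bar>r\<bar> *\<^sub>R (LBINT v. E v)"
    unfolding E_def using r by (intro lborel_integral_real_affine) auto
  then have "norm (LBINT v. htail X X' k M v) = r * norm (LBINT v. E v)"
    using r by simp
  also have "\<dots> \<le> r * (exp (X\<^sup>2 / 2 + r\<^sup>2) * (1 / r ^ k * exp (real k - r\<^sup>2 +
      X\<^sup>2 / 2 - X * X')) * (32 * skern_int\<^sup>2 / (pi * (1 / 2))) / sqrt (r\<^sup>2))"
    using r by (intro mult_left_mono bd(1)) auto
  also have "\<dots> = (exp (X\<^sup>2 / 2 + r\<^sup>2) * exp (real k - r\<^sup>2 + X\<^sup>2 / 2 - X * X')) *
      (64 * skern_int\<^sup>2 / pi) / r ^ k"
    using r by (simp add: field_simps)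
  also have "exp (X\<^sup>2 / 2 + r\<^sup>2) * exp (real k - r\<^sup>2 + X\<^sup>2 / 2 - X * X') = exp
      (X\<^sup>2 + real k - X * X')"
    by (simp flip: exp_add)
  finally show "norm (LBINT v. htail X X' k M v) \<le>
      exp (X\<^sup>2 + real k - X * X') * (64 * skern_int\<^sup>2 / pi) / sqrt (real M / 2) ^ k"
    by (simp add: r_def)
qed

text \<open>The bound decays like (m + L)^(- k / 2), so a strictly positive level difference k is
  what drives it to 0.\<close>

lemma htail_tendsto_0:
  assumes "1 \<le> k"
  shows "(\<lambda>L. LBINT v. htail X X' k (m + L) v) \<longlonglongrightarrow> 0"
proof (rule Lim_null_comparison)
  have lim: "filterlim (\<lambda>L. sqrt (real (m + L) / 2)) at_top sequentially"
    by real_asymp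
  have "filterlim (\<lambda>L. sqrt (real (m + L) / 2) ^ k) at_top sequentially"
    using assms by (intro filterlim_pow_at_top lim) auto
  then show "(\<lambda>L. exp (X\<^sup>2 + real k - X * X') * (64 * skern_int\<^sup>2 / pi) / sqrt (real (m +
      L) / 2) ^ k) \<longlonglongrightarrow> 0"
    by (rule tendsto_divide_0[OF tendsto_const filterlim_at_top_imp_at_infinity])
  have "\<forall>\<^sub>F L in sequentially. \<bar>X\<bar> \<le> sqrt (real (m + L) / 2)"
    using lim by (simp add: filterlim_at_top)
  then show "\<forall>\<^sub>F L in sequentially. norm (LBINT v. htail X X' k (m + L) v) \<le>
      exp (X\<^sup>2 + real k - X * X') * (64 * skern_int\<^sup>2 / pi) / sqrt (real (m + L) / 2) ^ k"
    using eventually_gt_at_top[of k]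
    by eventually_elim (rule htail_integral(2), auto)
qed

text \<open>A partial sum is the remainder at its top degree minus that at its bottom degree plus an
  integral over the line between the two cut-off radii. There the quadratic exponents of weight and
  generating function cancel, leaving a pure oscillation over w^k. X^2 < p makes the line leave the
  first disc at a height V 0 > 0, away from the pole.\<close>

lemma convergent_hermite_series:
  fixes X X' :: real and p k :: nat
  assumes k: "1 \<le> k" "X \<noteq> X' \<or> 2 \<le> k" and p: "X\<^sup>2 < real p"
  defines "G \<equiv> gexp (- 2 * X' * 1) (2 * 1\<^sup>2)"
  shows "summable (\<lambda>j. of_real (hcoeff X 1 (p + k + j)) * (LBINT v. Complex (X / 2) v ^ (p + j) * G
      (Complex (X / 2) v)))"
proof -
  define m where "m = p + k"
  define c where "c = X / 2"
  define b where "b = 2 * (X - X')"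
  let ?w = "Complex c"
  let ?f = "\<lambda>v. gexp b 0 (?w v) / ?w v ^ k"
  define V where "V = (\<lambda>L. sqrt (real (m + L) / 2 - c\<^sup>2))"
  have c2: "c\<^sup>2 < real (m + L) / 2" for L
    using p zero_le_power2[of X] by (simp add: c_def m_def power_divide)
  have V0: "0 < V L" for L
    using c2 by (simp add: V_def)
  have Vmono: "V 0 \<le> V L" for L
    by (simp add: V_def)
  have norm_w: "norm (?w v) < sqrt (real (m + L) / 2) \<longleftrightarrow> \<bar>v\<bar> < V L" for v L
  proof -
    have "norm (?w v) < sqrt (real (m + L) / 2) \<longleftrightarrow> c\<^sup>2 + v\<^sup>2 < real (m + L) / 2"
      by (simp add: cmod_def)
    also have "\<dots> \<longleftrightarrow> v\<^sup>2 < real (m + L) / 2 - c\<^sup>2"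
      by linarith
    also have "\<dots> \<longleftrightarrow> \<bar>v\<bar> < V L"
      unfolding V_def by (metis real_sqrt_abs real_sqrt_less_iff)
    finally show ?thesis .
  qed
  have Vlim: "filterlim V at_top sequentially"
    unfolding V_def by real_asymp
  let ?P = "\<lambda>L v. \<Sum>j<L. of_real (hcoeff X 1 (p + k + j)) * (?w v ^ (p + j) * G (?w v))"
  let ?A = "\<lambda>L v. indicator {V 0..V L} v *\<^sub>R ?f v + indicator {- V L..- V 0} v *\<^sub>R ?f v"
  have int: "integrable lborel (\<lambda>v. ?w v ^ j * G (?w v))" for j
    unfolding G_def by (intro integrable_power_gexp) auto
  have Pi: "integrable lborel (?P L)" for L
    by (intro Bochner_Integration.integrable_sum integrable_mult_right int)
  have cont: "continuous_on T ?f" if "0 \<notin> T" for T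
  proof -
    have "?w v \<noteq> 0" if "v \<in> T" for v
      using that \<open>0 \<notin> T\<close> by (auto simp: complex_eq_iff)
    then show ?thesis
      by (intro continuous_intros) auto
  qed
  have A1: "integrable lborel (\<lambda>v. indicator {V 0..V L} v *\<^sub>R ?f v)" for L
    using borel_integrable_atLeastAtMost'[OF cont, of "V 0" "V L"] V0[of 0] by (auto simp: set_integrable_def)
  have A2: "integrable lborel (\<lambda>v. indicator {- V L..- V 0} v *\<^sub>R ?f v)" for L
    using borel_integrable_atLeastAtMost'[OF cont, of "- V L" "- V 0"] V0[of 0] by (auto simp: set_integrable_def)
  have Ai: "integrable lborel (?A L)" for L
    by (intro Bochner_Integration.integrable_add A1 A2)
  \<comment> \<open>The cut-offs of the two remainders differ exactly on the annulus described by
    \<open>?A L\<close>; the excluded v are the pole height and the radii.\<close>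
  have decomp: "?P L v = htail X X' k (m + L) v - htail X X' k m v + ?A L v"
    if v: "v \<noteq> 0" "\<bar>v\<bar> \<noteq> V 0" "\<bar>v\<bar> \<noteq> V L" for L v
  proof -
    let ?T = "\<lambda>M. \<Sum>j<M. of_real (hcoeff X 1 j) * ?w v ^ j"
    let ?F = "hgen X 1 (?w v)"
    have w0: "?w v \<noteq> 0"
      using v by (auto simp: complex_eq_iff)
    have T: "?T (m + L) - ?T m = (\<Sum>j<L. of_real (hcoeff X 1 (m + j)) * ?w v ^ (m + j))"
    proof -
      have "?T (m + L) = ?T m + (\<Sum>j<L. of_real (hcoeff X 1 (m + j)) * ?w v ^ (m + j))"
        by (induction L) (simp_all add: algebra_simps)
      then show ?thesis by simp
    qed
    have "?P L v = G (?w v) * (\<Sum>j<L. of_real (hcoeff X 1 (m + j)) * ?w v ^ (p + j))"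
      by (simp add: sum_distrib_left m_def mult_ac)
    also have "(\<Sum>j<L. of_real (hcoeff X 1 (m + j)) * ?w v ^ (p + j)) = (\<Sum>j<L. of_real (hcoeff X 1 (m
        + j)) * ?w v ^ (m + j)) / ?w v ^ k"
      unfolding sum_divide_distrib using w0 by (intro sum.cong refl) (simp add: m_def power_add)
    also have "G (?w v) * ((\<Sum>j<L. of_real (hcoeff X 1 (m + j)) * ?w v ^ (m + j)) / ?w v ^ k) = G (?w v) *
        (?T (m + L) - ?T m) / ?w v ^ k"
      unfolding T by simp
    finally have P: "?P L v = G (?w v) * (?T (m + L) - ?T m) / ?w v ^ k" .
    have h: "htail X X' k (m + L) v = G (?w v) * (?T (m + L) - (if \<bar>v\<bar> < V L then ?F else 0)) / ?w v
        ^ k" for L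
      unfolding htail_def Let_def c_def[symmetric] G_def[symmetric] norm_w using w0 by simp
    have GF: "G (?w v) * ?F = gexp b 0 (?w v)"
      by (simp add: G_def hgen_eq_gexp gexp_mult b_def algebra_simps)
    have A: "?A L v = G (?w v) * ((if \<bar>v\<bar> < V L then ?F else 0) - (if \<bar>v\<bar> < V 0 then ?F
        else 0)) / ?w v ^ k"
      using v Vmono[of L] V0[of 0] by (auto simp: GF indicator_def abs_if split: if_splits)
    show ?thesis
      unfolding P h[of L] h[of 0, simplified] A
      by (simp add: algebra_simps diff_divide_distrib add_divide_distrib)
  qed
  have "eventually (\<lambda>L. k < m + L \<and> \<bar>X\<bar> \<le> sqrt (real (m + L) / 2)) sequentially"
  proof (rule eventually_conj)
    show "\<forall>\<^sub>F L in sequentially. k < m + L"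
      using eventually_gt_at_top[of k] by eventually_elim simp
    have "filterlim (\<lambda>L. sqrt (real (m + L) / 2)) at_top sequentially"
      by real_asymp
    then show "\<forall>\<^sub>F L in sequentially. \<bar>X\<bar> \<le> sqrt (real (m + L) / 2)"
      by (simp add: filterlim_at_top)
  qed
  then have ev: "\<forall>\<^sub>F L in sequentially. integrable lborel (htail X X' k (m + L))"
    by eventually_elim (rule htail_integral(1), auto)
  have ae: "AE v in lborel. ?P L v = htail X X' k (m + L) v - htail X X' k m v + ?A L v" for L
  proof -
    have "AE v in lborel. v \<noteq> 0" "AE v in lborel. v \<noteq> V 0" "AE v in lborel. v \<noteq> - V 0" "AE
        v in lborel. v \<noteq> V L" "AE v in lborel. v \<noteq> - V L"
      by (rule AE_lborel_singleton)+
    then show ?thesis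
      by eventually_elim (rule decomp, auto simp: abs_if split: if_splits)
  qed
  \<comment> \<open>\<open>htail_integral\<close> requires a degree that is large compared with k
    and X; at degree m integrability is read off from the decomposition for one large L.\<close>
  have mi: "integrable lborel (htail X X' k m)"
  proof -
    obtain L where L: "integrable lborel (htail X X' k (m + L))"
      using ev by (auto simp: eventually_sequentially)
    have i: "integrable lborel (\<lambda>v. htail X X' k (m + L) v + ?A L v - ?P L v)"
      by (intro Bochner_Integration.integrable_diff Bochner_Integration.integrable_add[OF L] Ai Pi)
    show ?thesis
    proof (rule integrable_cong_AE_imp[OF i])
      show "AE v in lborel. htail X X' k (m + L) v + ?A L v - ?P L v = htail X X' k m v"
        using ae[of L] by eventually_elim simp
    qed simp
  qed
  have S: "(\<Sum>j<L. of_real (hcoeff X 1 (p + k + j)) * (LBINT v. ?w v ^ (p + j) * G (?w v))) =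
      (LBINT v. htail X X' k (m + L) v) - (LBINT v. htail X X' k m v) +
      ((LBINT v. indicator {V 0..V L} v *\<^sub>R ?f v) + (LBINT v. indicator {- V L..- V 0} v *\<^sub>R ?f v))"
    if L: "integrable lborel (htail X X' k (m + L))" for L
  proof -
    have "(\<Sum>j<L. of_real (hcoeff X 1 (p + k + j)) * (LBINT v. ?w v ^ (p + j) * G (?w v))) = (LBINT v. ?P L v)"
      by (subst Bochner_Integration.integral_sum) (auto intro: int)
    also have "\<dots> = (LBINT v. htail X X' k (m + L) v - htail X X' k m v + ?A L v)"
      using Pi[of L] Ai[of L] by (intro integral_cong_AE ae borel_measurable_add borel_measurable_diff
          htail_measurable) (auto dest: borel_measurable_integrable)
    also have "\<dots> = (LBINT v. htail X X' k (m + L) v) - (LBINT v. htail X X' k m v) +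
      ((LBINT v. indicator {V 0..V L} v *\<^sub>R ?f v) + (LBINT v. indicator {- V L..- V 0} v *\<^sub>R ?f v))"
      unfolding Bochner_Integration.integral_add[OF Bochner_Integration.integrable_diff[OF L mi] Ai]
        Bochner_Integration.integral_diff[OF L mi] Bochner_Integration.integral_add[OF A1 A2] ..
    finally show ?thesis .
  qed
  have bk: "b \<noteq> 0 \<or> 2 \<le> k"
    using k by (auto simp: b_def)
  obtain l1 where l1: "(\<lambda>L. LBINT v. indicator {V 0..V L} v *\<^sub>R ?f v) \<longlonglongrightarrow> l1"
    using convergent_line_integral[OF V0[of 0] k(1) bk Vlim, of c] unfolding convergent_def by blast
  obtain l2 where l2: "(\<lambda>L. LBINT v. indicator {- V L..- V 0} v *\<^sub>R ?f v) \<longlonglongrightarrow> l2"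
    using convergent_line_integral_neg[OF V0[of 0] k(1) bk Vlim, of c] unfolding convergent_def by blast
  have "(\<lambda>L. (LBINT v. htail X X' k (m + L) v) - (LBINT v. htail X X' k m v) +
      ((LBINT v. indicator {V 0..V L} v *\<^sub>R ?f v) + (LBINT v. indicator {- V L..- V 0} v *\<^sub>R ?f
          v))) \<longlonglongrightarrow>
      0 - (LBINT v. htail X X' k m v) + (l1 + l2)"
    by (intro tendsto_add tendsto_diff tendsto_const htail_tendsto_0 k l1 l2)
  then have "(\<lambda>L. \<Sum>j<L. of_real (hcoeff X 1 (p + k + j)) * (LBINT v. ?w v ^ (p + j) * G (?w v)))
      \<longlonglongrightarrow>
      0 - (LBINT v. htail X X' k m v) + (l1 + l2)"
  proof (rule Lim_transform_eventually)
    show "\<forall>\<^sub>F L in sequentially. (LBINT v. htail X X' k (m + L) v) - (LBINT v. htail X X' k m v) +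
      ((LBINT v. indicator {V 0..V L} v *\<^sub>R ?f v) + (LBINT v. indicator {- V L..- V 0} v *\<^sub>R ?f v)) =
      (\<Sum>j<L. of_real (hcoeff X 1 (p + k + j)) * (LBINT v. ?w v ^ (p + j) * G (?w v)))"
      using ev by eventually_elim (rule S[symmetric])
  qed
  then show ?thesis
    unfolding c_def by (rule sums_summable[unfolded sums_def])
qed

section \<open>The limit of vanishing time difference\<close>

text \<open>The excluded case is the jump: for n = n' + 1 and X = X' the half-line integrals of 1 /
  w have no oscillation to make them converge.\<close>

lemma summable_DBM_term:
  assumes n: "n' < n" "2 \<le> n'" and X: "X \<noteq> X' \<or> n \<noteq> n' + 1"
  shows "summable (\<lambda>j. DBM_term (n, X, T) (n', X', T) (int j))"
proof -
  define k where "k = n - n'"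
  \<comment> \<open>Dropping J terms does not affect summability and yields X^2 < n' + J, strictly
    because n' > 0.\<close>
  define J where "J = nat \<lceil>X\<^sup>2\<rceil>"
  have k: "1 \<le> k" "X \<noteq> X' \<or> 2 \<le> k"
    using n X by (auto simp: k_def)
  have p: "X\<^sup>2 < real (n' + J)"
    using n unfolding J_def by linarith
  \<comment> \<open>N = 2 makes \<rho> = sqrt (N / 2) = 1, and equal times make \<kappa> = 1. The
    levels are then written as 2 + (n - 2), hence the hypothesis 2 <= n'.\<close>
  let ?C = "exp (- real 2 * (T - T)) * real 2 powr ((real (n - 2) - real (n' - 2)) / 2) * (2 * real 2) powr (- 1 / 2)"
  let ?f = "\<lambda>j. of_real (hcoeff X 1 (n' + J + k + j)) *
     (LBINT v. Complex (X / 2) v ^ (n' + J + j) * gexp (- 2 * X' * 1) (2 * 1\<^sup>2) (Complex (X / 2) v))"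
  have eq: "complex_of_real (?C * DBM_term (n, X, T) (n', X', T) (int (j + J))) = of_real (1 / (2 * pi)) * ?f j" for j
  proof -
    have m: "int (n' + J + k + j) = int (2 + (n - 2)) + int (j + J)" "int (n' + J + j) = int (2 + (n' - 2)) +
        int (j + J)"
      using n by (auto simp: k_def)
    have "2 + (n - 2) = n" "2 + (n' - 2) = n'"
      using n by auto
    with scaled_DBM_term[OF _ m, of T T X X' "X / 2"] show ?thesis
      by simp
  qed
  have C: "?C \<noteq> 0"
    by simp
  have "summable (\<lambda>j. of_real (1 / (2 * pi)) * ?f j)"
    using convergent_hermite_series[OF k p] by (rule summable_mult)
  then have "summable (\<lambda>j. complex_of_real (?C * DBM_term (n, X, T) (n', X', T) (int (j + J))))"
    unfolding eq .
  then have "summable (\<lambda>j. ?C * DBM_term (n, X, T) (n', X', T) (int (j + J)))"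
    using summable_Re by fastforce
  then have "summable (\<lambda>j. DBM_term (n, X, T) (n', X', T) (int (j + J)))"
    using summable_cmult_iff[of ?C] C by blast
  then show ?thesis
    using summable_iff_shift[of "\<lambda>j. DBM_term (n, X, T) (n', X', T) (int j)" J] by simp
qed

text \<open>A time shift d multiplies the j-th term by exp (- d)^j, so the kernels at positive time
  differences are the Abel means of the series at equal times.\<close>

lemma K_DBM_tendsto:
  assumes n: "n' < n" "2 \<le> n'" and X: "X \<noteq> X' \<or> n \<noteq> n' + 1" and e: "\<And>i. 0 < e i" "e
      \<longlonglongrightarrow> 0"
  shows "(\<lambda>i. K_DBM (n, X, T) (n', X', T + e i)) \<longlonglongrightarrow> K_DBM (n, X, T) (n', X', T)"
proof -
  have K: "K_DBM (n, X, T) (n', X', T + d) = - (\<Sum>j. DBM_term (n, X, T) (n', X', T) (int j) * exp (- d) ^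
      j)" for d
  proof -
    have "DBM_term (n, X, T) (n', X', T + d) (int j) = DBM_term (n, X, T) (n', X', T) (int j) * exp (- d) ^ j" for j
      by (simp add: DBM_term_def flip: exp_of_nat_mult)
    then show ?thesis
      using n by (simp add: K_DBM_def precedes_def)
  qed
  have "(\<lambda>i. exp (- e i)) \<longlonglongrightarrow> exp (- 0)"
    by (intro tendsto_intros e)
  then have "(\<lambda>i. \<Sum>j. DBM_term (n, X, T) (n', X', T) (int j) * exp (- e i) ^ j)
      \<longlonglongrightarrow> (\<Sum>j. DBM_term (n, X, T) (n', X', T) (int j))"
    using e by (intro Abel_limit summable_DBM_term n X) auto
  then have "(\<lambda>i. K_DBM (n, X, T) (n', X', T + e i)) \<longlonglongrightarrow> - (\<Sum>j. DBM_term (n,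
      X, T) (n', X', T) (int j))"
    unfolding K by (rule tendsto_minus)
  then show ?thesis
    using K[of 0] by simp
qed

lemma scaled_DBM_tendsto:
  assumes n: "n' < n" and N: "2 \<le> N" and x: "x \<noteq> x' \<or> n \<noteq> n' + 1" and e: "\<And>i. 0 < e
      i" "e \<longlonglongrightarrow> 0"
  shows "(\<lambda>i. scaled_DBM a N (n, x, t) (n', x', t + e i)) \<longlonglongrightarrow> scaled_DBM a N (n,
      x, t) (n', x', t)"
proof -
  have "(\<lambda>i. K_DBM (N + n, edge_pos a N x, t / (2 * real N)) (N + n', edge_pos a N x', t / (2 * real N)
      + e i / (2 * real N)))
     \<longlonglongrightarrow> K_DBM (N + n, edge_pos a N x, t / (2 * real N)) (N + n', edge_pos a N x', t / (2
         * real N))"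
  proof (rule K_DBM_tendsto)
    show "edge_pos a N x \<noteq> edge_pos a N x' \<or> N + n \<noteq> N + n' + 1"
      using x N by (auto simp: edge_pos_def)
    show "0 < e i / (2 * real N)" for i
      using e N by simp
    show "(\<lambda>i. e i / (2 * real N)) \<longlonglongrightarrow> 0"
      using tendsto_divide[OF e(2) tendsto_const, of "2 * real N"] N by simp
  qed (use n N in auto)
  then have K: "(\<lambda>i. K_DBM (N + n, edge_pos a N x, t / (2 * real N)) (N + n', edge_pos a N x', (t + e
      i) / (2 * real N)))
     \<longlonglongrightarrow> K_DBM (N + n, edge_pos a N x, t / (2 * real N)) (N + n', edge_pos a N x', t / (2
         * real N))"
    by (simp add: add_divide_distrib)
  have "(\<lambda>i. exp (- real N * ((t + e i) / (2 * real N) - t / (2 * real N)))) \<longlonglongrightarrow>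
      exp (- real N * ((t + 0) / (2 * real N) - t / (2 * real N)))"
    using N by (intro tendsto_intros e) auto
  then have E: "(\<lambda>i. exp (- real N * ((t + e i) / (2 * real N) - t / (2 * real N))))
      \<longlonglongrightarrow> exp (- real N * (t / (2 * real N) - t / (2 * real N)))"
    by simp
  show ?thesis
    unfolding scaled_DBM_def prod.case by (intro tendsto_of_real tendsto_mult tendsto_const K E)
qed

section \<open>Continuity of the bead kernel as the time difference vanishes\<close>

lemma isCont_H: "isCont (H (Suc j)) q" if "q \<noteq> 0 \<or> 1 \<le> j"
proof (cases "q = 0")
  case False
  show ?thesis
  proof (cases "0 < q")
    case True
    have "\<forall>\<^sub>F y in nhds q. y ^ j / fact j = H (Suc j) y"
      using eventually_nhds_in_open[of "{0<..}" q] True by (auto elim!: eventually_mono simp: H_def)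
    moreover have "isCont (\<lambda>y. y ^ j / fact j) q"
      by (intro continuous_intros) auto
    ultimately show ?thesis
      by (rule isCont_cong[THEN iffD1])
  next
    case False
    have "\<forall>\<^sub>F y in nhds q. 0 = H (Suc j) y"
      using eventually_nhds_in_open[of "{..<0}" q] False \<open>q \<noteq> 0\<close> by (auto elim!:
          eventually_mono simp: H_def)
    moreover have "isCont (\<lambda>y. 0 :: real) q"
      by simp
    ultimately show ?thesis
      by (rule isCont_cong[THEN iffD1])
  qed
next
  case True
  then have j: "1 \<le> j"
    using that by auto
  have "H (Suc j) = (\<lambda>y. max 0 y ^ j / fact j)"
    using j by (auto simp: H_def max_def)
  then show ?thesis
    by (auto intro!: continuous_intros)
qed

lemma H_abs_le: "\<bar>H (Suc j) q\<bar> \<le> exp \<bar>q\<bar>"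
  using power_div_fact_le_exp[of q j] by (auto simp: H_def)

text \<open>After the substitution the density no longer depends on s, so a single majorant serves
  the limit s -> 0.\<close>

lemma H_conv_eq_expectation:
  assumes s: "0 < s"
  shows "H_conv (Suc j) (2 * s) x z = (LBINT y. H (Suc j) (x - z - sqrt s * y) * std_normal_density y)"
proof -
  have "H_conv (Suc j) (2 * s) x z = (LBINT y. H (Suc j) (x - y) * bm_density (2 * s) y z)"
    using s by (simp add: H_conv_def)
  also have "\<dots> = \<bar>sqrt s\<bar> *\<^sub>R (LBINT y. H (Suc j) (x - (z + sqrt s * y)) * bm_density (2
      * s) (z + sqrt s * y) z)"
    using s by (intro lborel_integral_real_affine) auto
  also have "\<dots> = (LBINT y. sqrt s * (H (Suc j) (x - (z + sqrt s * y)) * bm_density (2 * s) (z + sqrt s * y) z))"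
    using s by simp
  also have "\<dots> = (LBINT y. H (Suc j) (x - z - sqrt s * y) * std_normal_density y)"
  proof (rule Bochner_Integration.integral_cong)
    fix y
    have "sqrt s * bm_density (2 * s) (z + sqrt s * y) z = std_normal_density y"
      using s by (simp add: bm_density_def std_normal_density_def power_mult_distrib real_sqrt_mult field_simps)
    then show "sqrt s * (H (Suc j) (x - (z + sqrt s * y)) * bm_density (2 * s) (z + sqrt s * y) z) = H (Suc j)
        (x - z - sqrt s * y) * std_normal_density y"
      by (simp add: mult_ac diff_diff_eq)
  qed simp
  finally show ?thesis .
qed

text \<open>In the excluded case j = 0, x = x' the limit would be 1/2: fluctuations of order sqrt s
  dominate the drift a s.\<close>

lemma H_conv_tendsto:
  assumes x: "x \<noteq> x' \<or> 1 \<le> j" and s: "\<And>i. 0 < s i" "s \<longlonglongrightarrow> 0"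
  shows "(\<lambda>i. H_conv (Suc j) (2 * s i) x (x' + a * s i)) \<longlonglongrightarrow> H (Suc j) (x - x')"
proof -
  obtain S where S: "\<And>i. s i \<le> S"
    using convergent_imp_Bseq[OF convergentI[OF s(2)]] unfolding Bseq_def by (auto simp: abs_le_iff)
  have S0: "0 \<le> S"
    using S[of 0] s(1)[of 0] by linarith
  let ?h = "\<lambda>i y. H (Suc j) (x - (x' + a * s i) - sqrt (s i) * y) * std_normal_density y"
  define w where "w = (\<lambda>y. exp (\<bar>x - x'\<bar> + \<bar>a\<bar> * S) / sqrt (2 * pi) * exp (sqrt S *
      \<bar>y\<bar> - 1 / 2 * y\<^sup>2))"
  have "(\<lambda>i. LBINT y. ?h i y) \<longlonglongrightarrow> (LBINT y. H (Suc j) (x - x') * std_normal_density y)"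
  proof (rule integral_dominated_convergence[where w=w])
    show "integrable lborel w"
      unfolding w_def by (intro integrable_mult_right integrable_exp_abs_gauss) auto
    show "AE y in lborel. (\<lambda>i. ?h i y) \<longlonglongrightarrow> H (Suc j) (x - x') * std_normal_density y"
    proof (intro AE_I2 tendsto_mult tendsto_const)
      fix y
      have "(\<lambda>i. x - (x' + a * s i) - sqrt (s i) * y) \<longlonglongrightarrow> x - (x' + a * 0) - sqrt 0 * y"
        by (intro tendsto_intros s)
      then have "(\<lambda>i. x - (x' + a * s i) - sqrt (s i) * y) \<longlonglongrightarrow> x - x'"
        by simp
      then show "(\<lambda>i. H (Suc j) (x - (x' + a * s i) - sqrt (s i) * y)) \<longlonglongrightarrow> H (Suc
          j) (x - x')"
        using x by (intro isCont_tendsto_compose[OF isCont_H]) auto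
    qed
    show "AE y in lborel. norm (?h i y) \<le> w y" for i
    proof (intro AE_I2)
      fix y
      have "\<bar>x - (x' + a * s i) - sqrt (s i) * y\<bar> \<le> \<bar>x - x'\<bar> + \<bar>a\<bar> * S + sqrt
          S * \<bar>y\<bar>"
      proof -
        have "\<bar>a * s i\<bar> \<le> \<bar>a\<bar> * S" "\<bar>sqrt (s i) * y\<bar> \<le> sqrt S * \<bar>y\<bar>"
          using S[of i] s(1)[of i] by (auto simp: abs_mult intro!: mult_left_mono mult_right_mono)
        then show ?thesis by linarith
      qed
      then have "\<bar>H (Suc j) (x - (x' + a * s i) - sqrt (s i) * y)\<bar> \<le> exp (\<bar>x - x'\<bar> +
          \<bar>a\<bar> * S + sqrt S * \<bar>y\<bar>)"
        by (intro order.trans[OF H_abs_le]) simp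
      then have "norm (?h i y) \<le> exp (\<bar>x - x'\<bar> + \<bar>a\<bar> * S + sqrt S * \<bar>y\<bar>) *
          std_normal_density y"
        by (simp add: abs_mult mult_right_mono)
      also have "\<dots> = w y"
      proof -
        have "exp (sqrt S * \<bar>y\<bar> - 1 / 2 * y\<^sup>2) = exp (sqrt S * \<bar>y\<bar>) * exp (- y\<^sup>2 / 2)"
          unfolding exp_add[symmetric] by simp
        then show ?thesis
          by (simp add: w_def std_normal_density_def exp_add)
      qed
      finally show "norm (?h i y) \<le> w y" .
    qed
  qed measurable
  moreover have "(LBINT y. H (Suc j) (x - x') * std_normal_density y) = H (Suc j) (x - x')"
    by simp
  ultimately show ?thesis
    unfolding H_conv_eq_expectation[OF s(1)] by simp
qed

lemma valid_path_bead_contour: "valid_path (bead_contour a n n')"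
  by (simp add: bead_contour_def)

text \<open>For n' < n the integrand has a pole at 0: the segment keeps the distance a from it, the
  arc the distance 1.\<close>

lemma bead_contour_image:
  assumes a: "\<bar>a\<bar> < 1" and n: "n' < n" and u: "u \<in> path_image (bead_contour a n n')"
  shows "norm u \<le> 1" "(if 0 < a then a else 1) \<le> norm u"
proof -
  have u1: "norm (u_plus a) = 1" "norm (u_minus a) = 1"
    unfolding u_plus_minus_eq_exp[OF a] by (simp_all only: norm_exp_i_times)
  have "norm u \<le> 1 \<and> (if 0 < a then a else 1) \<le> norm u"
  proof (cases "0 < a")
    case True
    then have uc: "u \<in> closed_segment (u_minus a) (u_plus a)"
      using u by (simp add: bead_contour_def)
    have "closed_segment (u_minus a) (u_plus a) \<subseteq> cball 0 1"
      using u1 by (intro closed_segment_subset) auto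
    then have "norm u \<le> 1"
      using uc by auto
    moreover obtain r where "u = (1 - r) *\<^sub>R u_minus a + r *\<^sub>R u_plus a"
      using uc by (auto simp: closed_segment_def)
    then have "Re u = (1 - r) * a + r * a"
      by (simp add: u_plus_def u_minus_def)
    then have "Re u = a"
      by (simp add: algebra_simps)
    then have "a \<le> norm u"
      using complex_Re_le_cmod[of u] by simp
    ultimately show ?thesis
      using True by simp
  next
    case False
    have "0 \<le> arccos a"
      using a by (intro arccos_lbound) auto
    with False u n show ?thesis
      by (auto simp: bead_contour_def path_image_part_circlepath norm_mult)
  qed
  then show "norm u \<le> 1" "(if 0 < a then a else 1) \<le> norm u"
    by auto
qed

lemma bounded_deriv_bead_contour:
  obtains D where "\<And>r. r \<in> {0..1} \<Longrightarrow> norm (vector_derivative (bead_contour a n n') (at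
      r)) \<le> D"
proof (cases "a > 0 \<or> n \<le> n'")
  case True
  show thesis
    by (rule that[of "norm (u_plus a - u_minus a)"]) (use True in \<open>simp add: bead_contour_def\<close>)
next
  case False
  show thesis
    by (rule that[of "norm (of_real (arccos a - - arccos a) :: complex)"])
       (use False in \<open>simp add: bead_contour_def vector_derivative_part_circlepath norm_mult\<close>)
qed

lemma bead_contour_integral_tendsto:
  assumes a: "\<bar>a\<bar> < 1" and n: "n' < n" and e: "\<And>i. 0 < e i" "e \<longlonglongrightarrow> 0"
  shows "(\<lambda>i. contour_integral (bead_contour a n n') (\<lambda>u. gexp (y - a * e i) (e i) u / u ^ k))
      \<longlonglongrightarrow>
    contour_integral (bead_contour a n n') (\<lambda>u. gexp y 0 u / u ^ k)"
proof -
  let ?g = "bead_contour a n n'"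
  define m where "m = (if 0 < a then a else 1)"
  have m: "0 < m"
    by (simp add: m_def)
  note im = bead_contour_image[OF a n, folded m_def]
  obtain S where S: "\<And>i. e i \<le> S"
    using convergent_imp_Bseq[OF convergentI[OF e(2)]] unfolding Bseq_def by (auto simp: abs_le_iff)
  define M where "M = \<bar>y\<bar> + 2 * S"
  obtain D where D: "\<And>r. r \<in> {0..1} \<Longrightarrow> norm (vector_derivative ?g (at r)) \<le> D"
    by (rule bounded_deriv_bead_contour[of a n n']) (rule that; assumption)
  have bound: "norm (gexp (y - a * e i) (e i) u / u ^ k - gexp y 0 u / u ^ k) \<le> exp M * 2 / m ^ k * e i" if
      u: "u \<in> path_image ?g" for i u
  proof -
    obtain b v where bv: "u = Complex b v"
      by (cases u)
    have nu: "norm u \<le> 1" "(norm u)\<^sup>2 \<le> 1"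
      using im(1)[OF u] by (auto intro: power_le_one)
    then have v: "b\<^sup>2 + v\<^sup>2 \<le> 1"
      by (simp add: bv cmod_power2)
    have b: "\<bar>b\<bar> \<le> 1"
      using order.trans[OF abs_Re_le_cmod nu(1)] by (simp add: bv)
    have ae: "\<bar>a * e i\<bar> \<le> e i"
      using a e(1)[of i] by (simp add: abs_mult mult_left_le_one_le)
    have yb: "z * b \<le> \<bar>z\<bar>" for z
      by (rule order.trans[OF abs_ge_self]) (use b in \<open>simp add: abs_mult mult_left_le\<close>)
    have "norm (of_real (exp 0) * gexp (y - a * e i) (e i) (Complex b v) - gexp y 0 (Complex b v)) \<le>
       exp M * (\<bar>0\<bar> + \<bar>(y - a * e i) - y\<bar> * norm (Complex b v) + \<bar>e i - 0\<bar> / 2 *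
           (norm (Complex b v))\<^sup>2)"
    proof (rule gexp_diff_le)
      have "e i / 2 * (b\<^sup>2 - v\<^sup>2) \<le> e i / 2 * 1"
      proof (rule mult_left_mono)
        show "b\<^sup>2 - v\<^sup>2 \<le> 1"
          using v zero_le_power2[of v] by linarith
      qed (use e(1)[of i] in simp)
      then show "0 + (y - a * e i) * b + e i / 2 * (b\<^sup>2 - v\<^sup>2) \<le> M"
        using yb[of "y - a * e i"] ae S[of i] e(1)[of i] unfolding M_def by linarith
      show "y * b + 0 / 2 * (b\<^sup>2 - v\<^sup>2) \<le> M"
        using yb[of y] S[of i] e(1)[of i] unfolding M_def by simp
    qed
    also have "\<dots> \<le> exp M * (0 + e i * 1 + e i * 1)"
      using ae nu e(1)[of i] unfolding bv by (intro mult_left_mono add_mono mult_mono) auto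
    finally have "norm (gexp (y - a * e i) (e i) u - gexp y 0 u) \<le> exp M * 2 * e i"
      by (simp add: bv)
    moreover have "m ^ k \<le> norm u ^ k"
      using im(2)[OF u] m by (intro power_mono) auto
    ultimately have "norm (gexp (y - a * e i) (e i) u - gexp y 0 u) / norm u ^ k \<le> exp M * 2 * e i / m ^ k"
      using m e(1)[of i] by (intro frac_le) auto
    then show ?thesis
      by (simp add: norm_divide norm_power flip: diff_divide_distrib)
  qed
  have nz: "u \<noteq> 0" if "u \<in> path_image ?g" for u
    using im(2)[OF that] m by auto
  show ?thesis
  proof (rule contour_integral_uniform_limit(2)[OF _ _ D valid_path_bead_contour])
    show "\<forall>\<^sub>F i in sequentially. (\<lambda>u. gexp (y - a * e i) (e i) u / u ^ k)
        contour_integrable_on ?g"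
    proof (intro always_eventually allI)
      fix i
      have "continuous_on (path_image ?g) (\<lambda>u. gexp (y - a * e i) (e i) u / u ^ k)"
        using nz by (intro continuous_intros) auto
      then show "(\<lambda>u. gexp (y - a * e i) (e i) u / u ^ k) contour_integrable_on ?g"
        by (auto simp: bead_contour_def intro: contour_integrable_continuous_linepath
            contour_integrable_continuous_part_circlepath)
    qed
    show "uniform_limit (path_image ?g) (\<lambda>i u. gexp (y - a * e i) (e i) u / u ^ k) (\<lambda>u. gexp y
        0 u / u ^ k) sequentially"
    proof (rule uniform_limitI)
      fix \<epsilon> :: real assume "0 < \<epsilon>"
      moreover have "(\<lambda>i. exp M * 2 / m ^ k * e i) \<longlonglongrightarrow> exp M * 2 / m ^ k * 0"
        by (intro tendsto_intros e)
      ultimately have "\<forall>\<^sub>F i in sequentially. exp M * 2 / m ^ k * e i < \<epsilon>"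
        by (intro order_tendstoD(2)) auto
      then show "\<forall>\<^sub>F i in sequentially. \<forall>u\<in>path_image ?g. dist (gexp (y - a * e i) (e
          i) u / u ^ k) (gexp y 0 u / u ^ k) < \<epsilon>"
        by eventually_elim (use bound in \<open>auto simp: dist_norm intro: le_less_trans\<close>)
    qed
  qed auto
qed

lemma K_Bead_tendsto:
  assumes a: "\<bar>a\<bar> < 1" and n: "n' < n" and x: "x \<noteq> x' \<or> n \<noteq> n' + 1" and e:
      "\<And>i. 0 < e i" "e \<longlonglongrightarrow> 0"
  shows "(\<lambda>i. K_Bead a (n, x, t) (n', x', t + e i)) \<longlonglongrightarrow> K_Bead a (n, x, t) (n', x', t)"
proof -
  obtain j where j: "n - n' = Suc j"
    using n by (metis Suc_diff_Suc)
  have p: "precedes (n, x, t) (n', x', t')" for t'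
    using n by (simp add: precedes_def)
  have K: "K_Bead a (n, x, t) (n', x', t + d) = - of_real (H_conv (Suc j) (2 * d) x (x' + a * d)) +
    1 / (2 * of_real pi * \<i>) * contour_integral (bead_contour a n n') (\<lambda>u. gexp (x - x' - a * d) d u
        / u ^ Suc j)" for d
    using K_Bead_eq_precedes[OF less_imp_le[OF n] p[of "t + d"], of a] by (simp add: j)
  have "H_conv (Suc j) (2 * 0) x (x' + a * 0) = H (Suc j) (x - x')"
    by (simp add: H_conv_def)
  moreover have "(\<lambda>i. H_conv (Suc j) (2 * e i) x (x' + a * e i)) \<longlonglongrightarrow> H (Suc j) (x - x')"
    using x j n by (intro H_conv_tendsto e) auto
  ultimately have "(\<lambda>i. K_Bead a (n, x, t) (n', x', t + e i)) \<longlonglongrightarrow> K_Bead a (n, x,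
      t) (n', x', t + 0)"
    unfolding K using bead_contour_integral_tendsto[OF a n e, of "x - x'" "Suc j"]
    by (intro tendsto_add tendsto_minus tendsto_of_real tendsto_mult tendsto_const) simp_all
  then show ?thesis
    by simp
qed

text \<open>At fixed N both kernels converge pointwise as t' decreases to t, and a bound with one K
  for all 0 < t' - t <= 1 is a closed condition. Therefore K is uniform in x and x' although the
  convergence used is not.\<close>

lemma scaled_DBM_bound_equal_times:
  fixes n n' :: nat and a B :: real
  assumes a: "\<bar>a\<bar> < 1" and n: "n' < n"
  obtains K N0 where "\<And>N x t x'. \<lbrakk>N0 \<le> N; \<bar>x\<bar> \<le> B; \<bar>x'\<bar> \<le> B; x
      \<noteq> x' \<or> n \<noteq> n' + 1\<rbrakk> \<Longrightarrow>
    norm (scaled_DBM a N (n, x, t) (n', x', t) - K_Bead a (n, x, t) (n', x', t)) \<le> K / sqrt (real N)"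
proof -
  obtain K N0 where K: "\<And>N x t x' t'. \<lbrakk>N0 \<le> N; t < t'; t' - t \<le> 1; \<bar>x\<bar> \<le> B;
      \<bar>x'\<bar> \<le> B\<rbrakk> \<Longrightarrow>
    norm (scaled_DBM a N (n, x, t) (n', x', t') - K_Bead a (n, x, t) (n', x', t')) \<le> K / sqrt (real N)"
    by (rule scaled_DBM_bound_outside[OF a less_imp_le[OF n], of 1 B]) (rule that; assumption)
  define e where "e = (\<lambda>i. inverse (real (Suc i)))"
  have e: "0 < e i" "e i \<le> 1" for i
    by (auto simp: e_def inverse_le_1_iff)
  have e0: "e \<longlonglongrightarrow> 0"
    unfolding e_def by (rule LIMSEQ_inverse_real_of_nat)
  show thesis
  proof (rule that[of "max 2 N0"])
    fix N x t x' assume *: "max 2 N0 \<le> N" "\<bar>x\<bar> \<le> B" "\<bar>x'\<bar> \<le> B" "x \<noteq> x'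
        \<or> n \<noteq> n' + 1"
    have "(\<lambda>i. norm (scaled_DBM a N (n, x, t) (n', x', t + e i) - K_Bead a (n, x, t) (n', x', t + e
        i))) \<longlonglongrightarrow>
        norm (scaled_DBM a N (n, x, t) (n', x', t) - K_Bead a (n, x, t) (n', x', t))"
      using * by (intro tendsto_norm tendsto_diff scaled_DBM_tendsto K_Bead_tendsto a n e e0) auto
    then show "norm (scaled_DBM a N (n, x, t) (n', x', t) - K_Bead a (n, x, t) (n', x', t)) \<le> K / sqrt (real N)"
      by (rule LIMSEQ_le_const2) (use * e in \<open>auto intro!: K\<close>)
  qed
qed

section \<open>From fixed levels to uniform convergence on compact sets\<close>

lemma eventually_scaled_DBM_near:
  fixes n n' :: nat and a b \<epsilon> :: real
  assumes a: "\<bar>a\<bar> < 1" and \<epsilon>: "0 < \<epsilon>"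
  shows "\<forall>\<^sub>F N in sequentially. \<forall>x t x' t'. \<bar>x\<bar> \<le> b \<longrightarrow>
      \<bar>x'\<bar> \<le> b \<longrightarrow> \<bar>t\<bar> \<le> b \<longrightarrow> \<bar>t'\<bar> \<le> b
          \<longrightarrow>
    space_like (n, x, t) (n', x', t') \<longrightarrow> \<not> at_jump (n, x, t) (n', x', t') \<longrightarrow>
    dist (scaled_DBM a N (n, x, t) (n', x', t')) (K_Bead a (n, x, t) (n', x', t')) < \<epsilon>"
proof -
  have small: "\<forall>\<^sub>F N in sequentially. K / sqrt (real N) < \<epsilon>" for K
  proof -
    have "(\<lambda>N. K / sqrt (real N)) \<longlonglongrightarrow> 0"
      by real_asymp
    then show ?thesis
      using \<epsilon> by (rule order_tendstoD(2))
  qed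
  show ?thesis
  proof (cases "n \<le> n'")
    case True
    obtain K N0 where K: "\<And>N x t x' t'. \<lbrakk>N0 \<le> N; \<bar>t' - t\<bar> \<le> 2 * b; \<bar>x\<bar>
        \<le> b; \<bar>x'\<bar> \<le> b; \<not> precedes (n, x, t) (n', x', t')\<rbrakk> \<Longrightarrow>
        norm (scaled_DBM a N (n, x, t) (n', x', t') - K_Bead a (n, x, t) (n', x', t')) \<le> K / sqrt (real N)"
      by (rule scaled_DBM_bound_inside[OF a True, of "2 * b" b]) (rule that; assumption)
    \<comment> \<open>The premise n' <= n sits inside the statement; for n < n' it is vacuous and
      any constants do.\<close>
    obtain K' N0' where K': "\<And>N x t x' t'. \<lbrakk>N0' \<le> N; n' \<le> n; t < t'; t' - t \<le> 2 * b;
        \<bar>x\<bar> \<le> b; \<bar>x'\<bar> \<le> b\<rbrakk> \<Longrightarrow>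
        norm (scaled_DBM a N (n, x, t) (n', x', t') - K_Bead a (n, x, t) (n', x', t')) \<le> K' / sqrt (real N)"
    proof (cases "n' \<le> n")
      case True
      show thesis
        by (rule scaled_DBM_bound_outside[OF a True, of "2 * b" b]) (rule that; assumption)
    qed (use that in auto)
    show ?thesis
      using eventually_ge_at_top[of N0] eventually_ge_at_top[of N0'] small[of K] small[of K']
    proof eventually_elim
      case (elim N)
      show ?case
      proof (intro allI impI)
        fix x t x' t'
        assume *: "\<bar>x\<bar> \<le> b" "\<bar>x'\<bar> \<le> b" "\<bar>t\<bar> \<le> b" "\<bar>t'\<bar> \<le> b"
        have t: "\<bar>t' - t\<bar> \<le> 2 * b"
          using * by linarith
        show "dist (scaled_DBM a N (n, x, t) (n', x', t')) (K_Bead a (n, x, t) (n', x', t')) < \<epsilon>"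
        proof (cases "precedes (n, x, t) (n', x', t')")
          case True
          then have "n' \<le> n" "t < t'"
            using \<open>n \<le> n'\<close> by (auto simp: precedes_def)
          then show ?thesis
            using K'[of N t t' x x'] elim * t by (simp add: dist_norm)
        next
          case False
          then show ?thesis
            using K[of N t' t x x'] elim * t by (simp add: dist_norm)
        qed
      qed
    qed
  next
    case False
    then have n: "n' < n" by simp
    obtain K N0 where K: "\<And>N x t x'. \<lbrakk>N0 \<le> N; \<bar>x\<bar> \<le> b; \<bar>x'\<bar> \<le> b; x
        \<noteq> x' \<or> n \<noteq> n' + 1\<rbrakk> \<Longrightarrow>
        norm (scaled_DBM a N (n, x, t) (n', x', t) - K_Bead a (n, x, t) (n', x', t)) \<le> K / sqrt (real N)"
      by (rule scaled_DBM_bound_equal_times[OF a n, of b]) (rule that; assumption)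
    obtain K' N0' where K': "\<And>N x t x' t'. \<lbrakk>N0' \<le> N; t < t'; t' - t \<le> 2 * b; \<bar>x\<bar>
        \<le> b; \<bar>x'\<bar> \<le> b\<rbrakk> \<Longrightarrow>
        norm (scaled_DBM a N (n, x, t) (n', x', t') - K_Bead a (n, x, t) (n', x', t')) \<le> K' / sqrt (real N)"
      by (rule scaled_DBM_bound_outside[OF a less_imp_le[OF n], of "2 * b" b]) (rule that; assumption)
    show ?thesis
      using eventually_ge_at_top[of N0] eventually_ge_at_top[of N0'] small[of K] small[of K']
    proof eventually_elim
      case (elim N)
      show ?case
      proof (intro allI impI)
        fix x t x' t'
        assume *: "\<bar>x\<bar> \<le> b" "\<bar>x'\<bar> \<le> b" "\<bar>t\<bar> \<le> b" "\<bar>t'\<bar> \<le> b"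
          and sl: "space_like (n, x, t) (n', x', t')" and nj: "\<not> at_jump (n, x, t) (n', x', t')"
        \<comment> \<open>Space-likeness excludes t' < t, where the weights exp (- l (t' - t)) of
          the infinite sum would grow with l.\<close>
        have "t \<le> t'"
          using sl n by (auto simp: space_like_def)
        then consider "t < t'" | "t' = t"
          by linarith
        then show "dist (scaled_DBM a N (n, x, t) (n', x', t')) (K_Bead a (n, x, t) (n', x', t')) < \<epsilon>"
        proof cases
          case 1
          have "t' - t \<le> 2 * b"
            using * by linarith
          then show ?thesis
            using K'[of N t t' x x'] elim * 1 by (simp add: dist_norm)
        next
          case 2
          have "x \<noteq> x' \<or> n \<noteq> n' + 1"
            using nj 2 by (auto simp: at_jump_def)
          then show ?thesis
            using K[of N x x' t] elim * 2 by (simp add: dist_norm)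
        qed
      qed
    qed
  qed
qed

lemma compact_nat_imp_finite:
  fixes S :: "nat set"
  assumes "compact S"
  shows "finite S"
  by (rule compactE_image[OF assms, of UNIV "\<lambda>n. {n}"]) (auto intro:
      discrete_topology_class.open_discrete finite_subset)

text \<open>A compact set meets finitely many levels, the topology on them being discrete, and has
  bounded positions and times; hence finitely many estimates at fixed levels suffice.\<close>

theorem theorem1p3:
  fixes a :: real and C :: "(point \<times> point) set"
  assumes "-1 < a" and "a < 1" and "compact C"
  shows "uniform_limit {(p, p') \<in> C. space_like p p' \<and> \<not> at_jump p p'}
    (\<lambda>N ((n, x, t), (n', x', t')). complex_of_real
       (exp (- real N * (t' / (2 * real N) - t / (2 * real N))) *
        real N powr ((real n - real n') / 2) * (2 * real N) powr (- 1 / 2) *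
        K_DBM (N + n, sqrt (2 * real N) * a + x / sqrt (2 * real N), t / (2 * real N))
              (N + n', sqrt (2 * real N) * a + x' / sqrt (2 * real N), t' / (2 * real N))))
    (\<lambda>(p, p'). K_Bead a p p') sequentially"
proof (rule uniform_limitI)
  fix \<epsilon> :: real assume \<epsilon>: "0 < \<epsilon>"
  have a: "\<bar>a\<bar> < 1"
    using assms by auto
  have fin: "finite ((\<lambda>z. fst (fst z)) ` C)" "finite ((\<lambda>z. fst (snd z)) ` C)"
    by (intro compact_nat_imp_finite compact_continuous_image assms(3) continuous_intros)+
  have bdd: "\<exists>b. \<forall>z\<in>C. \<bar>f z\<bar> \<le> b" if "continuous_on C f" for f :: "point
      \<times> point \<Rightarrow> real"
    using compact_imp_bounded[OF compact_continuous_image[OF that assms(3)]] by (auto simp: bounded_real)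
  have cont: "continuous_on C (\<lambda>z. fst (snd (fst z)))" "continuous_on C (\<lambda>z. snd (snd (fst z)))"
    "continuous_on C (\<lambda>z. fst (snd (snd z)))" "continuous_on C (\<lambda>z. snd (snd (snd z)))"
    by (intro continuous_intros)+
  obtain b1 b2 b3 b4 where b: "\<forall>z\<in>C. \<bar>fst (snd (fst z))\<bar> \<le> b1" "\<forall>z\<in>C.
      \<bar>snd (snd (fst z))\<bar> \<le> b2"
    "\<forall>z\<in>C. \<bar>fst (snd (snd z))\<bar> \<le> b3" "\<forall>z\<in>C. \<bar>snd (snd (snd z))\<bar>
        \<le> b4"
    using bdd[OF cont(1)] bdd[OF cont(2)] bdd[OF cont(3)] bdd[OF cont(4)] by blast
  define b where "b = max (max b1 b2) (max b3 b4)"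
  have C: "(n, n') \<in> (\<lambda>z. fst (fst z)) ` C \<times> (\<lambda>z. fst (snd z)) ` C" "\<bar>x\<bar>
      \<le> b" "\<bar>x'\<bar> \<le> b" "\<bar>t\<bar> \<le> b" "\<bar>t'\<bar> \<le> b"
    if "((n, x, t), (n', x', t')) \<in> C" for n x t n' x' t'
    using b[THEN bspec, OF that] that by (force simp: b_def)+
  define R where "R = (\<lambda>N n n'. \<forall>x t x' t'. \<bar>x\<bar> \<le> b \<longrightarrow>
      \<bar>x'\<bar> \<le> b \<longrightarrow> \<bar>t\<bar> \<le> b \<longrightarrow> \<bar>t'\<bar> \<le> b
          \<longrightarrow>
    space_like (n, x, t) (n', x', t') \<longrightarrow> \<not> at_jump (n, x, t) (n', x', t') \<longrightarrow>
    dist (scaled_DBM a N (n, x, t) (n', x', t')) (K_Bead a (n, x, t) (n', x', t')) < \<epsilon>)"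
  have "\<forall>\<^sub>F N in sequentially. R N (fst m) (snd m)" for m
    unfolding R_def by (rule eventually_scaled_DBM_near[OF a \<epsilon>])
  then have "\<forall>\<^sub>F N in sequentially. \<forall>m\<in>(\<lambda>z. fst (fst z)) ` C \<times>
      (\<lambda>z. fst (snd z)) ` C. R N (fst m) (snd m)"
    by (intro eventually_ball_finite finite_cartesian_product fin) auto
  then show "\<forall>\<^sub>F N in sequentially. \<forall>z\<in>{(p, p') \<in> C. space_like p p' \<and>
      \<not> at_jump p p'}.
      dist ((\<lambda>((n, x, t), (n', x', t')). complex_of_real
       (exp (- real N * (t' / (2 * real N) - t / (2 * real N))) *
        real N powr ((real n - real n') / 2) * (2 * real N) powr (- 1 / 2) *
        K_DBM (N + n, sqrt (2 * real N) * a + x / sqrt (2 * real N), t / (2 * real N))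
              (N + n', sqrt (2 * real N) * a + x' / sqrt (2 * real N), t' / (2 * real N)))) z)
       (case z of (p, p') \<Rightarrow> K_Bead a p p') < \<epsilon>"
  proof (rule eventually_mono, intro ballI)
    fix N z
    assume R: "\<forall>m\<in>(\<lambda>z. fst (fst z)) ` C \<times> (\<lambda>z. fst (snd z)) ` C. R N (fst m)
        (snd m)"
      and z: "z \<in> {(p, p') \<in> C. space_like p p' \<and> \<not> at_jump p p'}"
    obtain n x t n' x' t' where zz: "z = ((n, x, t), (n', x', t'))"
      by (metis prod.exhaust)
    have zC: "((n, x, t), (n', x', t')) \<in> C" "space_like (n, x, t) (n', x', t')" "\<not> at_jump (n, x, t)
        (n', x', t')"
      using z by (auto simp: zz)
    have "R N n n'"
      using bspec[OF R C(1)[OF zC(1)]] by simp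
    then have "dist (scaled_DBM a N (n, x, t) (n', x', t')) (K_Bead a (n, x, t) (n', x', t')) < \<epsilon>"
      unfolding R_def using C(2-)[OF zC(1)] zC(2,3) by blast
    then show "dist ((\<lambda>((n, x, t), (n', x', t')). complex_of_real
       (exp (- real N * (t' / (2 * real N) - t / (2 * real N))) *
        real N powr ((real n - real n') / 2) * (2 * real N) powr (- 1 / 2) *
        K_DBM (N + n, sqrt (2 * real N) * a + x / sqrt (2 * real N), t / (2 * real N))
              (N + n', sqrt (2 * real N) * a + x' / sqrt (2 * real N), t' / (2 * real N)))) z)
       (case z of (p, p') \<Rightarrow> K_Bead a p p') < \<epsilon>"
      unfolding zz prod.case scaled_DBM_def edge_pos_def .
  qed
qed

end
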